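(* Let $M,N$ be differentiable manifolds and let $V=M\times N$ be the product manifold, with projection maps $\pi_M:V\to M$ and $\pi_N:V\to N$. Let $$\mathfrak{X}_N(V)=\{\mathbf{v}\in\mathfrak{X}(V)\mid \mathbf{v}(\pi_N^*h)=0\ \ \forall h\in C^\infty(N)\},\qquad \mathfrak{X}_M(V)=\{\mathbf{v}\in\mathfrak{X}(V)\mid \mathbf{v}(\pi_M^*g)=0\ \ \forall g\in C^\infty(M)\}$$ be the spaces of horizontal and vertical vector fields (with respect to the first factor). Let $\mathfrak{X}(M,N)$ and $\mathfrak{X}(N,M)$ be the spaces of smooth families of vector fields on $M$ parametrized by $N$ and on $N$ parametrized by $M$, respectively, and let $\iota_{\mathfrak{X}(M,N)}:\mathfrak{X}(M,N)\to\mathfrak{X}(V)$, $\pi_{\mathfrak{X}(M,N)}:\mathfrak{X}(V)\to\mathfrak{X}(M,N)$, $\iota_{\mathfrak{X}(N,M)}:\mathfrak{X}(N,M)\to\mathfrak{X}(V)$, $\pi_{\mathfrak{X}(N,M)}:\mathfrak{X}(V)\to\mathfrak{X}(N,M)$ be the maps defined in the context. Then: 1. Every vector field on $V$ decomposes into a horizontal and a vertical component: $$\mathfrak{X}(V)=\mathfrak{X}_N(V)\oplus\mathfrak{X}_M(V).$$ 2. The projection maps $\pi_{\mathfrak{X}_N(V)}:\mathfrak{X}(V)\to\mathfrak{X}_N(V)$ and $\pi_{\mathfrak{X}_M(V)}:\mathfrak{X}(V)\to\mathfrak{X}_M(V)$ associated with this direct sum decomposition are $$\pi_{\mathfrak{X}_N(V)}=\iota_{\mathfrak{X}(M,N)}\circ\pi_{\mathfrak{X}(M,N)},\qquad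 \pi_{\mathfrak{X}_M(V)}=\iota_{\mathfrak{X}(N,M)}\circ\pi_{\mathfrak{X}(N,M)}.$$ 3. The maps $\iota_{\mathfrak{X}(M,N)}$ and $\iota_{\mathfrak{X}(N,M)}$ give natural isomorphisms of $C^\infty(V)$-modules $$\iota_{\mathfrak{X}(M,N)}:\mathfrak{X}(M,N)\xrightarrow{\ \sim\ }\mathfrak{X}_N(V),\qquad \iota_{\mathfrak{X}(N,M)}:\mathfrak{X}(N,M)\xrightarrow{\ \sim\ }\mathfrak{X}_M(V).$$ 4. The following sequence of $C^\infty(V)$-modules is exact: $$0\rightarrow\mathfrak{X}(M,N)\xrightarrow{\ \iota_{\mathfrak{X}(M,N)}\ }\mathfrak{X}(V)\xrightarrow{\ \pi_{\mathfrak{X}(N,M)}\ }\mathfrak{X}(N,M)\rightarrow 0.$$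
   Context: Differentiable manifolds are finite-dimensional and smooth, with the usual conventions. $C^\infty(M)$ is the algebra of smooth real-valued functions on $M$. A smooth vector field on $M$ is a derivation of the algebra $C^\infty(M)$; the $C^\infty(M)$-module of all of them is $\mathfrak{X}(M)$. Embeddings. For $n_0\in N$, $i_{n_0}:M\to V$, $m\mapsto(m,n_0)$. For $m_0\in M$, $j_{m_0}:N\to V$, $n\mapsto(m_0,n)$. Smooth families of functions. A family $g=\{g_n\in C^\infty(M)\}_{n\in N}$ is a smooth family of functions if the function $f:V\to\mathbb{R}$, $f(m,n)=g_n(m)$, is in $C^\infty(V)$. The space of these is $C^\infty(M,N)$. The assignment $g\mapsto f$, with inverse $f\mapsto\{i_n^*f\}_{n\in N}$, is a canonical isomorphism $C^\infty(M,N)\cong C^\infty(V)$. Smooth families of vector fields. A family $\mathbf{w}=\{\mathbf{w}_n\in\mathfrak{X}(M)\}_{n\in N}$ is a smooth family of vector fields on $M$ if $\{g_n\}\mapsto\{\mathbf{w}_n(g_n)\}$ is a derivation of $C^\infty(M,N)$ (in particular, it maps smooth families of functions to smooth families of functions). The space of these is $\mathfrak{X}(M,N)$. It is a $C^\infty(V)$-module via $(f\cdot\mathbf{w})_n=(i_n^*f)\,\mathbf{w}_n$ for $f\in C^\infty(V)$. Maps. $\iota_{\mathfrak{X}(M,N)}:\mathfrak{X}(M,N)\to\mathfrak{X}(V)$ sends $\{\mathbf{w}_n\}$ to the vector field $\mathbf{v}$ determined by $$i_n^*(\mathbf{v}(f))=\mathbf{w}_n(i_n^*f)\quad\text{for all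 } f\in C^\infty(V),\ n\in N.$$ $\pi_{\mathfrak{X}(M,N)}:\mathfrak{X}(V)\to\mathfrak{X}(M,N)$ is the $C^\infty(V)$-linear map sending $\mathbf{v}$ to the family $\{\mathbf{w}_n\}$ given by $$\mathbf{w}_n(g)=i_n^*(\mathbf{v}(\pi_M^*g))\quad\text{for all } g\in C^\infty(M),\ n\in N.$$ Interchanging the roles of $M$ and $N$: $\mathfrak{X}(N,M)$ is the space of smooth families $\{\mathbf{u}_m\in\mathfrak{X}(N)\}_{m\in M}$, defined analogously with $j_m$ in place of $i_n$, with $C^\infty(V)$-module structure $(f\cdot\mathbf{u})_m=(j_m^*f)\,\mathbf{u}_m$. The map $\iota_{\mathfrak{X}(N,M)}$ sends $\{\mathbf{u}_m\}$ to the $\mathbf{v}\in\mathfrak{X}(V)$ with $j_m^*(\mathbf{v}(f))=\mathbf{u}_m(j_m^*f)$ for all $f\in C^\infty(V)$, $m\in M$. The map $\pi_{\mathfrak{X}(N,M)}$ sends $\mathbf{v}$ to $\{\mathbf{u}_m\}$ with $\mathbf{u}_m(h)=j_m^*(\mathbf{v}(\pi_N^*h))$ for all $h\in C^\infty(N)$, $m\in M$. *)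

theory Defs
  imports "HOL-Analysis.Analysis" "HOL-Algebra.AbelCoset" "HOL-Algebra.Module"
begin

section \<open>Smooth manifolds\<close>

text \<open>
  The model space of a manifold is a linear subspace \<open>E\<close> of a Euclidean space rather than a
  whole type of class \<open>euclidean_space\<close>: such types have dimension at least one, so that
  zero-dimensional manifolds would otherwise be excluded.

  \<open>Ck_on k E U f\<close> says that \<open>f\<close> is of class \<open>C\<^sup>k\<close> on \<open>U\<close>, which is meant to be relatively open
  in \<open>E\<close>. The derivative within \<open>U\<close> is then determined exactly in the directions of \<open>E\<close>, and
  these are the only directions used.
\<close>

primrec Ck_on ::
  "nat \<Rightarrow> 'e::euclidean_space set \<Rightarrow> 'e set \<Rightarrow> ('e \<Rightarrow> 'f::real_normed_vector) \<Rightarrow> bool"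
where
  "Ck_on 0 E U f \<longleftrightarrow> continuous_on U f"
| "Ck_on (Suc k) E U f \<longleftrightarrow>
     (\<exists>f'. (\<forall>x\<in>U. (f has_derivative f' x) (at x within U)) \<and>
           (\<forall>v\<in>E. Ck_on k E U (\<lambda>x. f' x v)))"

definition smooth_on ::
  "'e::euclidean_space set \<Rightarrow> 'e set \<Rightarrow> ('e \<Rightarrow> 'f::real_normed_vector) \<Rightarrow> bool"
where "smooth_on E U f \<longleftrightarrow> (\<forall>k. Ck_on k E U f)"

record ('a, 'e) manifold =
  mtop :: "'a topology"
  model :: "'e set"
  atlas :: "('a set \<times> ('a \<Rightarrow> 'e)) set"

abbreviation pts :: "('a, 'e) manifold \<Rightarrow> 'a set"
  where "pts M \<equiv> topspace (mtop M)"

definition smooth_manifold :: "('a, 'e::euclidean_space) manifold \<Rightarrow> bool" where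
  "smooth_manifold M \<longleftrightarrow>
     Hausdorff_space (mtop M) \<and> second_countable (mtop M) \<and>
     subspace (model M) \<and>
     (\<Union>(U, \<phi>)\<in>atlas M. U) = pts M \<and>
     (\<forall>(U, \<phi>)\<in>atlas M.
        openin (mtop M) U \<and> openin (top_of_set (model M)) (\<phi> ` U) \<and>
        homeomorphic_map (subtopology (mtop M) U) (top_of_set (\<phi> ` U)) \<phi>) \<and>
     (\<forall>(U, \<phi>)\<in>atlas M. \<forall>(W, \<psi>)\<in>atlas M.
        smooth_on (model M) (\<phi> ` (U \<inter> W)) (\<psi> \<circ> inv_into U \<phi>))"

definition prod_manifold ::
  "('a, 'e) manifold \<Rightarrow> ('b, 'f) manifold \<Rightarrow> ('a \<times> 'b, 'e \<times> 'f) manifold"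
where
  "prod_manifold M N =
     \<lparr>mtop = prod_topology (mtop M) (mtop N),
      model = model M \<times> model N,
      atlas = {(U \<times> W, map_prod \<phi> \<psi>) | U \<phi> W \<psi>. (U, \<phi>) \<in> atlas M \<and> (W, \<psi>) \<in> atlas N}\<rparr>"

section \<open>Smooth functions, derivations and vector fields\<close>

text \<open>
  Functions on a set of points, and maps on a set of functions, are represented by their
  extensional representatives, so that HOL equality is equality on the intended domain.
\<close>

definition smooth_fun :: "('a, 'e::euclidean_space) manifold \<Rightarrow> ('a \<Rightarrow> real) \<Rightarrow> bool" where
  "smooth_fun M f \<longleftrightarrow>
     (\<forall>(U, \<phi>)\<in>atlas M. smooth_on (model M) (\<phi> ` U) (f \<circ> inv_into U \<phi>))"

definition smooth_algebra ::
  "('a, 'e::euclidean_space) manifold \<Rightarrow> (real, 'a \<Rightarrow> real) module" (\<open>C\<^sup>\<infinity>\<close>)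
where
  "C\<^sup>\<infinity> M =
     \<lparr>carrier = {f \<in> extensional (pts M). smooth_fun M f},
      monoid.mult = (\<lambda>f g. \<lambda>x\<in>pts M. f x * g x),
      one = (\<lambda>x\<in>pts M. 1),
      zero = (\<lambda>x\<in>pts M. 0),
      add = (\<lambda>f g. \<lambda>x\<in>pts M. f x + g x),
      smult = (\<lambda>c f. \<lambda>x\<in>pts M. c * f x)\<rparr>"

definition pullback :: "('a, 'e) manifold \<Rightarrow> ('a \<Rightarrow> 'b) \<Rightarrow> ('b \<Rightarrow> real) \<Rightarrow> ('a \<Rightarrow> real)"
  where "pullback M \<phi> f = (\<lambda>x\<in>pts M. f (\<phi> x))"

definition derivations :: "(real, 'f) module \<Rightarrow> ('f \<Rightarrow> 'f) set" where
  "derivations A =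
     {D \<in> carrier A \<rightarrow>\<^sub>E carrier A.
        (\<forall>a\<in>carrier A. \<forall>b\<in>carrier A. D (a \<oplus>\<^bsub>A\<^esub> b) = D a \<oplus>\<^bsub>A\<^esub> D b) \<and>
        (\<forall>c. \<forall>a\<in>carrier A. D (c \<odot>\<^bsub>A\<^esub> a) = c \<odot>\<^bsub>A\<^esub> D a) \<and>
        (\<forall>a\<in>carrier A. \<forall>b\<in>carrier A.
           D (a \<otimes>\<^bsub>A\<^esub> b) = (a \<otimes>\<^bsub>A\<^esub> D b) \<oplus>\<^bsub>A\<^esub> (D a \<otimes>\<^bsub>A\<^esub> b))}"

text \<open>
  The record type of modules in HOL-Algebra extends that of rings; the fields for
  multiplication and unit play no role for a module and are left undefined.
\<close>

definition vector_fields ::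
  "('a, 'e::euclidean_space) manifold \<Rightarrow>
     ('a \<Rightarrow> real, ('a \<Rightarrow> real) \<Rightarrow> ('a \<Rightarrow> real)) module" (\<open>\<XX>\<close>)
where
  "\<XX> M =
     \<lparr>carrier = derivations (C\<^sup>\<infinity> M),
      monoid.mult = undefined,
      one = undefined,
      zero = (\<lambda>f\<in>carrier (C\<^sup>\<infinity> M). \<zero>\<^bsub>C\<^sup>\<infinity> M\<^esub>),
      add = (\<lambda>v w. \<lambda>f\<in>carrier (C\<^sup>\<infinity> M). v f \<oplus>\<^bsub>C\<^sup>\<infinity> M\<^esub> w f),
      smult = (\<lambda>g v. \<lambda>f\<in>carrier (C\<^sup>\<infinity> M). g \<otimes>\<^bsub>C\<^sup>\<infinity> M\<^esub> v f)\<rparr>"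

section \<open>Smooth families\<close>

text \<open>
  To treat both factors of a product at once, families on a manifold \<open>X\<close> parametrized by a
  manifold \<open>P\<close> are defined relative to a manifold \<open>V\<close> and maps \<open>i p : X \<rightarrow> V\<close>, for \<open>p\<close> in \<open>P\<close>.
  They are only used for \<open>V = M \<times> N\<close>, with \<open>i\<close> one of the two embeddings of a factor. Every
  point of \<open>V\<close> is then \<open>i p x\<close> for exactly one pair \<open>(x, p)\<close>, so a family \<open>g\<close> determines the
  function \<open>f\<close> on \<open>V\<close> with \<open>f (i p x) = g p x\<close>.
\<close>

definition family_algebra ::
  "('x, 'e::euclidean_space) manifold \<Rightarrow> ('p, 'f) manifold \<Rightarrow>
     ('v, 'g::euclidean_space) manifold \<Rightarrow> ('p \<Rightarrow> 'x \<Rightarrow> 'v) \<Rightarrow>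
     (real, 'p \<Rightarrow> 'x \<Rightarrow> real) module"
where
  "family_algebra X P V i =
     \<lparr>carrier = {g \<in> pts P \<rightarrow>\<^sub>E carrier (C\<^sup>\<infinity> X).
                   \<exists>f\<in>carrier (C\<^sup>\<infinity> V). \<forall>p\<in>pts P. \<forall>x\<in>pts X. f (i p x) = g p x},
      monoid.mult = (\<lambda>g h. \<lambda>p\<in>pts P. g p \<otimes>\<^bsub>C\<^sup>\<infinity> X\<^esub> h p),
      one = (\<lambda>p\<in>pts P. \<one>\<^bsub>C\<^sup>\<infinity> X\<^esub>),
      zero = (\<lambda>p\<in>pts P. \<zero>\<^bsub>C\<^sup>\<infinity> X\<^esub>),
      add = (\<lambda>g h. \<lambda>p\<in>pts P. g p \<oplus>\<^bsub>C\<^sup>\<infinity> X\<^esub> h p),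
      smult = (\<lambda>c g. \<lambda>p\<in>pts P. c \<odot>\<^bsub>C\<^sup>\<infinity> X\<^esub> g p)\<rparr>"

definition family_fields ::
  "('x, 'e::euclidean_space) manifold \<Rightarrow> ('p, 'f) manifold \<Rightarrow>
     ('v, 'g::euclidean_space) manifold \<Rightarrow> ('p \<Rightarrow> 'x \<Rightarrow> 'v) \<Rightarrow>
     ('v \<Rightarrow> real, 'p \<Rightarrow> ('x \<Rightarrow> real) \<Rightarrow> ('x \<Rightarrow> real)) module"
where
  "family_fields X P V i =
     \<lparr>carrier = {w \<in> pts P \<rightarrow>\<^sub>E carrier (\<XX> X).
                   (\<lambda>g\<in>carrier (family_algebra X P V i). \<lambda>p\<in>pts P. w p (g p))
                     \<in> derivations (family_algebra X P V i)},
      monoid.mult = undefined,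
      one = undefined,
      zero = (\<lambda>p\<in>pts P. \<zero>\<^bsub>\<XX> X\<^esub>),
      add = (\<lambda>w u. \<lambda>p\<in>pts P. w p \<oplus>\<^bsub>\<XX> X\<^esub> u p),
      smult = (\<lambda>f w. \<lambda>p\<in>pts P. pullback X (i p) f \<odot>\<^bsub>\<XX> X\<^esub> w p)\<rparr>"

definition family_iota ::
  "('x, 'e::euclidean_space) manifold \<Rightarrow> ('p, 'f) manifold \<Rightarrow>
     ('v, 'g::euclidean_space) manifold \<Rightarrow> ('p \<Rightarrow> 'x \<Rightarrow> 'v) \<Rightarrow>
     ('p \<Rightarrow> ('x \<Rightarrow> real) \<Rightarrow> ('x \<Rightarrow> real)) \<Rightarrow> (('v \<Rightarrow> real) \<Rightarrow> ('v \<Rightarrow> real))"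
where
  "family_iota X P V i w =
     (THE v. v \<in> carrier (\<XX> V) \<and>
        (\<forall>f\<in>carrier (C\<^sup>\<infinity> V). \<forall>p\<in>pts P.
           pullback X (i p) (v f) = w p (pullback X (i p) f)))"

definition family_pi ::
  "('x, 'e::euclidean_space) manifold \<Rightarrow> ('p, 'f) manifold \<Rightarrow>
     ('v, 'g::euclidean_space) manifold \<Rightarrow> ('p \<Rightarrow> 'x \<Rightarrow> 'v) \<Rightarrow> ('v \<Rightarrow> 'x) \<Rightarrow>
     (('v \<Rightarrow> real) \<Rightarrow> ('v \<Rightarrow> real)) \<Rightarrow> ('p \<Rightarrow> ('x \<Rightarrow> real) \<Rightarrow> ('x \<Rightarrow> real))"
where
  "family_pi X P V i \<pi> v =
     (\<lambda>p\<in>pts P. \<lambda>g\<in>carrier (C\<^sup>\<infinity> X). pullback X (i p) (v (pullback V \<pi> g)))"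

definition emb_i :: "'b \<Rightarrow> 'a \<Rightarrow> 'a \<times> 'b" where "emb_i n = (\<lambda>m. (m, n))"
definition emb_j :: "'a \<Rightarrow> 'b \<Rightarrow> 'a \<times> 'b" where "emb_j m = (\<lambda>n. (m, n))"

text \<open>
  Below, \<open>MN\<close> refers to families on \<open>M\<close> parametrized by \<open>N\<close>, and \<open>NM\<close> to families on \<open>N\<close>
  parametrized by \<open>M\<close>; in both cases the ambient manifold is \<open>M \<times> N\<close>.
\<close>

definition "fields_MN M N = family_fields M N (prod_manifold M N) emb_i"
definition "fields_NM M N = family_fields N M (prod_manifold M N) emb_j"
definition "iota_MN M N = family_iota M N (prod_manifold M N) emb_i"
definition "iota_NM M N = family_iota N M (prod_manifold M N) emb_j"
definition "pi_MN M N = family_pi M N (prod_manifold M N) emb_i fst"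
definition "pi_NM M N = family_pi N M (prod_manifold M N) emb_j snd"

section \<open>Horizontal and vertical vector fields\<close>

definition horizontal_fields ::
  "('a, 'e::euclidean_space) manifold \<Rightarrow> ('b, 'f::euclidean_space) manifold \<Rightarrow>
     (('a \<times> 'b \<Rightarrow> real) \<Rightarrow> ('a \<times> 'b \<Rightarrow> real)) set"
where
  "horizontal_fields M N =
     {v \<in> carrier (\<XX> (prod_manifold M N)).
        \<forall>h\<in>carrier (C\<^sup>\<infinity> N).
          v (pullback (prod_manifold M N) snd h) = \<zero>\<^bsub>C\<^sup>\<infinity> (prod_manifold M N)\<^esub>}"

definition vertical_fields ::
  "('a, 'e::euclidean_space) manifold \<Rightarrow> ('b, 'f::euclidean_space) manifold \<Rightarrow>
     (('a \<times> 'b \<Rightarrow> real) \<Rightarrow> ('a \<times> 'b \<Rightarrow> real)) set"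
where
  "vertical_fields M N =
     {v \<in> carrier (\<XX> (prod_manifold M N)).
        \<forall>g\<in>carrier (C\<^sup>\<infinity> M).
          v (pullback (prod_manifold M N) fst g) = \<zero>\<^bsub>C\<^sup>\<infinity> (prod_manifold M N)\<^esub>}"

section \<open>Module homomorphisms, direct sums, exact sequences\<close>

text \<open>
  The qualified name \<open>Module.module\<close> is the notion of HOL-Algebra, as opposed to the locale
  \<open>module\<close> of Main.
\<close>

definition mod_hom ::
  "('r, 'k) ring_scheme \<Rightarrow> ('r, 'a, 'l) module_scheme \<Rightarrow> ('r, 'b, 'm) module_scheme \<Rightarrow>
     ('a \<Rightarrow> 'b) \<Rightarrow> bool"
where
  "mod_hom R A B h \<longleftrightarrow>
     Module.module R A \<and> Module.module R B \<and>
     h \<in> carrier A \<rightarrow> carrier B \<and>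
     (\<forall>a\<in>carrier A. \<forall>b\<in>carrier A. h (a \<oplus>\<^bsub>A\<^esub> b) = h a \<oplus>\<^bsub>B\<^esub> h b) \<and>
     (\<forall>r\<in>carrier R. \<forall>a\<in>carrier A. h (r \<odot>\<^bsub>A\<^esub> a) = r \<odot>\<^bsub>B\<^esub> h a)"

definition mod_iso ::
  "('r, 'k) ring_scheme \<Rightarrow> ('r, 'a, 'l) module_scheme \<Rightarrow> ('r, 'b, 'm) module_scheme \<Rightarrow>
     ('a \<Rightarrow> 'b) \<Rightarrow> bool"
where
  "mod_iso R A B h \<longleftrightarrow> mod_hom R A B h \<and> bij_betw h (carrier A) (carrier B)"

definition direct_sum_of ::
  "('r, 'k) ring_scheme \<Rightarrow> ('r, 'a, 'l) module_scheme \<Rightarrow> 'a set \<Rightarrow> 'a set \<Rightarrow> bool"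
where
  "direct_sum_of R X A B \<longleftrightarrow>
     Module.module R X \<and> submodule A R X \<and> submodule B R X \<and>
     A <+>\<^bsub>X\<^esub> B = carrier X \<and> A \<inter> B = {\<zero>\<^bsub>X\<^esub>}"

text \<open>The projection onto the summand \<open>A\<close> along the summand \<open>B\<close>.\<close>

definition summand_proj ::
  "('r, 'a, 'l) module_scheme \<Rightarrow> 'a set \<Rightarrow> 'a set \<Rightarrow> 'a \<Rightarrow> 'a"
where
  "summand_proj X A B x = (THE a. a \<in> A \<and> (\<exists>b\<in>B. x = a \<oplus>\<^bsub>X\<^esub> b))"

definition short_exact ::
  "('r, 'k) ring_scheme \<Rightarrow> ('r, 'a, 'l) module_scheme \<Rightarrow> ('a \<Rightarrow> 'b) \<Rightarrow>
     ('r, 'b, 'm) module_scheme \<Rightarrow> ('b \<Rightarrow> 'c) \<Rightarrow> ('r, 'c, 'n) module_scheme \<Rightarrow> bool"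
where
  "short_exact R A f B g C \<longleftrightarrow>
     mod_hom R A B f \<and> mod_hom R B C g \<and>
     a_kernel A B f = {\<zero>\<^bsub>A\<^esub>} \<and>
     f ` carrier A = a_kernel B C g \<and>
     g ` carrier B = carrier C"

end

theory Submission
  imports Defs
begin

text \<open>
  By Hadamard's lemma and bump functions, the value \<open>v f p\<close> of a derivation depends only on the
  differential of \<open>f\<close> at \<open>p\<close>. At \<open>(m, n)\<close>, the functions \<open>f\<close> and
  \<open>\<pi>\<^sub>M\<^sup>* i\<^sub>n\<^sup>* f + \<pi>\<^sub>N\<^sup>* j\<^sub>m\<^sup>* f\<close> have the same differential, so
  \<open>v f (m, n) = v (\<pi>\<^sub>M\<^sup>* i\<^sub>n\<^sup>* f) (m, n) + v (\<pi>\<^sub>N\<^sup>* j\<^sub>m\<^sup>* f) (m, n)\<close>; this is the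
  decomposition \<open>v = \<iota> (\<pi> v) + \<iota>' (\<pi>' v)\<close>. It remains to see that the first summand is smooth in
  \<open>(m, n)\<close>, which follows from its expression in coordinates. The rest is formal, using
  \<open>\<pi> \<circ> \<iota> = id\<close>.
\<close>

section \<open>Differential calculus relative to a subspace\<close>

text \<open>A derivation accepts only functions on the whole manifold, while coordinates and
  Hadamard factors live in one chart. Bump functions close this gap, and extending them by zero is
  where the Hausdorff axiom enters. Smoothness of the first summand is not automatic, because the
  function to which \<open>v\<close> is applied changes with the point \<open>(m, n)\<close>; the
  coordinate expression trades it for finitely many fixed functions on \<open>V\<close> with smooth
  coefficients. This is done for the first factor only: by the splitting, the second summand is
  \<open>v f\<close> minus the first. The model is a subspace \<open>E\<close> of a Euclidean space,
  so a derivative within a relatively open set is determined on \<open>E\<close> alone. Arbitrary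
  witnesses \<open>f'\<close> are therefore replaced by \<open>dirderiv\<close>, and derivatives are
  composed with the orthogonal projection onto \<open>E\<close>, written in an orthonormal basis of
  \<open>E\<close>. Both kinds of families are instances of one locale; horizontal fields become the
  kernel of the projection to families on \<open>N\<close>, vertical fields that of the projection
  to families on \<open>M\<close>.\<close>

lemma Ck_on_cong:
  assumes "\<And>x. x \<in> U \<Longrightarrow> f x = g x"
  shows "Ck_on k E U f \<longleftrightarrow> Ck_on k E U g"
proof -
  have "(f has_derivative D) (at x within U) \<longleftrightarrow> (g has_derivative D) (at x within U)"
    if "x \<in> U" for x D
    using assms that has_derivative_transform[of x U f g] has_derivative_transform[of x U g f]
    by metis
  then show ?thesis
    using assms by (cases k) (auto cong: continuous_on_cong)
qed

lemma Ck_on_subset: "Ck_on k E U f \<Longrightarrow> T \<subseteq> U \<Longrightarrow> Ck_on k E T f"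
proof (induction k arbitrary: f)
  case 0
  then show ?case by (auto intro: continuous_on_subset)
next
  case (Suc k)
  then show ?case by simp (meson has_derivative_subset subsetD)
qed

lemma Ck_on_SucD: "Ck_on (Suc k) E U f \<Longrightarrow> Ck_on k E U f"
proof (induction k arbitrary: f)
  case 0
  then show ?case
    by (auto simp: continuous_on_eq_continuous_within intro: has_derivative_continuous)
next
  case (Suc k)
  from Suc.prems obtain f' where
    "\<forall>x\<in>U. (f has_derivative f' x) (at x within U)" "\<forall>v\<in>E. Ck_on (Suc k) E U (\<lambda>x. f' x v)"
    unfolding Ck_on.simps(2)[of "Suc k"] by blast
  then show ?case
    using Suc.IH by auto
qed

lemma Ck_on_const: "Ck_on k E U (\<lambda>_. c)"
  by (induction k arbitrary: c) (auto intro!: exI[of _ "\<lambda>_ _. 0"])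

lemma Ck_on_linear:
  assumes "bounded_linear L"
  shows "Ck_on k E U L"
proof (cases k)
  case 0
  then show ?thesis using assms by (simp add: linear_continuous_on)
next
  case (Suc n)
  then show ?thesis
    using bounded_linear_imp_has_derivative[OF assms] Ck_on_const[of n E U]
    by (simp del: Ck_on.simps(1)) (blast intro: exI[of _ "\<lambda>_. L"])
qed

lemma Ck_on_linear_compose:
  "bounded_linear L \<Longrightarrow> Ck_on k E U f \<Longrightarrow> Ck_on k E U (\<lambda>x. L (f x))"
proof (induction k arbitrary: f)
  case 0
  then show ?case by (auto intro: bounded_linear.continuous_on)
next
  case (Suc k)
  then obtain f' where
    "\<forall>x\<in>U. (f has_derivative f' x) (at x within U)" "\<forall>v\<in>E. Ck_on k E U (\<lambda>x. f' x v)"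
    by auto
  then show ?case
    using Suc.IH[OF Suc.prems(1)] bounded_linear.has_derivative[OF Suc.prems(1)]
    unfolding Ck_on.simps by (intro exI[of _ "\<lambda>x v. L (f' x v)"]) blast
qed

lemma Ck_on_add: "Ck_on k E U f \<Longrightarrow> Ck_on k E U g \<Longrightarrow> Ck_on k E U (\<lambda>x. f x + g x)"
proof (induction k arbitrary: f g)
  case 0
  then show ?case by (auto intro: continuous_intros)
next
  case (Suc k)
  obtain f' where f': 
    "\<forall>x\<in>U. (f has_derivative f' x) (at x within U)" "\<forall>v\<in>E. Ck_on k E U (\<lambda>x. f' x v)"
    using Suc.prems by auto
  obtain g' where g': 
    "\<forall>x\<in>U. (g has_derivative g' x) (at x within U)" "\<forall>v\<in>E. Ck_on k E U (\<lambda>x. g' x v)"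
    using Suc.prems by auto
  show ?case
    using f' g' Suc.IH by (auto intro!: exI[of _ "\<lambda>x v. f' x v + g' x v"] has_derivative_add)
qed

lemma Ck_on_sum:
  "(\<And>b. b \<in> B \<Longrightarrow> Ck_on k E U (f b)) \<Longrightarrow> Ck_on k E U (\<lambda>x. \<Sum>b\<in>B. f b x)"
  by (induction B rule: infinite_finite_induct) (auto intro: Ck_on_const Ck_on_add)

lemma Ck_on_scaleR:
  "Ck_on k E U f \<Longrightarrow> Ck_on k E U g \<Longrightarrow> Ck_on k E U (\<lambda>x. f x *\<^sub>R g x)"
proof (induction k arbitrary: f g)
  case 0
  then show ?case by (auto intro: continuous_intros)
next
  case (Suc k)
  obtain f' where f': 
    "\<forall>x\<in>U. (f has_derivative f' x) (at x within U)" "\<forall>v\<in>E. Ck_on k E U (\<lambda>x. f' x v)"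
    using Suc.prems by auto
  obtain g' where g': 
    "\<forall>x\<in>U. (g has_derivative g' x) (at x within U)" "\<forall>v\<in>E. Ck_on k E U (\<lambda>x. g' x v)"
    using Suc.prems by auto
  show ?case
    \<comment> \<open>The product rule leaves \<open>f\<close> and \<open>g\<close> undifferentiated
      beside \<open>g'\<close> and \<open>f'\<close>, so they are also used at one order
      lower.\<close>
    using f' g' Suc.IH Suc.prems[THEN Ck_on_SucD]
    by (auto intro!: exI[of _ "\<lambda>x v. f x *\<^sub>R g' x v + f' x v *\<^sub>R g x"] has_derivative_scaleR
        Ck_on_add)
qed

lemma Ck_on_mult:
  fixes f g :: "_ \<Rightarrow> real"
  shows "Ck_on k E U f \<Longrightarrow> Ck_on k E U g \<Longrightarrow> Ck_on k E U (\<lambda>x. f x * g x)"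
  using Ck_on_scaleR[of k E U f g] by simp

text \<open>\<open>Basis\<close> spans the ambient type and not the model space, so a basis of the
  subspace itself is needed. As a map on the ambient space the sum is the orthogonal projection onto
  \<open>F\<close>, which serves below to correct derivatives outside \<open>F\<close>. For a
  zero-dimensional \<open>F\<close> the basis is empty.\<close>

lemma orthonormal_expansion:
  fixes F :: "'f::euclidean_space set"
  assumes "subspace F"
  obtains B where "finite B" "B \<subseteq> F" "\<And>x. x \<in> F \<Longrightarrow> (\<Sum>b\<in>B. (x \<bullet> b) *\<^sub>R b) = x"
proof -
  obtain B where B: "B \<subseteq> F" "pairwise orthogonal B" "\<And>x. x \<in> B \<Longrightarrow> norm x = 1"
      "independent B" "span B = F"
    using orthonormal_basis_subspace[OF assms] by metis
  have fin: "finite B"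
    using B independent_imp_finite by blast
  show thesis
  proof
    fix x assume "x \<in> F"
    \<comment> \<open>The residue is orthogonal to every element of \<open>B\<close> and lies in the
      span of \<open>B\<close>, hence it is orthogonal to itself.\<close>
    define y where "y = x - (\<Sum>b\<in>B. (x \<bullet> b) *\<^sub>R b)"
    have "y \<bullet> c = 0" if "c \<in> B" for c
    proof -
      have "(\<Sum>b\<in>B. (x \<bullet> b) *\<^sub>R b) \<bullet> c = (\<Sum>b\<in>B. if b = c then x \<bullet> c else 0)"
        unfolding inner_sum_left
      proof (rule sum.cong)
        fix b assume "b \<in> B"
        have "c \<bullet> c = 1"
          using B(3)[OF that] by (simp add: norm_eq_1)
        moreover have "b \<noteq> c \<Longrightarrow> b \<bullet> c = 0"
          using B(2) \<open>b \<in> B\<close> that by (auto simp: pairwise_def orthogonal_def)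
        ultimately show "(x \<bullet> b) *\<^sub>R b \<bullet> c = (if b = c then x \<bullet> c else 0)"
          by auto
      qed simp
      then show ?thesis
        using fin that by (simp add: y_def inner_diff_left)
    qed
    moreover have "y \<in> span B"
      unfolding y_def
      using \<open>x \<in> F\<close> B(5) by (intro span_diff span_sum span_scale) (auto intro: span_base)
    ultimately have "y \<bullet> y = 0"
      by (metis orthogonal_def orthogonal_to_span)
    then show "(\<Sum>b\<in>B. (x \<bullet> b) *\<^sub>R b) = x"
      by (simp add: y_def)
  qed (use fin B in auto)
qed

text \<open>The induction keeps \<open>g\<close> fixed and varies \<open>h\<close>: the chain rule
  gives a sum of products of components of \<open>g'\<close> with functions
  \<open>h' (g x) b\<close>, and the latter are again composites with the same
  \<open>g\<close>.\<close>

lemma Ck_on_compose: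
  fixes g :: "'e::euclidean_space \<Rightarrow> 'f::euclidean_space"
  assumes "subspace F" "T \<subseteq> F"
  shows "Ck_on k F T h \<Longrightarrow> Ck_on k E U g \<Longrightarrow> g ` U \<subseteq> T \<Longrightarrow> Ck_on k E U (\<lambda>x. h (g x))"
proof (induction k arbitrary: h)
  case 0
  then show ?case by (auto intro: continuous_on_compose2)
next
  case (Suc k)
  obtain B where B: "finite B" "B \<subseteq> F" "\<And>x. x \<in> F \<Longrightarrow> (\<Sum>b\<in>B. (x \<bullet> b) *\<^sub>R b) = x"
    using orthonormal_expansion[OF assms(1)] by metis
  obtain h' where h': 
    "\<forall>x\<in>T. (h has_derivative h' x) (at x within T)" "\<forall>v\<in>F. Ck_on k F T (\<lambda>x. h' x v)"
    using Suc.prems by auto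
  obtain g' where g': 
    "\<forall>x\<in>U. (g has_derivative g' x) (at x within U)" "\<forall>v\<in>E. Ck_on k E U (\<lambda>x. g' x v)"
    using Suc.prems by auto
  \<comment> \<open>\<open>g' x v\<close> need not lie in \<open>F\<close> a priori, so it is replaced by its orthogonal projection.\<close>
  have deriv: "((\<lambda>x. h (g x)) has_derivative (\<lambda>v. \<Sum>b\<in>B. (g' x v \<bullet> b) *\<^sub>R h' (g x) b)) (at x within U)"
    if x: "x \<in> U" for x
  proof -
    have "((\<lambda>y. \<Sum>b\<in>B. (g y \<bullet> b) *\<^sub>R b) has_derivative (\<lambda>v. \<Sum>b\<in>B. (g' x v \<bullet> b) *\<^sub>R b)) (at x within U)"
      using g' x by (auto intro!: derivative_eq_intros)
    then have "(g has_derivative (\<lambda>v. \<Sum>b\<in>B. (g' x v \<bullet> b) *\<^sub>R b)) (at x within U)"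
      using Suc.prems(3) assms(2) B(3) x
      by (elim has_derivative_transform[rotated 2]) (auto simp: subset_iff image_subset_iff)
    moreover have "(h has_derivative h' (g x)) (at (g x) within g ` U)"
      using h' x Suc.prems(3) by (meson has_derivative_subset image_subset_iff)
    ultimately have "((h \<circ> g) has_derivative h' (g x) \<circ> (\<lambda>v. \<Sum>b\<in>B. (g' x v \<bullet> b) *\<^sub>R b)) (at x within U)"
      by (rule diff_chain_within)
    moreover have "linear (h' (g x))"
      using h' x Suc.prems(3) has_derivative_linear by blast
    ultimately show ?thesis
      by (simp add: o_def linear_sum linear_cmul)
  qed
  have "Ck_on k E U (\<lambda>x. \<Sum>b\<in>B. (g' x v \<bullet> b) *\<^sub>R h' (g x) b)" if "v \<in> E" for v
  proof (intro Ck_on_sum Ck_on_scaleR)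
    fix b assume "b \<in> B"
    show "Ck_on k E U (\<lambda>x. g' x v \<bullet> b)"
      using g' that by (auto intro: Ck_on_linear_compose bounded_linear_inner_left)
    show "Ck_on k E U (\<lambda>x. h' (g x) b)"
      using Suc.IH h' \<open>b \<in> B\<close> B(2) Suc.prems Ck_on_SucD by blast
  qed
  with deriv show ?case
    by (auto intro!: exI[of _ "\<lambda>x v. \<Sum>b\<in>B. (g' x v \<bullet> b) *\<^sub>R h' (g x) b"])
qed

lemma Ck_on_Pair:
  assumes "Ck_on k E U f" "Ck_on k E U g"
  shows "Ck_on k E U (\<lambda>x. (f x, g x))"
proof -
  have "Ck_on k E U (\<lambda>x. (f x, 0) + (0, g x))"
    using assms
    by (intro Ck_on_add Ck_on_linear_compose[of "\<lambda>y. (y, 0)"] Ck_on_linear_compose[of "\<lambda>y. (0, y)"]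
        bounded_linear_Pair bounded_linear_ident bounded_linear_zero) 
  then show ?thesis by simp
qed

subsection \<open>Directional derivatives\<close>

text \<open>A two-sided derivative along a line, which replaces a choice among the derivatives
  within a set \<open>U\<close>. It is the right notion when \<open>v\<close> lies in the model
  space and \<open>U\<close> is relatively open there: the line then stays in \<open>U\<close> for
  small \<open>t\<close>.\<close>

definition dirderiv :: "'e::real_normed_vector \<Rightarrow> ('e \<Rightarrow> 'f::real_normed_vector) \<Rightarrow> 'e \<Rightarrow> 'f"
  where "dirderiv v f x = vector_derivative (\<lambda>t. f (x + t *\<^sub>R v)) (at 0)"

lemma dirderiv_eq:
  assumes E: "subspace E" and U: "openin (top_of_set E) U" and x: "x \<in> U" and v: "v \<in> E"
    and f: "(f has_derivative f') (at x within U)"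
  shows "dirderiv v f x = f' v"
proof -
  obtain T where T: "open T" "U = E \<inter> T"
    using U by (auto simp: openin_open)
  \<comment> \<open>The parameters for which the line runs inside the open set \<open>T\<close>.
    Since they form an open set of reals, a derivative within \<open>S\<close> is a two-sided
    one.\<close>
  define S where "S = (\<lambda>t. x + t *\<^sub>R v) -` T"
  have "open S"
    unfolding S_def by (intro open_vimage T continuous_intros)
  have "0 \<in> S"
    using x T by (auto simp: S_def)
  have sub: "(\<lambda>t. x + t *\<^sub>R v) ` S \<subseteq> U"
    using x v E T by (auto simp: S_def subspace_add subspace_scale)
  have "((\<lambda>t. x + t *\<^sub>R v) has_derivative (\<lambda>t. t *\<^sub>R v)) (at 0 within S)"
    by (auto intro!: derivative_eq_intros)
  moreover have "(f has_derivative f') (at (x + 0 *\<^sub>R v) within (\<lambda>t. x + t *\<^sub>R v) ` S)"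
    using f sub by (auto intro: has_derivative_subset)
  ultimately have "((f \<circ> (\<lambda>t. x + t *\<^sub>R v)) has_derivative f' \<circ> (\<lambda>t. t *\<^sub>R v)) (at 0 within S)"
    by (rule diff_chain_within)
  moreover have "f' \<circ> (\<lambda>t. t *\<^sub>R v) = (\<lambda>t. t *\<^sub>R f' v)"
    using linear_cmul[OF has_derivative_linear[OF f]] by auto
  ultimately have "((\<lambda>t. f (x + t *\<^sub>R v)) has_vector_derivative f' v) (at 0 within S)"
    unfolding has_vector_derivative_def by (simp add: o_def)
  then have "((\<lambda>t. f (x + t *\<^sub>R v)) has_vector_derivative f' v) (at 0)"
    unfolding at_within_open[OF \<open>0 \<in> S\<close> \<open>open S\<close>] .
  then show ?thesis
    unfolding dirderiv_def by (rule vector_derivative_at)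
qed

text \<open>In \<open>Ck_on\<close> the derivative is an existential witness, which may differ
  between neighbourhoods and between orders. Here it becomes the fixed function
  \<open>dirderiv v f\<close>, so that local statements can be glued and all orders can be treated
  together.\<close>

lemma Ck_on_Suc_iff:
  assumes "subspace E" "openin (top_of_set E) U"
  shows "Ck_on (Suc k) E U f \<longleftrightarrow>
    (\<forall>x\<in>U. f differentiable (at x within U)) \<and> (\<forall>v\<in>E. Ck_on k E U (dirderiv v f))"
proof
  assume "Ck_on (Suc k) E U f"
  then obtain f' where f': 
    "\<forall>x\<in>U. (f has_derivative f' x) (at x within U)" "\<forall>v\<in>E. Ck_on k E U (\<lambda>x. f' x v)"
    by auto
  have "Ck_on k E U (dirderiv v f)" if "v \<in> E" for v
  proof -
    have "dirderiv v f x = f' x v" if "x \<in> U" for x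
      using dirderiv_eq[OF assms that \<open>v \<in> E\<close>] f'(1) that by blast
    then show ?thesis
      using Ck_on_cong[of U "dirderiv v f" "\<lambda>x. f' x v"] f'(2) that by blast
  qed
  with f' show "(\<forall>x\<in>U. f differentiable (at x within U)) \<and> (\<forall>v\<in>E. Ck_on k E U (dirderiv v f))"
    by (auto simp: differentiable_def)
next
  assume R: "(\<forall>x\<in>U. f differentiable (at x within U)) \<and> (\<forall>v\<in>E. Ck_on k E U (dirderiv v f))"
  then obtain f' where f': "\<forall>x\<in>U. (f has_derivative f' x) (at x within U)"
    unfolding differentiable_def by metis
  have "Ck_on k E U (\<lambda>x. f' x v)" if "v \<in> E" for v
  proof -
    have "dirderiv v f x = f' x v" if "x \<in> U" for x
      using dirderiv_eq[OF assms that \<open>v \<in> E\<close>] f' that by blast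
    then show ?thesis
      using Ck_on_cong[of U "dirderiv v f" "\<lambda>x. f' x v"] R that by blast
  qed
  with f' show "Ck_on (Suc k) E U f"
    by auto
qed

lemma at_within_openin_subset:
  assumes "openin (top_of_set E) T" "T \<subseteq> U" "U \<subseteq> E" "x \<in> T"
  shows "at x within T = at x within U"
proof -
  obtain S where "open S" "T = E \<inter> S"
    using assms by (auto simp: openin_open)
  with assms show ?thesis
    by (intro at_within_nhd[of _ S]) auto
qed

text \<open>The derivatives found on the various \<open>T\<close> are all given by
  \<open>dirderiv v f\<close>, which does not mention \<open>T\<close>; so the induction hypothesis
  applies to it.\<close>

lemma Ck_on_local:
  assumes E: "subspace E" and U: "openin (top_of_set E) U"
  shows "(\<And>x. x \<in> U \<Longrightarrow> \<exists>T. openin (top_of_set E) T \<and> x \<in> T \<and> T \<subseteq> U \<and> Ck_on k E T f)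
    \<Longrightarrow> Ck_on k E U f"
proof (induction k arbitrary: f)
  case 0
  show ?case
    unfolding Ck_on.simps continuous_on_eq_continuous_within
  proof
    fix x assume "x \<in> U"
    then obtain T where T: "openin (top_of_set E) T" "x \<in> T" "T \<subseteq> U" "continuous_on T f"
      using 0 by auto
    then show "continuous (at x within U) f"
      using at_within_openin_subset[of E T U x] openin_imp_subset[OF U]
      by (metis continuous_on_eq_continuous_within)
  qed
next
  case (Suc k)
  have *: "f differentiable (at x within U) \<and>
      (\<exists>T. openin (top_of_set E) T \<and> x \<in> T \<and> T \<subseteq> U \<and> (\<forall>v\<in>E. Ck_on k E T (dirderiv v f)))"
    if x: "x \<in> U" for x
  proof -
    obtain T where T: "openin (top_of_set E) T" "x \<in> T" "T \<subseteq> U" "Ck_on (Suc k) E T f"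
      using Suc.prems[OF x] by (elim exE conjE)
    moreover have "at x within T = at x within U"
      using at_within_openin_subset T openin_imp_subset[OF U] by blast
    ultimately show ?thesis
      using T(4)[unfolded Ck_on_Suc_iff[OF E T(1)]] by metis
  qed
  have "Ck_on k E U (dirderiv v f)" if "v \<in> E" for v
  proof (rule Suc.IH)
    fix x assume "x \<in> U"
    then obtain T where "openin (top_of_set E) T" "x \<in> T" "T \<subseteq> U" "\<forall>v\<in>E. Ck_on k E T (dirderiv v f)"
      using * by blast
    with that show "\<exists>T. openin (top_of_set E) T \<and> x \<in> T \<and> T \<subseteq> U \<and> Ck_on k E T (dirderiv v f)"
      by blast
  qed
  with * show ?case
    unfolding Ck_on_Suc_iff[OF E U] by blast
qed

subsection \<open>Smooth maps\<close>

lemma smooth_on_cong: "(\<And>x. x \<in> U \<Longrightarrow> f x = g x) \<Longrightarrow> smooth_on E U f \<longleftrightarrow> smooth_on E U g"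
  unfolding smooth_on_def using Ck_on_cong by blast

lemma smooth_on_subset: "smooth_on E U f \<Longrightarrow> T \<subseteq> U \<Longrightarrow> smooth_on E T f"
  unfolding smooth_on_def using Ck_on_subset by blast

lemma smooth_on_const: "smooth_on E U (\<lambda>_. c)"
  unfolding smooth_on_def using Ck_on_const by blast

lemma smooth_on_linear: "bounded_linear L \<Longrightarrow> smooth_on E U L"
  unfolding smooth_on_def using Ck_on_linear by blast

lemma smooth_on_add: "smooth_on E U f \<Longrightarrow> smooth_on E U g \<Longrightarrow> smooth_on E U (\<lambda>x. f x + g x)"
  unfolding smooth_on_def using Ck_on_add by blast

lemma smooth_on_sum:
  "(\<And>b. b \<in> B \<Longrightarrow> smooth_on E U (f b)) \<Longrightarrow> smooth_on E U (\<lambda>x. \<Sum>b\<in>B. f b x)"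
  unfolding smooth_on_def by (simp add: Ck_on_sum)

lemma smooth_on_mult:
  fixes f g :: "_ \<Rightarrow> real"
  shows "smooth_on E U f \<Longrightarrow> smooth_on E U g \<Longrightarrow> smooth_on E U (\<lambda>x. f x * g x)"
  unfolding smooth_on_def using Ck_on_mult by blast

lemma smooth_on_compose:
  assumes "subspace F" "T \<subseteq> F" "smooth_on F T h" "smooth_on E U g" "g ` U \<subseteq> T"
  shows "smooth_on E U (\<lambda>x. h (g x))"
  using assms Ck_on_compose[OF assms(1,2)] unfolding smooth_on_def by blast

lemma smooth_on_Pair:
  "smooth_on E U f \<Longrightarrow> smooth_on E U g \<Longrightarrow> smooth_on E U (\<lambda>x. (f x, g x))"
  unfolding smooth_on_def using Ck_on_Pair by blast

lemma smooth_on_local: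
  assumes "subspace E" "openin (top_of_set E) U"
    and "\<And>x. x \<in> U \<Longrightarrow> \<exists>T. openin (top_of_set E) T \<and> x \<in> T \<and> T \<subseteq> U \<and> smooth_on E T f"
  shows "smooth_on E U f"
  unfolding smooth_on_def
proof
  fix k show "Ck_on k E U f"
  proof (rule Ck_on_local[OF assms(1,2)])
    fix x assume "x \<in> U"
    then show "\<exists>T. openin (top_of_set E) T \<and> x \<in> T \<and> T \<subseteq> U \<and> Ck_on k E T f"
      using assms(3) unfolding smooth_on_def by blast
  qed
qed

lemma smooth_on_imp_continuous_on: "smooth_on E U f \<Longrightarrow> continuous_on U f"
  unfolding smooth_on_def by (metis Ck_on.simps(1))

lemma smooth_on_imp_differentiable: "smooth_on E U f \<Longrightarrow> x \<in> U \<Longrightarrow> f differentiable (at x within U)"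
  unfolding smooth_on_def differentiable_def by (metis Ck_on.simps(2))

lemma smooth_on_dirderiv:
  assumes "subspace E" "openin (top_of_set E) U" "smooth_on E U f" "v \<in> E"
  shows "smooth_on E U (dirderiv v f)"
  unfolding smooth_on_def
proof
  fix k show "Ck_on k E U (dirderiv v f)"
    using assms(3,4) Ck_on_Suc_iff[OF assms(1,2)] unfolding smooth_on_def by blast
qed

text \<open>A derivative \<open>f'\<close> within \<open>U\<close> is determined only on
  \<open>E\<close>. The projection \<open>p\<close> onto \<open>E\<close> is the identity on
  \<open>U\<close>, so \<open>f' \<circ> p\<close> is a derivative of \<open>f\<close> as well, and
  it is expressed by the directional derivatives along \<open>B\<close> alone.\<close>

lemma has_derivative_dirderiv:
  fixes E :: "'e::euclidean_space set"
  assumes E: "subspace E" and U: "openin (top_of_set E) U" and x: "x \<in> U"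
    and B: "finite B" "B \<subseteq> E" "\<And>x. x \<in> E \<Longrightarrow> (\<Sum>b\<in>B. (x \<bullet> b) *\<^sub>R b) = x"
    and f: "f differentiable (at x within U)"
  shows "(f has_derivative (\<lambda>v. \<Sum>b\<in>B. (v \<bullet> b) *\<^sub>R dirderiv b f x)) (at x within U)"
proof -
  obtain f' where f': "(f has_derivative f') (at x within U)"
    using f by (auto simp: differentiable_def)
  define p where "p = (\<lambda>y. \<Sum>b\<in>B. (y \<bullet> b) *\<^sub>R b)"
  have p: "p y = y" if "y \<in> U" for y
    using B(3) openin_imp_subset[OF U] that by (auto simp: p_def)
  have "(p has_derivative p) (at x within U)"
    unfolding p_def by (auto intro!: derivative_eq_intros)
  moreover have "(f has_derivative f') (at (p x) within p ` U)"
    using f' p x by simp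
  ultimately have "(f \<circ> p has_derivative f' \<circ> p) (at x within U)"
    by (rule diff_chain_within)
  then have "(f has_derivative f' \<circ> p) (at x within U)"
    using p x by (elim has_derivative_transform[rotated 2]) auto
  moreover have "f' \<circ> p = (\<lambda>v. \<Sum>b\<in>B. (v \<bullet> b) *\<^sub>R dirderiv b f x)"
  proof
    fix v
    have lin: "linear f'"
      using f' has_derivative_linear by blast
    have "(f' \<circ> p) v = (\<Sum>b\<in>B. (v \<bullet> b) *\<^sub>R f' b)"
      unfolding p_def o_def linear_sum[OF lin] using linear_cmul[OF lin] by simp
    also have "\<dots> = (\<Sum>b\<in>B. (v \<bullet> b) *\<^sub>R dirderiv b f x)"
      using dirderiv_eq[OF E U x _ f'] B(2) by (intro sum.cong) auto
    finally show "(f' \<circ> p) v = (\<Sum>b\<in>B. (v \<bullet> b) *\<^sub>R dirderiv b f x)" .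
  qed
  ultimately show ?thesis by simp
qed

subsection \<open>Bump functions\<close>

text \<open>\<open>flat 0\<close> is Cauchy's function, smooth but not analytic at 0. With the
  powers in the denominator the linear span of the family is closed under differentiation, which is
  what an induction on the order needs.\<close>

definition flat :: "nat \<Rightarrow> real \<Rightarrow> real"
  where "flat j x = (if x > 0 then exp (- (1 / x)) / x ^ j else 0)"

lemma flat_tendsto_0: "(flat j \<longlongrightarrow> 0) (at 0)"
proof -
  \<comment> \<open>Substitution of \<open>inverse x\<close>: the exponential dominates every power
    at infinity.\<close>
  have "((\<lambda>x. inverse x ^ j / exp (inverse x)) \<longlongrightarrow> (0::real)) (at_right 0)"
    using filterlim_compose[OF tendsto_power_div_exp_0 filterlim_inverse_at_top_right] .
  then have "(flat j \<longlongrightarrow> 0) (at_right 0)"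
  proof (rule Lim_transform_eventually)
    show "\<forall>\<^sub>F x in at_right 0. inverse x ^ j / exp (inverse x) = flat j x"
      using eventually_at_right_less[of "0::real"]
      by eventually_elim (simp add: flat_def exp_minus field_simps)
  qed
  moreover have "(flat j \<longlongrightarrow> 0) (at_left 0)"
  proof (rule Lim_transform_eventually[OF tendsto_const])
    show "\<forall>\<^sub>F x in at_left 0. 0 = flat j x"
      by (auto simp: eventually_at_left_field flat_def intro: exI[of _ "-1"])
  qed
  ultimately show ?thesis
    by (simp add: filterlim_split_at)
qed

text \<open>For positive \<open>x\<close> this is the quotient rule, for negative \<open>x\<close>
  everything vanishes. At 0 the difference quotient of \<open>flat j\<close> is
  \<open>flat (Suc j)\<close>, which tends to 0.\<close>

lemma flat_has_derivative:
  "(flat j has_real_derivative flat (j + 2) x - real j * flat (j + 1) x) (at x)"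
proof (cases x "0::real" rule: linorder_cases)
  case less
  have "((\<lambda>_. 0) has_real_derivative 0) (at x)"
    by simp
  then have "(flat j has_real_derivative 0) (at x)"
    by (rule has_field_derivative_transform_within_open[of _ _ _ "{..<0}"])
      (use less in \<open>auto simp: flat_def\<close>)
  with less show ?thesis by (simp add: flat_def)
next
  case equal
  have "((\<lambda>y. (flat j y - flat j 0) / (y - 0)) \<longlongrightarrow> 0) (at 0)"
  proof (rule Lim_transform_eventually[OF flat_tendsto_0[of "Suc j"]])
    show "\<forall>\<^sub>F y in at 0. flat (Suc j) y = (flat j y - flat j 0) / (y - 0)"
      by (auto simp: flat_def eventually_at_filter)
  qed
  with equal show ?thesis
    by (simp add: has_field_derivative_iff flat_def)
next
  case greater
  have "((\<lambda>x. exp (- (1 / x)) / x ^ j) has_real_derivative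
      exp (- (1 / x)) / x ^ (j + 2) - real j * (exp (- (1 / x)) / x ^ (j + 1))) (at x)"
  proof -
    \<comment> \<open>Writing \<open>x ^ j / x\<close> for the power with exponent
      \<open>j - 1\<close> avoids truncated subtraction at \<open>j = 0\<close>; division is
      harmless since \<open>x\<close> is positive.\<close>
    have "((\<lambda>x. x ^ j) has_real_derivative real j * x ^ j / x) (at x)"
      using DERIV_pow[of j x] greater by (cases j) simp_all
    moreover have "((\<lambda>x. exp (- (1 / x))) has_real_derivative exp (- (1 / x)) / x\<^sup>2) (at x)"
      using greater by (auto intro!: derivative_eq_intros simp: power2_eq_square)
    ultimately have "((\<lambda>x. exp (- (1 / x)) / x ^ j) has_real_derivative
        (exp (- (1 / x)) / x\<^sup>2 * x ^ j - exp (- (1 / x)) * (real j * x ^ j / x)) / (x ^ j * x ^ j)) (at x)"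
      using greater by (intro DERIV_divide) auto
    moreover have "(exp (- (1 / x)) / x\<^sup>2 * x ^ j - exp (- (1 / x)) * (real j * x ^ j / x)) / (x ^ j * x ^ j) =
        exp (- (1 / x)) / x ^ (j + 2) - real j * (exp (- (1 / x)) / x ^ (j + 1))"
      using greater by (simp add: field_simps power2_eq_square)
    ultimately show ?thesis by simp
  qed
  then have "(flat j has_real_derivative
      exp (- (1 / x)) / x ^ (j + 2) - real j * (exp (- (1 / x)) / x ^ (j + 1))) (at x)"
    by (rule has_field_derivative_transform_within_open[of _ _ _ "{0<..}"])
      (use greater in \<open>auto simp: flat_def\<close>)
  with greater show ?thesis by (simp add: flat_def)
qed

lemma smooth_flat: "smooth_on UNIV UNIV (flat j)"
proof -
  have "Ck_on k UNIV UNIV (flat j)" for k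
  proof (induction k arbitrary: j)
    case 0
    have "continuous_on UNIV (flat j)"
      using DERIV_isCont[OF flat_has_derivative] by (simp add: continuous_at_imp_continuous_on)
    then show ?case by simp
  next
    case (Suc k)
    have "Ck_on k UNIV UNIV (\<lambda>x. (flat (j + 2) x + (- real j) * flat (j + 1) x) * v)" for v
      by (intro Ck_on_mult Ck_on_add Suc.IH Ck_on_const)
    moreover have "(flat j has_derivative (\<lambda>v. (flat (j + 2) x + (- real j) * flat (j + 1) x) * v)) (at x)" for x
      using flat_has_derivative[of j x] by (simp add: has_field_derivative_def)
    ultimately show ?case
      unfolding Ck_on.simps
      by (intro exI[of _ "\<lambda>x v. (flat (j + 2) x + (- real j) * flat (j + 1) x) * v"]) simp
  qed
  then show ?thesis by (simp add: smooth_on_def)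
qed

text \<open>Applying \<open>flat 0\<close> twice gives a plateau at both ends. With \<open>s\<close>
  the squared relative distance, \<open>flat 0 (1 - s)\<close> is 0 from radius \<open>r\<close> on
  and at least \<open>a\<close> up to radius \<open>r / 2\<close>. Hence
  \<open>flat 0 (a - flat 0 (1 - s))\<close> equals \<open>flat 0 a\<close> outside and 0 inside,
  and \<open>\<rho>\<close> is one minus its quotient by \<open>flat 0 a\<close>.\<close>

lemma bump_exists:
  fixes x0 :: "'e::euclidean_space"
  assumes "r > 0"
  obtains \<rho> :: "'e \<Rightarrow> real" where "\<And>E U. smooth_on E U \<rho>"
    "\<And>x. dist x0 x \<le> r / 2 \<Longrightarrow> \<rho> x = 1" "\<And>x. r \<le> dist x0 x \<Longrightarrow> \<rho> x = 0"
proof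
  \<comment> \<open>Unlike the distance, its square is smooth at the centre too. It is spelled out
    by sums, products and constants to match the closure rules of \<open>smooth_on\<close>.\<close>
  define s where
    "s x = 1 / r\<^sup>2 * (\<Sum>b\<in>Basis. (x \<bullet> b + - (x0 \<bullet> b)) * (x \<bullet> b + - (x0 \<bullet> b)))" for x :: 'e
  \<comment> \<open>Within radius \<open>r / 2\<close> the value of \<open>s\<close> is at most
    \<open>1 / 4\<close>, so \<open>1 - s\<close> is at least \<open>1 / 2\<close>, and
    \<open>flat 0\<close> is monotone.\<close>
  define a where "a = flat 0 (1 / 2)"
  define \<rho> where "\<rho> x = 1 + (- 1 / flat 0 a) * flat 0 (a + (- 1) * flat 0 (1 + (- 1) * s x))" for x
  show "smooth_on E U \<rho>" for E U
    unfolding \<rho>_def s_def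
    by (intro smooth_on_add smooth_on_mult smooth_on_const smooth_on_sum smooth_on_linear
        bounded_linear_inner_left smooth_on_compose[OF subspace_UNIV subset_UNIV smooth_flat] subset_UNIV)
  have s: "s x = (dist x0 x / r)\<^sup>2" for x
  proof -
    have "(\<Sum>b\<in>Basis. (x \<bullet> b + - (x0 \<bullet> b)) * (x \<bullet> b + - (x0 \<bullet> b))) = (x - x0) \<bullet> (x - x0)"
      unfolding euclidean_inner[of "x - x0" "x - x0"] by (simp add: inner_diff_left)
    moreover have "(dist x0 x)\<^sup>2 = (x - x0) \<bullet> (x - x0)"
      by (metis dist_commute dist_norm power2_norm_eq_inner)
    ultimately show ?thesis
      unfolding s_def by (simp add: power_divide)
  qed
  have pos: "flat 0 x > 0" if "x > 0" for x
    using that by (simp add: flat_def)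
  have "a > 0" "flat 0 a > 0"
    using pos by (simp_all add: a_def)
  have mono: "flat 0 x \<le> flat 0 y" if "x \<le> y" for x y
    using that by (auto simp: flat_def field_simps)
  fix x :: 'e
  show "\<rho> x = 1" if "dist x0 x \<le> r / 2"
  proof -
    have "dist x0 x / r \<le> 1 / 2"
      using that assms by (simp add: field_simps)
    then have "s x \<le> (1 / 2)\<^sup>2"
      unfolding s using assms by (intro power_mono) auto
    also have "\<dots> \<le> 1 / 2"
      by (simp add: power2_eq_square)
    finally have "a \<le> flat 0 (1 - s x)"
      unfolding a_def by (intro mono) simp
    then show ?thesis
      by (simp add: \<rho>_def flat_def[of 0 "a - _"])
  qed
  show "\<rho> x = 0" if "r \<le> dist x0 x"
  proof -
    have "1 \<le> dist x0 x / r"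
      using that assms by (simp add: field_simps)
    then have "1 \<le> s x"
      unfolding s by (simp add: one_le_power)
    then have "flat 0 (1 - s x) = 0"
      by (simp add: flat_def)
    then show ?thesis
      using \<open>flat 0 a > 0\<close> by (simp add: \<rho>_def)
  qed
qed

subsection \<open>Hadamard's lemma\<close>

lemma segment_in_convex:
  fixes x0 x :: "'a::real_vector"
  assumes "convex S" "x0 \<in> S" "x \<in> S" "t \<in> {0..1}"
  shows "x0 + t *\<^sub>R (x - x0) \<in> S"
  using convexD_alt[OF assms(1-3), of t] assms(4) by (simp add: algebra_simps)

text \<open>Differentiating \<open>f (x0 + t *\<^sub>R (x - x0))\<close> in \<open>x\<close>
  produces a factor \<open>t\<close> and a directional derivative of \<open>f\<close>. The weight
  \<open>t ^ j\<close> and the arbitrary \<open>f\<close> absorb both, so that the induction on the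
  order closes.\<close>

lemma Ck_on_segment_integral:
  fixes f :: "'e::euclidean_space \<Rightarrow> real"
  assumes E: "subspace E" and S: "openin (top_of_set E) S" and conv: "convex S" and x0: "x0 \<in> S"
  shows "smooth_on E S f \<Longrightarrow>
    Ck_on k E S (\<lambda>x. integral (cbox 0 1) (\<lambda>t. t ^ j * f (x0 + t *\<^sub>R (x - x0))))"
proof (induction k arbitrary: f j)
  case 0
  have "continuous_on (S \<times> cbox 0 1) (\<lambda>y. snd y ^ j * f (x0 + snd y *\<^sub>R (fst y - x0)))"
    using segment_in_convex[OF conv x0]
    by (intro continuous_intros continuous_on_compose2[OF smooth_on_imp_continuous_on[OF 0]]) auto
  then show ?case
    unfolding Ck_on.simps by (intro integral_continuous_on_param) (simp add: split_beta)
next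
  case (Suc k)
  obtain B where B: "finite B" "B \<subseteq> E" "\<And>x. x \<in> E \<Longrightarrow> (\<Sum>b\<in>B. (x \<bullet> b) *\<^sub>R b) = x"
    using orthonormal_expansion[OF E] by metis
  have df: "smooth_on E S (dirderiv b f)" if "b \<in> B" for b
    using smooth_on_dirderiv[OF E S Suc.prems] B(2) that by blast
  define c where "c b x t = t ^ Suc j * dirderiv b f (x0 + t *\<^sub>R (x - x0))" for b x and t :: real
  \<comment> \<open>The derivative of the integrand in \<open>x\<close>, packed as a bounded linear
    operator: differentiation under the integral sign asks for joint continuity of this
    operator.\<close>
  define D where "D x t = (\<Sum>b\<in>B. c b x t *\<^sub>R blinfun_inner_left b)" for x t
  have cont: "continuous_on (S \<times> cbox 0 1) (\<lambda>y. c b (fst y) (snd y))" if "b \<in> B" for b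
    unfolding c_def using segment_in_convex[OF conv x0]
    by (intro continuous_intros continuous_on_compose2[OF smooth_on_imp_continuous_on[OF df[OF that]]])
      auto
  have integral_D: "integral (cbox 0 1) (D x) = (\<Sum>b\<in>B. integral (cbox 0 1) (c b x) *\<^sub>R blinfun_inner_left b)"
    if x: "x \<in> S" for x
  proof -
    have "continuous_on (cbox 0 1) (c b x)" if "b \<in> B" for b
      using continuous_on_compose2[OF cont[OF that], of "cbox 0 1" "\<lambda>t. (x, t)"] x
        continuous_on_Pair[OF continuous_on_const continuous_on_id, of "{0..1}" x]
      by auto
    then have "(D x has_integral (\<Sum>b\<in>B. integral (cbox 0 1) (c b x) *\<^sub>R blinfun_inner_left b)) (cbox 0 1)"
      unfolding D_def
      by (intro has_integral_sum B(1) has_integral_scaleR_left integrable_integral integrable_continuous)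
    then show ?thesis by (rule integral_unique)
  qed
  have "((\<lambda>x. integral (cbox 0 1) (\<lambda>t. t ^ j * f (x0 + t *\<^sub>R (x - x0)))) has_derivative
      blinfun_apply (integral (cbox 0 1) (D x))) (at x within S)" if x: "x \<in> S" for x
  proof (rule leibniz_rule[OF _ _ _ x conv])
    fix x t assume x: "x \<in> S" and t: "t \<in> cbox 0 (1::real)"
    let ?y = "x0 + t *\<^sub>R (x - x0)"
    have y: "?y \<in> S"
      using segment_in_convex[OF conv x0 x] t by simp
    have "(f has_derivative (\<lambda>v. \<Sum>b\<in>B. (v \<bullet> b) *\<^sub>R dirderiv b f ?y)) (at ?y within S)"
      by (rule has_derivative_dirderiv[OF E S y B smooth_on_imp_differentiable[OF Suc.prems y]])
    then have "(f has_derivative (\<lambda>v. \<Sum>b\<in>B. (v \<bullet> b) *\<^sub>R dirderiv b f ?y))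
        (at ?y within (\<lambda>x. x0 + t *\<^sub>R (x - x0)) ` S)"
      using segment_in_convex[OF conv x0] t by (elim has_derivative_subset) auto
    moreover have "((\<lambda>x. x0 + t *\<^sub>R (x - x0)) has_derivative (\<lambda>v. t *\<^sub>R v)) (at x within S)"
      by (auto intro!: derivative_eq_intros)
    ultimately have "((\<lambda>x. f (x0 + t *\<^sub>R (x - x0))) has_derivative
        (\<lambda>v. \<Sum>b\<in>B. (t *\<^sub>R v \<bullet> b) *\<^sub>R dirderiv b f ?y)) (at x within S)"
      using diff_chain_within unfolding o_def by blast
    then have "((\<lambda>x. t ^ j * f (x0 + t *\<^sub>R (x - x0))) has_derivative
        (\<lambda>v. t ^ j * (\<Sum>b\<in>B. (t *\<^sub>R v \<bullet> b) *\<^sub>R dirderiv b f ?y))) (at x within S)"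
      by (rule has_derivative_mult_right)
    moreover have "(\<lambda>v. t ^ j * (\<Sum>b\<in>B. (t *\<^sub>R v \<bullet> b) *\<^sub>R dirderiv b f ?y)) = blinfun_apply (D x t)"
      by (auto simp: D_def c_def blinfun.sum_left blinfun.scaleR_left sum_distrib_left mult_ac)
    ultimately show "((\<lambda>x. t ^ j * f (x0 + t *\<^sub>R (x - x0))) has_derivative blinfun_apply (D x t)) (at x within S)"
      by simp
  next
    fix x assume x: "x \<in> S"
    show "(\<lambda>t. t ^ j * f (x0 + t *\<^sub>R (x - x0))) integrable_on cbox 0 1"
      using segment_in_convex[OF conv x0 x]
      by (intro integrable_continuous continuous_intros
          continuous_on_compose2[OF smooth_on_imp_continuous_on[OF Suc.prems]]) auto
  next
    show "continuous_on (S \<times> cbox 0 1) (\<lambda>(x, t). D x t)"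
      unfolding D_def split_beta by (intro continuous_intros cont)
  qed
  moreover have "Ck_on k E S (\<lambda>x. blinfun_apply (integral (cbox 0 1) (D x)) v)" for v
  proof -
    have "Ck_on k E S (\<lambda>x. \<Sum>b\<in>B. integral (cbox 0 1) (c b x) * (v \<bullet> b))"
      unfolding c_def by (intro Ck_on_sum Ck_on_mult Ck_on_const Suc.IH df)
    then show ?thesis
      by (subst Ck_on_cong) (auto simp: integral_D[unfolded box_real] blinfun.sum_left blinfun.scaleR_left)
  qed
  ultimately show ?case
    unfolding Ck_on.simps
    by (intro exI[of _ "\<lambda>x. blinfun_apply (integral (cbox 0 1) (D x))"]) blast
qed

text \<open>Fundamental theorem of calculus along the segment from \<open>x0\<close> to
  \<open>x\<close>, which convexity keeps in \<open>S\<close>. The factor \<open>G b\<close> is the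
  average of \<open>dirderiv b f\<close> over that segment, so at \<open>x0\<close> it is the value
  itself.\<close>

lemma Hadamard:
  fixes f :: "'e::euclidean_space \<Rightarrow> real"
  assumes E: "subspace E" and S: "openin (top_of_set E) S" and conv: "convex S" and x0: "x0 \<in> S"
    and f: "smooth_on E S f"
    and B: "finite B" "B \<subseteq> E" "\<And>x. x \<in> E \<Longrightarrow> (\<Sum>b\<in>B. (x \<bullet> b) *\<^sub>R b) = x"
  obtains G where "\<And>b. b \<in> B \<Longrightarrow> smooth_on E S (G b)"
    "\<And>x. x \<in> S \<Longrightarrow> f x = f x0 + (\<Sum>b\<in>B. ((x - x0) \<bullet> b) * G b x)"
    "\<And>b. b \<in> B \<Longrightarrow> G b x0 = dirderiv b f x0"
proof
  \<comment> \<open>The factor \<open>t ^ 0\<close> matches the weight in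
    \<open>Ck_on_segment_integral\<close>.\<close>
  define G where "G b x = integral (cbox 0 1) (\<lambda>t. t ^ 0 * dirderiv b f (x0 + t *\<^sub>R (x - x0)))" for b x
  have df: "smooth_on E S (dirderiv b f)" if "b \<in> B" for b
    using smooth_on_dirderiv[OF E S f] B(2) that by blast
  show "smooth_on E S (G b)" if "b \<in> B" for b
    unfolding smooth_on_def G_def using Ck_on_segment_integral[OF E S conv x0 df[OF that]] by blast
  show "G b x0 = dirderiv b f x0" if "b \<in> B" for b
    by (simp add: G_def)
  fix x assume x: "x \<in> S"
  let ?y = "\<lambda>t. x0 + t *\<^sub>R (x - x0)"
  have "((\<lambda>t. \<Sum>b\<in>B. ((x - x0) \<bullet> b) * dirderiv b f (?y t)) has_integral f (?y 1) - f (?y 0)) {0..1}"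
  proof (rule fundamental_theorem_of_calculus)
    fix t :: real assume t: "t \<in> {0..1}"
    have y: "?y t \<in> S"
      using segment_in_convex[OF conv x0 x t] .
    have "(f has_derivative (\<lambda>v. \<Sum>b\<in>B. (v \<bullet> b) *\<^sub>R dirderiv b f (?y t))) (at (?y t) within S)"
      by (rule has_derivative_dirderiv[OF E S y B smooth_on_imp_differentiable[OF f y]])
    then have "(f has_derivative (\<lambda>v. \<Sum>b\<in>B. (v \<bullet> b) *\<^sub>R dirderiv b f (?y t))) (at (?y t) within ?y ` {0..1})"
      using segment_in_convex[OF conv x0 x] by (elim has_derivative_subset) auto
    moreover have "(?y has_derivative (\<lambda>s. s *\<^sub>R (x - x0))) (at t within {0..1})"
      by (auto intro!: derivative_eq_intros)
    ultimately have "((\<lambda>t. f (?y t)) has_derivative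
        (\<lambda>s. \<Sum>b\<in>B. (s *\<^sub>R (x - x0) \<bullet> b) *\<^sub>R dirderiv b f (?y t))) (at t within {0..1})"
      using diff_chain_within unfolding o_def by blast
    then show "((\<lambda>t. f (?y t)) has_vector_derivative (\<Sum>b\<in>B. ((x - x0) \<bullet> b) * dirderiv b f (?y t)))
        (at t within {0..1})"
      by (simp add: has_vector_derivative_def sum_distrib_left mult_ac)
  qed simp
  moreover have "((\<lambda>t. \<Sum>b\<in>B. ((x - x0) \<bullet> b) * dirderiv b f (?y t)) has_integral
      (\<Sum>b\<in>B. ((x - x0) \<bullet> b) * G b x)) {0..1}"
  proof (intro has_integral_sum B(1) has_integral_mult_right)
    fix b assume "b \<in> B"
    have "(\<lambda>t. dirderiv b f (?y t)) integrable_on {0..1}"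
      using segment_in_convex[OF conv x0 x]
      by (intro integrable_continuous_interval continuous_intros
          continuous_on_compose2[OF smooth_on_imp_continuous_on[OF df[OF \<open>b \<in> B\<close>]]]) auto
    then show "((\<lambda>t. dirderiv b f (?y t)) has_integral G b x) {0..1}"
      by (simp add: G_def has_integral_integral)
  qed
  ultimately have "f (?y 1) - f (?y 0) = (\<Sum>b\<in>B. ((x - x0) \<bullet> b) * G b x)"
    by (rule has_integral_unique)
  then show "f x = f x0 + (\<Sum>b\<in>B. ((x - x0) \<bullet> b) * G b x)"
    by simp
qed

section \<open>Functions and derivations on a manifold\<close>

lemma smooth_algebra_simps:
  "f \<oplus>\<^bsub>C\<^sup>\<infinity> M\<^esub> g = (\<lambda>x\<in>pts M. f x + g x)"
  "f \<otimes>\<^bsub>C\<^sup>\<infinity> M\<^esub> g = (\<lambda>x\<in>pts M. f x * g x)"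
  "c \<odot>\<^bsub>C\<^sup>\<infinity> M\<^esub> f = (\<lambda>x\<in>pts M. c * f x)"
  "\<zero>\<^bsub>C\<^sup>\<infinity> M\<^esub> = (\<lambda>x\<in>pts M. 0)"
  "\<one>\<^bsub>C\<^sup>\<infinity> M\<^esub> = (\<lambda>x\<in>pts M. 1)"
  by (simp_all add: smooth_algebra_def)

section \<open>Charts and smooth functions on a manifold\<close>

locale smooth_mfd =
  fixes M :: "('a, 'e::euclidean_space) manifold"
  assumes smooth_manifold: "smooth_manifold M"
begin

lemma subspace_model: "subspace (model M)"
  and Hausdorff: "Hausdorff_space (mtop M)"
  using smooth_manifold by (auto simp: smooth_manifold_def)

lemma chart_at:
  assumes "p \<in> pts M"
  obtains U \<phi> where "(U, \<phi>) \<in> atlas M" "p \<in> U"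
proof -
  have "p \<in> (\<Union>(U, \<phi>)\<in>atlas M. U)"
    using assms smooth_manifold unfolding smooth_manifold_def by blast
  then show thesis using that by blast
qed

context
  fixes U and \<phi> :: "'a \<Rightarrow> 'e"
  assumes chart: "(U, \<phi>) \<in> atlas M"
begin

lemma chart_open: "openin (mtop M) U"
  and chart_image_open: "openin (top_of_set (model M)) (\<phi> ` U)"
  and chart_homeo: "homeomorphic_map (subtopology (mtop M) U) (top_of_set (\<phi> ` U)) \<phi>"
  using smooth_manifold chart unfolding smooth_manifold_def by fast+

lemma chart_subset: "U \<subseteq> pts M"
  using chart_open by (rule openin_subset)

lemma chart_topspace: "topspace (subtopology (mtop M) U) = U"
  using chart_subset by auto

lemma chart_inj: "inj_on \<phi> U"
  using homeomorphic_imp_injective_map[OF chart_homeo] unfolding chart_topspace .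

lemma chart_inv: "x \<in> U \<Longrightarrow> inv_into U \<phi> (\<phi> x) = x"
  using chart_inj by simp

lemma chart_image_openin:
  assumes "openin (mtop M) W" "W \<subseteq> U"
  shows "openin (top_of_set (model M)) (\<phi> ` W)"
proof -
  have "openin (subtopology (mtop M) U) W"
    using assms by (simp add: openin_open_subtopology[OF chart_open])
  then have "openin (top_of_set (\<phi> ` U)) (\<phi> ` W)"
    using homeomorphic_imp_open_map[OF chart_homeo] by (simp add: open_map_def)
  then show ?thesis
    using chart_image_open openin_trans by blast
qed

lemma chart_preimage_openin:
  assumes "openin (top_of_set (model M)) Q"
  shows "openin (mtop M) {x \<in> U. \<phi> x \<in> Q}"
proof -
  have "openin (top_of_set (\<phi> ` U)) (Q \<inter> \<phi> ` U)"
    using openin_imp_subset[OF chart_image_open] openin_subset_trans[of "model M" "Q \<inter> \<phi> ` U" "\<phi> ` U"]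
      openin_Int[OF assms chart_image_open] by auto
  then have "openin (subtopology (mtop M) U) {x \<in> topspace (subtopology (mtop M) U). \<phi> x \<in> Q \<inter> \<phi> ` U}"
    by (rule openin_continuous_map_preimage[OF homeomorphic_imp_continuous_map[OF chart_homeo]])
  then have "openin (subtopology (mtop M) U) {x \<in> U. \<phi> x \<in> Q}"
    unfolding chart_topspace by (rule back_subst) auto
  then show ?thesis
    using openin_trans_full chart_open by blast
qed

end

lemma transition_smooth:
  assumes "(U, \<phi>) \<in> atlas M" "(W, \<psi>) \<in> atlas M"
  shows "smooth_on (model M) (\<phi> ` (U \<inter> W)) (\<lambda>y. \<psi> (inv_into U \<phi> y))"
  using smooth_manifold assms unfolding smooth_manifold_def o_def by fast

text \<open>\<open>smooth_fun\<close> tests every chart, while constructions supply a formula in one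
  chart chosen at each point. Transition maps carry the formula to any other chart.\<close>

lemma smooth_fun_localI:
  assumes "\<And>p. p \<in> pts M \<Longrightarrow> \<exists>U \<phi> Q F. (U, \<phi>) \<in> atlas M \<and> p \<in> U \<and> \<phi> p \<in> Q \<and>
    openin (top_of_set (model M)) Q \<and> smooth_on (model M) Q F \<and> (\<forall>x\<in>U. \<phi> x \<in> Q \<longrightarrow> f x = F (\<phi> x))"
  shows "smooth_fun M f"
  unfolding smooth_fun_def
proof (clarify)
  fix W \<psi> assume W: "(W, \<psi>) \<in> atlas M"
  show "smooth_on (model M) (\<psi> ` W) (f \<circ> inv_into W \<psi>)"
  proof (rule smooth_on_local[OF subspace_model chart_image_open[OF W]])
    fix y assume "y \<in> \<psi> ` W"
    then obtain p where p: "p \<in> W" "y = \<psi> p" by auto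
    then have "p \<in> pts M"
      using chart_subset[OF W] by auto
    then obtain U \<phi> Q F where U: "(U, \<phi>) \<in> atlas M" "p \<in> U" "\<phi> p \<in> Q"
      "openin (top_of_set (model M)) Q" "smooth_on (model M) Q F" "\<forall>x\<in>U. \<phi> x \<in> Q \<longrightarrow> f x = F (\<phi> x)"
      using assms by meson
    \<comment> \<open>The region where the local formula and the chart under test are both
      available.\<close>
    define Z where "Z = {x \<in> U. \<phi> x \<in> Q} \<inter> W"
    have Z: "openin (mtop M) Z" "Z \<subseteq> W"
      unfolding Z_def using chart_preimage_openin[OF U(1,4)] chart_open[OF W] by auto
    have inv: "inv_into W \<psi> (\<psi> x) = x" if "x \<in> Z" for x
      using chart_inv[OF W] that by (auto simp: Z_def)
    have "smooth_on (model M) (\<psi> ` Z) (\<lambda>y. \<phi> (inv_into W \<psi> y))"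
      by (rule smooth_on_subset[OF transition_smooth[OF W U(1)]]) (auto simp: Z_def)
    then have "smooth_on (model M) (\<psi> ` Z) (\<lambda>y. F (\<phi> (inv_into W \<psi> y)))"
      using inv openin_imp_subset[OF U(4)]
      by (intro smooth_on_compose[OF subspace_model _ U(5)]) (auto simp: Z_def)
    then have "smooth_on (model M) (\<psi> ` Z) (f \<circ> inv_into W \<psi>)"
      by (rule iffD1[OF smooth_on_cong, rotated]) (use U(6) inv in \<open>auto simp: Z_def\<close>)
    then show "\<exists>T. openin (top_of_set (model M)) T \<and> y \<in> T \<and> T \<subseteq> \<psi> ` W \<and>
        smooth_on (model M) T (f \<circ> inv_into W \<psi>)"
      using chart_image_openin[OF W Z] Z(2) p U by (intro exI[of _ "\<psi> ` Z"]) (auto simp: Z_def)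
  qed
qed

lemma carrier_iff: "f \<in> carrier (C\<^sup>\<infinity> M) \<longleftrightarrow> f \<in> extensional (pts M) \<and> smooth_fun M f"
  by (simp add: smooth_algebra_def)

lemma smooth_fun_chart:
  "smooth_fun M f \<Longrightarrow> (U, \<phi>) \<in> atlas M \<Longrightarrow> smooth_on (model M) (\<phi> ` U) (\<lambda>y. f (inv_into U \<phi> y))"
  unfolding smooth_fun_def o_def by fast

lemma restrict_carrierI:
  assumes "\<And>U \<phi>. (U, \<phi>) \<in> atlas M \<Longrightarrow> smooth_on (model M) (\<phi> ` U) (\<lambda>y. f (inv_into U \<phi> y))"
  shows "(\<lambda>x\<in>pts M. f x) \<in> carrier (C\<^sup>\<infinity> M)"
  unfolding carrier_iff smooth_fun_def
proof safe
  fix U \<phi> assume U: "(U, \<phi>) \<in> atlas M"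
  have "inv_into U \<phi> y \<in> pts M" if "y \<in> \<phi> ` U" for y
    using inv_into_into[OF that] chart_subset[OF U] by auto
  then show "smooth_on (model M) (\<phi> ` U) (restrict f (pts M) \<circ> inv_into U \<phi>)"
    using assms[OF U] smooth_on_cong[of "\<phi> ` U" "restrict f (pts M) \<circ> inv_into U \<phi>"] by auto
qed auto

lemma carrier_chart:
  "f \<in> carrier (C\<^sup>\<infinity> M) \<Longrightarrow> (U, \<phi>) \<in> atlas M \<Longrightarrow> smooth_on (model M) (\<phi> ` U) (\<lambda>y. f (inv_into U \<phi> y))"
  using smooth_fun_chart carrier_iff by blast

lemma add_carrier:
  "f \<in> carrier (C\<^sup>\<infinity> M) \<Longrightarrow> g \<in> carrier (C\<^sup>\<infinity> M) \<Longrightarrow> (\<lambda>x\<in>pts M. f x + g x) \<in> carrier (C\<^sup>\<infinity> M)"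
  by (intro restrict_carrierI smooth_on_add carrier_chart)

lemma mult_carrier:
  "f \<in> carrier (C\<^sup>\<infinity> M) \<Longrightarrow> g \<in> carrier (C\<^sup>\<infinity> M) \<Longrightarrow> (\<lambda>x\<in>pts M. f x * g x) \<in> carrier (C\<^sup>\<infinity> M)"
  by (intro restrict_carrierI smooth_on_mult carrier_chart)

lemma const_carrier: "(\<lambda>x\<in>pts M. c) \<in> carrier (C\<^sup>\<infinity> M)"
  by (intro restrict_carrierI smooth_on_const)

lemma smult_carrier: "f \<in> carrier (C\<^sup>\<infinity> M) \<Longrightarrow> (\<lambda>x\<in>pts M. c * f x) \<in> carrier (C\<^sup>\<infinity> M)"
  by (intro restrict_carrierI smooth_on_mult smooth_on_const carrier_chart)

lemma sum_carrier:
  "(\<And>b. b \<in> B \<Longrightarrow> f b \<in> carrier (C\<^sup>\<infinity> M)) \<Longrightarrow> (\<lambda>x\<in>pts M. \<Sum>b\<in>B. f b x) \<in> carrier (C\<^sup>\<infinity> M)"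
  by (rule restrict_carrierI, rule smooth_on_sum, rule carrier_chart) auto

lemma carrier_eqI:
  assumes "f \<in> carrier (C\<^sup>\<infinity> M)" "g \<in> carrier (C\<^sup>\<infinity> M)" "\<And>x. x \<in> pts M \<Longrightarrow> f x = g x"
  shows "f = g"
  using assms by (auto simp: carrier_iff intro: extensionalityI)

text \<open>The algebra consists of extensional functions, so its equations can be tested at points
  of \<open>M\<close>; the calculations below evaluate at a single point.\<close>

lemma derivations_iff: "D \<in> derivations (C\<^sup>\<infinity> M) \<longleftrightarrow>
    D \<in> carrier (C\<^sup>\<infinity> M) \<rightarrow>\<^sub>E carrier (C\<^sup>\<infinity> M) \<and>
    (\<forall>f\<in>carrier (C\<^sup>\<infinity> M). \<forall>g\<in>carrier (C\<^sup>\<infinity> M). \<forall>x\<in>pts M. D (\<lambda>x\<in>pts M. f x + g x) x = D f x + D g x) \<and>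
    (\<forall>c. \<forall>f\<in>carrier (C\<^sup>\<infinity> M). \<forall>x\<in>pts M. D (\<lambda>x\<in>pts M. c * f x) x = c * D f x) \<and>
    (\<forall>f\<in>carrier (C\<^sup>\<infinity> M). \<forall>g\<in>carrier (C\<^sup>\<infinity> M). \<forall>x\<in>pts M.
       D (\<lambda>x\<in>pts M. f x * g x) x = f x * D g x + D f x * g x)"
proof -
  have ext: "h = (\<lambda>x\<in>pts M. k x) \<longleftrightarrow> (\<forall>x\<in>pts M. h x = k x)" if "h \<in> carrier (C\<^sup>\<infinity> M)" for h k
    using that by (auto simp: carrier_iff intro: extensionalityI)
  have "D \<in> carrier (C\<^sup>\<infinity> M) \<rightarrow>\<^sub>E carrier (C\<^sup>\<infinity> M) \<Longrightarrow> f \<in> carrier (C\<^sup>\<infinity> M) \<Longrightarrow> D f \<in> carrier (C\<^sup>\<infinity> M)" for f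
    by auto
  then show ?thesis
    unfolding derivations_def smooth_algebra_simps
    by (auto simp: ext add_carrier smult_carrier mult_carrier)
qed

section \<open>Derivations and their locality\<close>

context
  fixes D
  assumes D: "D \<in> derivations (C\<^sup>\<infinity> M)"
begin

lemma derivation_carrier: "f \<in> carrier (C\<^sup>\<infinity> M) \<Longrightarrow> D f \<in> carrier (C\<^sup>\<infinity> M)"
  and derivation_add: "f \<in> carrier (C\<^sup>\<infinity> M) \<Longrightarrow> g \<in> carrier (C\<^sup>\<infinity> M) \<Longrightarrow> x \<in> pts M \<Longrightarrow>
    D (\<lambda>x\<in>pts M. f x + g x) x = D f x + D g x"
  and derivation_smult: "f \<in> carrier (C\<^sup>\<infinity> M) \<Longrightarrow> x \<in> pts M \<Longrightarrow> D (\<lambda>x\<in>pts M. c * f x) x = c * D f x"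
  and derivation_mult: "f \<in> carrier (C\<^sup>\<infinity> M) \<Longrightarrow> g \<in> carrier (C\<^sup>\<infinity> M) \<Longrightarrow> x \<in> pts M \<Longrightarrow>
    D (\<lambda>x\<in>pts M. f x * g x) x = f x * D g x + D f x * g x"
  using D unfolding derivations_iff by (simp_all add: PiE_iff)

lemma derivation_const:
  assumes "x \<in> pts M"
  shows "D (\<lambda>x\<in>pts M. c) x = 0"
proof -
  \<comment> \<open>The Leibniz rule for \<open>1 * 1\<close> makes the derivative of the constant 1
    equal to its double; linearity then covers every constant.\<close>
  have "D (\<lambda>x\<in>pts M. 1 * 1) x = (1 * D (\<lambda>x\<in>pts M. 1) x + D (\<lambda>x\<in>pts M. 1) x * 1)"
    using derivation_mult[OF const_carrier[of 1] const_carrier[of 1] assms] assms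
    by (simp cong: restrict_cong)
  then have "D (\<lambda>x\<in>pts M. 1) x = 0" by simp
  moreover have "D (\<lambda>x\<in>pts M. c * 1) x = c * D (\<lambda>x\<in>pts M. 1) x"
    using derivation_smult[OF const_carrier[of 1] assms, of c] by (simp cong: restrict_cong)
  ultimately show ?thesis by simp
qed

lemma derivation_sum:
  assumes x: "x \<in> pts M"
  shows "finite B \<Longrightarrow> (\<And>b. b \<in> B \<Longrightarrow> f b \<in> carrier (C\<^sup>\<infinity> M)) \<Longrightarrow>
    D (\<lambda>x\<in>pts M. \<Sum>b\<in>B. f b x) x = (\<Sum>b\<in>B. D (f b) x)"
proof (induction B rule: finite_induct)
  case empty
  then show ?case using derivation_const[OF x, of 0] by (simp add: restrict_def)
next
  case (insert b B)
  have "D (\<lambda>x\<in>pts M. f b x + (\<lambda>x\<in>pts M. \<Sum>b\<in>B. f b x) x) x = D (f b) x + D (\<lambda>x\<in>pts M. \<Sum>b\<in>B. f b x) x"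
    using insert.prems x by (intro derivation_add sum_carrier) auto
  moreover have "(\<lambda>x\<in>pts M. f b x + (\<lambda>x\<in>pts M. \<Sum>b\<in>B. f b x) x) = (\<lambda>x\<in>pts M. \<Sum>b\<in>insert b B. f b x)"
    using insert.hyps by (auto intro: restrict_ext)
  moreover have "D (\<lambda>x\<in>pts M. \<Sum>b\<in>B. f b x) x = (\<Sum>b\<in>B. D (f b) x)"
    using insert.IH insert.prems by blast
  ultimately have "D (\<lambda>x\<in>pts M. \<Sum>b\<in>insert b B. f b x) x = D (f b) x + (\<Sum>b\<in>B. D (f b) x)"
    by metis
  also have "\<dots> = (\<Sum>b\<in>insert b B. D (f b) x)"
    using insert.hyps by simp
  finally show ?case .
qed

end

text \<open>Turns functions on a coordinate neighbourhood into elements of the algebra without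
  changing them over \<open>T\<close>. The bump is fixed before \<open>F\<close> is quantified, so
  that one \<open>\<rho>\<close> serves all functions of a computation.\<close>

lemma bump_extension:
  assumes U: "(U, \<phi>) \<in> atlas M" and p: "p \<in> U" and Q: "openin (top_of_set (model M)) Q"
    and pQ: "\<phi> p \<in> Q" and QU: "Q \<subseteq> \<phi> ` U"
  obtains T \<rho> where "openin (top_of_set (model M)) T" "\<phi> p \<in> T" "T \<subseteq> Q" "\<forall>y\<in>T. \<rho> y = (1::real)"
    "\<forall>F. smooth_on (model M) Q F \<longrightarrow>
      (\<lambda>x\<in>pts M. if x \<in> U \<and> \<phi> x \<in> Q then \<rho> (\<phi> x) * F (\<phi> x) else 0) \<in> carrier (C\<^sup>\<infinity> M)"
proof -
  obtain r where r: "r > 0" "cball (\<phi> p) r \<inter> model M \<subseteq> Q"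
    using Q pQ unfolding openin_contains_cball by blast
  obtain \<rho> :: "'e \<Rightarrow> real" where \<rho>: "\<And>E U. smooth_on E U \<rho>"
    "\<And>x. dist (\<phi> p) x \<le> r / 2 \<Longrightarrow> \<rho> x = 1" "\<And>x. r \<le> dist (\<phi> p) x \<Longrightarrow> \<rho> x = 0"
    using bump_exists[OF r(1), of "\<phi> p"] by metis
  define T where "T = model M \<inter> ball (\<phi> p) (r / 2)"
  \<comment> \<open>Over the chart, the bump is nonzero only inside \<open>K\<close>. Compactness
    passes through the chart, and the Hausdorff property makes \<open>K\<close> closed in all of
    \<open>M\<close>, not merely in \<open>U\<close>.\<close>
  define K where "K = {x \<in> U. \<phi> x \<in> cball (\<phi> p) r \<inter> model M}"
  have "\<phi> ` K = cball (\<phi> p) r \<inter> model M"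
    using r(2) QU by (auto simp: K_def)
  then have "compactin (top_of_set (\<phi> ` U)) (\<phi> ` K)"
    using r(2) QU closed_subspace[OF subspace_model]
    by (auto simp: compactin_subtopology intro: compact_Int_closed)
  then have "compactin (subtopology (mtop M) U) K"
    using homeomorphic_map_compactness[OF chart_homeo[OF U], of K] chart_topspace[OF U]
    by (auto simp: K_def)
  then have K: "closedin (mtop M) K"
    using compactin_imp_closedin[OF Hausdorff] compactin_subtopology by blast
  show thesis
  proof
    show "openin (top_of_set (model M)) T" "\<phi> p \<in> T"
      using pQ openin_imp_subset[OF Q] r(1) by (auto simp: T_def openin_open)
    show "T \<subseteq> Q"
      using r by (auto simp: T_def subset_iff)
    show "\<forall>y\<in>T. \<rho> y = 1"
      using \<rho>(2) by (auto simp: T_def)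
    have "(\<lambda>x\<in>pts M. if x \<in> U \<and> \<phi> x \<in> Q then \<rho> (\<phi> x) * F (\<phi> x) else 0) \<in> carrier (C\<^sup>\<infinity> M)"
      if F: "smooth_on (model M) Q F" for F :: "'e \<Rightarrow> real"
    proof -
      define f where "f = (\<lambda>x\<in>pts M. if x \<in> U \<and> \<phi> x \<in> Q then \<rho> (\<phi> x) * F (\<phi> x) else 0)"
      have "smooth_fun M f"
      proof (rule smooth_fun_localI)
        fix q assume q: "q \<in> pts M"
        show "\<exists>U \<phi> Q F. (U, \<phi>) \<in> atlas M \<and> q \<in> U \<and> \<phi> q \<in> Q \<and>
            openin (top_of_set (model M)) Q \<and> smooth_on (model M) Q F \<and> (\<forall>x\<in>U. \<phi> x \<in> Q \<longrightarrow> f x = F (\<phi> x))"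
        proof (cases "q \<in> U \<and> \<phi> q \<in> Q")
          case True
          have "smooth_on (model M) Q (\<lambda>y. \<rho> y * F y)"
            by (intro smooth_on_mult \<rho> F)
          moreover have "\<forall>x\<in>U. \<phi> x \<in> Q \<longrightarrow> f x = \<rho> (\<phi> x) * F (\<phi> x)"
            using chart_subset[OF U] by (auto simp: f_def)
          ultimately show ?thesis
            using True U Q by blast
        next
          \<comment> \<open>\<open>K\<close> lies over \<open>Q\<close>, so \<open>q\<close> is
            outside the closed set \<open>K\<close>, and \<open>W - K\<close> is an open
            neighbourhood of \<open>q\<close>. The function is zero there: off \<open>K\<close>,
            either the condition of the \<open>if\<close> fails or \<open>\<rho>\<close>
            vanishes.\<close>
          case False
          then have "q \<notin> K"
            using r(2) by (auto simp: K_def)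
          obtain W \<psi> where W: "(W, \<psi>) \<in> atlas M" "q \<in> W"
            using chart_at[OF q] .
          have "openin (top_of_set (model M)) (\<psi> ` (W - K))"
            using chart_open[OF W(1)] K by (intro chart_image_openin[OF W(1)] openin_diff) auto
          moreover have "\<forall>x\<in>W. \<psi> x \<in> \<psi> ` (W - K) \<longrightarrow> f x = 0"
          proof clarify
            fix x y assume xy: "x \<in> W" "\<psi> x = \<psi> y" "y \<in> W" "y \<notin> K"
            then have "x \<notin> K"
              using chart_inj[OF W(1)] by (auto dest: inj_onD)
            then show "f x = 0"
              using \<rho>(3)[of "\<phi> x"] xy(1) chart_subset[OF W(1)] openin_imp_subset[OF Q]
              by (auto simp: f_def K_def subset_iff not_le)
          qed
          ultimately show ?thesis
            using W \<open>q \<notin> K\<close> smooth_on_const[of "model M" _ 0]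
            by (intro exI[of _ W] exI[of _ \<psi>] exI[of _ "\<psi> ` (W - K)"] exI[of _ "\<lambda>_. 0"]) blast
        qed
      qed
      then have "f \<in> carrier (C\<^sup>\<infinity> M)"
        by (simp add: carrier_iff f_def)
      then show ?thesis
        by (simp add: f_def)
    qed
    then show "\<forall>F. smooth_on (model M) Q F \<longrightarrow>
        (\<lambda>x\<in>pts M. if x \<in> U \<and> \<phi> x \<in> Q then \<rho> (\<phi> x) * F (\<phi> x) else 0) \<in> carrier (C\<^sup>\<infinity> M)"
      by blast
  qed
qed

text \<open>
  By Hadamard's lemma, \<open>g - g p\<close> is near \<open>p\<close> a sum of products of two functions vanishing
  at \<open>p\<close>. Multiplication by the square of a bump function makes both factors global.
\<close>

lemma derivation_vanishes:
  assumes D: "D \<in> derivations (C\<^sup>\<infinity> M)" and g: "g \<in> carrier (C\<^sup>\<infinity> M)"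
    and U: "(U, \<phi>) \<in> atlas M" and p: "p \<in> U"
    and L: "((\<lambda>y. g (inv_into U \<phi> y)) has_derivative L) (at (\<phi> p) within \<phi> ` U)"
    and L0: "\<And>v. v \<in> model M \<Longrightarrow> L v = 0"
  shows "D g p = 0"
proof -
  define F where "F = (\<lambda>y. g (inv_into U \<phi> y))"
  have Fg: "F (\<phi> x) = g x" if "x \<in> U" for x
    using chart_inv[OF U that] by (simp add: F_def)
  have pM: "p \<in> pts M"
    using chart_subset[OF U] p by auto
  obtain r where r: "r > 0" "ball (\<phi> p) r \<inter> model M \<subseteq> \<phi> ` U"
    using chart_image_open[OF U] p unfolding openin_contains_ball by blast
  \<comment> \<open>A ball of the model space: convex, as \<open>Hadamard\<close> requires, and
    inside the chart image.\<close>
  define Q where "Q = model M \<inter> ball (\<phi> p) r"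
  have Q: "openin (top_of_set (model M)) Q" "convex Q" "Q \<subseteq> \<phi> ` U" "\<phi> p \<in> Q"
    using r p openin_imp_subset[OF chart_image_open[OF U]] subspace_imp_convex[OF subspace_model]
    by (auto simp: Q_def openin_open convex_Int)
  have F: "smooth_on (model M) Q F"
    unfolding F_def using smooth_on_subset[OF carrier_chart[OF g U] Q(3)] .
  obtain B where B: "finite B" "B \<subseteq> model M" "\<And>x. x \<in> model M \<Longrightarrow> (\<Sum>b\<in>B. (x \<bullet> b) *\<^sub>R b) = x"
    using orthonormal_expansion[OF subspace_model] by metis
  obtain G where G: "\<And>b. b \<in> B \<Longrightarrow> smooth_on (model M) Q (G b)"
    "\<And>x. x \<in> Q \<Longrightarrow> F x = F (\<phi> p) + (\<Sum>b\<in>B. ((x - \<phi> p) \<bullet> b) * G b x)"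
    "\<And>b. b \<in> B \<Longrightarrow> G b (\<phi> p) = dirderiv b F (\<phi> p)"
    using Hadamard[OF subspace_model Q(1,2,4) F B] by metis
  have G0: "G b (\<phi> p) = 0" if "b \<in> B" for b
  proof -
    have "dirderiv b F (\<phi> p) = L b"
      using dirderiv_eq[OF subspace_model chart_image_open[OF U] _ _ L] p B(2) that
      unfolding F_def by blast
    with G(3) L0 B(2) that show ?thesis by auto
  qed
  obtain T \<rho> where "openin (top_of_set (model M)) T" and \<rho>1: "\<phi> p \<in> T" and "T \<subseteq> Q"
    and \<rho>2: "\<forall>y\<in>T. \<rho> y = (1::real)"
    and ext': "\<forall>F. smooth_on (model M) Q F \<longrightarrow>
      (\<lambda>x\<in>pts M. if x \<in> U \<and> \<phi> x \<in> Q then \<rho> (\<phi> x) * F (\<phi> x) else 0) \<in> carrier (C\<^sup>\<infinity> M)"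
    by (rule bump_extension[OF U p Q(1,4,3)])
  note ext = ext'[rule_format]
  define e where
    "e F = (\<lambda>x\<in>pts M. if x \<in> U \<and> \<phi> x \<in> Q then \<rho> (\<phi> x) * F (\<phi> x) else 0)" for F :: "'e \<Rightarrow> real"
  define X where "X b = e (\<lambda>y. y \<bullet> b + - (\<phi> p \<bullet> b))" for b
  define Y where "Y b = e (G b)" for b
  define A where "A = (\<lambda>x\<in>pts M. e (\<lambda>_. 1) x * e (\<lambda>_. 1) x)"
  have X: "X b \<in> carrier (C\<^sup>\<infinity> M)" for b
    unfolding X_def e_def
    by (intro ext smooth_on_add smooth_on_const smooth_on_linear bounded_linear_inner_left)
  have Y: "Y b \<in> carrier (C\<^sup>\<infinity> M)" if "b \<in> B" for b
    unfolding Y_def e_def using ext G(1) that by blast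
  have A: "A \<in> carrier (C\<^sup>\<infinity> M)"
    unfolding A_def e_def by (intro mult_carrier ext smooth_on_const)
  define h where "h b = (\<lambda>x\<in>pts M. X b x * Y b x)" for b
  define S where "S = (\<lambda>x\<in>pts M. \<Sum>b\<in>B. h b x)"
  define A' where "A' = (\<lambda>x\<in>pts M. g p * A x)"
  have h: "h b \<in> carrier (C\<^sup>\<infinity> M)" if "b \<in> B" for b
    using mult_carrier[OF X Y[OF that]] by (simp add: h_def)
  have S: "S \<in> carrier (C\<^sup>\<infinity> M)"
    unfolding S_def using h by (rule sum_carrier)
  have A': "A' \<in> carrier (C\<^sup>\<infinity> M)"
    unfolding A'_def using A by (rule smult_carrier)
  have at_p: "A p = 1" "X b p = 0" "b \<in> B \<Longrightarrow> Y b p = 0" for b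
    using p pM Q(4) \<rho>1 \<rho>2 G0 by (auto simp: A_def X_def Y_def e_def)
  \<comment> \<open>The local expansion, once multiplied by \<open>A\<close>, is an identity on all
    of \<open>M\<close>: away from the coordinate ball both sides are 0.\<close>
  have "(\<lambda>x\<in>pts M. A x * g x) = (\<lambda>x\<in>pts M. A' x + S x)"
  proof (rule restrict_ext)
    fix x assume x: "x \<in> pts M"
    show "A x * g x = A' x + S x"
    proof (cases "x \<in> U \<and> \<phi> x \<in> Q")
      case True
      have "g x = g p + (\<Sum>b\<in>B. ((\<phi> x - \<phi> p) \<bullet> b) * G b (\<phi> x))"
        using G(2)[of "\<phi> x"] True Fg p by simp
      moreover have "(\<Sum>b\<in>B. h b x) = A x * (\<Sum>b\<in>B. ((\<phi> x - \<phi> p) \<bullet> b) * G b (\<phi> x))"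
        unfolding sum_distrib_left using True x
        by (intro sum.cong) (simp_all add: h_def A_def X_def Y_def e_def inner_diff_left)
      ultimately show ?thesis
        using x by (simp add: A'_def S_def ring_distribs)
    next
      case False
      with x show ?thesis
        by (auto simp: A'_def S_def h_def A_def X_def Y_def e_def)
    qed
  qed
  then have "D (\<lambda>x\<in>pts M. A x * g x) p = D (\<lambda>x\<in>pts M. A' x + S x) p"
    by simp
  also have "\<dots> = D A' p + D S p"
    using derivation_add[OF D A' S pM] .
  also have "D A' p = g p * D A p"
    unfolding A'_def using derivation_smult[OF D A pM] .
  also have "D S p = (\<Sum>b\<in>B. D (h b) p)"
    unfolding S_def by (rule derivation_sum[OF D pM B(1) h])
  also have "\<dots> = 0"
    unfolding h_def using X Y at_p by (simp add: derivation_mult[OF D] pM)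
  \<comment> \<open>On the left the Leibniz rule gives \<open>D g p + D A p * g p\<close>. Its
    second term is all that remains on the right, so \<open>D g p\<close> is 0 whatever
    \<open>D A p\<close> may be.\<close>
  finally show ?thesis
    unfolding derivation_mult[OF D A g pM] at_p(1) by simp
qed

end

section \<open>Products of manifolds\<close>

lemma pts_prod [simp]: "pts (prod_manifold M N) = pts M \<times> pts N"
  and mtop_prod: "mtop (prod_manifold M N) = prod_topology (mtop M) (mtop N)"
  and model_prod: "model (prod_manifold M N) = model M \<times> model N"
  by (simp_all add: prod_manifold_def)

lemma atlas_prodI:
  "(U, \<phi>) \<in> atlas M \<Longrightarrow> (W, \<psi>) \<in> atlas N \<Longrightarrow> (U \<times> W, map_prod \<phi> \<psi>) \<in> atlas (prod_manifold M N)"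
  by (auto simp: prod_manifold_def)

lemma atlas_prodE:
  assumes "(S, \<theta>) \<in> atlas (prod_manifold M N)"
  obtains U \<phi> W \<psi> where "(U, \<phi>) \<in> atlas M" "(W, \<psi>) \<in> atlas N" "S = U \<times> W" "\<theta> = map_prod \<phi> \<psi>"
  using assms by (auto simp: prod_manifold_def)

lemma map_prod_Times: "map_prod f g ` (A \<times> B) = f ` A \<times> g ` B"
  by (rule map_prod_surj_on) simp_all

lemma subspace_Times: "subspace E \<Longrightarrow> subspace F \<Longrightarrow> subspace (E \<times> F)"
  by (auto simp: subspace_def zero_prod_def)

lemma second_countable_prod_topology:
  assumes "second_countable X" "second_countable Y"
  shows "second_countable (prod_topology X Y)"
proof -
  obtain A where A: "countable A" "\<forall>V\<in>A. openin X V"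
    "\<forall>U x. openin X U \<and> x \<in> U \<longrightarrow> (\<exists>V\<in>A. x \<in> V \<and> V \<subseteq> U)"
    using assms(1) unfolding second_countable_def by blast
  obtain B where B: "countable B" "\<forall>V\<in>B. openin Y V"
    "\<forall>U x. openin Y U \<and> x \<in> U \<longrightarrow> (\<exists>V\<in>B. x \<in> V \<and> V \<subseteq> U)"
    using assms(2) unfolding second_countable_def by blast
  define C where "C = (\<lambda>(S, T). S \<times> T) ` (A \<times> B)"
  have "countable C"
    unfolding C_def using A B by auto
  moreover have "\<forall>V\<in>C. openin (prod_topology X Y) V"
    using A B by (auto simp: C_def openin_prod_Times_iff)
  moreover have "\<exists>V\<in>C. z \<in> V \<and> V \<subseteq> U" if U: "openin (prod_topology X Y) U" "z \<in> U" for U z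
  proof -
    obtain x y where z: "z = (x, y)" by (cases z)
    have "(x, y) \<in> U"
      using U(2) z by simp
    then obtain S T where ST: "openin X S" "openin Y T" "x \<in> S" "y \<in> T" "S \<times> T \<subseteq> U"
      using U(1)[unfolded openin_prod_topology_alt, rule_format] by metis
    obtain S' where S': "S' \<in> A" "x \<in> S'" "S' \<subseteq> S"
      using A(3)[rule_format, of S x] ST by auto
    obtain T' where T': "T' \<in> B" "y \<in> T'" "T' \<subseteq> T"
      using B(3)[rule_format, of T y] ST by auto
    have "S' \<times> T' \<in> C"
      using S'(1) T'(1) by (auto simp: C_def)
    then show ?thesis
      using z S' T' ST(5) by (intro bexI[of _ "S' \<times> T'"]) auto
  qed
  ultimately show ?thesis
    unfolding second_countable_def by blast
qed

lemma homeomorphic_map_prod: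
  assumes "homeomorphic_map X X' f" "homeomorphic_map Y Y' g"
  shows "homeomorphic_map (prod_topology X Y) (prod_topology X' Y') (map_prod f g)"
proof -
  obtain f' g' where "homeomorphic_maps X X' f f'" "homeomorphic_maps Y Y' g g'"
    using assms unfolding homeomorphic_map_maps by blast
  then have "homeomorphic_maps (prod_topology X Y) (prod_topology X' Y')
      (\<lambda>(x, y). (f x, g y)) (\<lambda>(x, y). (f' x, g' y))"
    by (simp add: homeomorphic_maps_prod)
  then show ?thesis
    unfolding homeomorphic_map_maps map_prod_def by blast
qed

section \<open>Calculus on products of model spaces\<close>

lemma smooth_on_fst:
  fixes E :: "'e::euclidean_space set" and F :: "'f::euclidean_space set"
  assumes "subspace E" "S \<subseteq> E" "smooth_on E S f"
  shows "smooth_on (E \<times> F) (S \<times> T) (\<lambda>y. f (fst y))"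
  using assms by (intro smooth_on_compose[OF _ _ assms(3)] smooth_on_linear bounded_linear_fst) auto

lemma smooth_on_snd:
  fixes E :: "'e::euclidean_space set" and F :: "'f::euclidean_space set"
  assumes "subspace F" "T \<subseteq> F" "smooth_on F T f"
  shows "smooth_on (E \<times> F) (S \<times> T) (\<lambda>y. f (snd y))"
  using assms by (intro smooth_on_compose[OF _ _ assms(3)] smooth_on_linear bounded_linear_snd) auto

lemma inv_into_map_prod:
  assumes "inj_on \<phi> U" "inj_on \<psi> W" "y \<in> \<phi> ` U \<times> \<psi> ` W"
  shows "inv_into (U \<times> W) (map_prod \<phi> \<psi>) y = (inv_into U \<phi> (fst y), inv_into W \<psi> (snd y))"
  using assms by (intro inv_into_f_eq map_prod_inj_on) (auto simp: mem_Times_iff inv_into_into f_inv_into_f)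

text \<open>The slice is kept as a function of both variables, so that it can be combined with
  \<open>F\<close> at the same point within the same product set.\<close>

lemma has_derivative_slice_fst:
  assumes "(F has_derivative L) (at (a, b) within S \<times> T)" "b \<in> T"
  shows "((\<lambda>y. F (fst y, b)) has_derivative (\<lambda>w. L (fst w, 0))) (at (a, b) within S \<times> T)"
proof -
  have "((\<lambda>y. (fst y, b)) has_derivative (\<lambda>w. (fst w, 0))) (at (a, b) within S \<times> T)"
    by (auto intro!: derivative_eq_intros)
  moreover have "(F has_derivative L) (at (fst (a, b), b) within (\<lambda>y. (fst y, b)) ` (S \<times> T))"
    using assms by (auto intro: has_derivative_subset)
  ultimately have "(F \<circ> (\<lambda>y. (fst y, b)) has_derivative L \<circ> (\<lambda>w. (fst w, 0))) (at (a, b) within S \<times> T)"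
    by (rule diff_chain_within)
  then show ?thesis
    by (simp add: o_def)
qed

lemma has_derivative_slice_snd:
  assumes "(F has_derivative L) (at (a, b) within S \<times> T)" "a \<in> S"
  shows "((\<lambda>y. F (a, snd y)) has_derivative (\<lambda>w. L (0, snd w))) (at (a, b) within S \<times> T)"
proof -
  have "((\<lambda>y. (a, snd y)) has_derivative (\<lambda>w. (0, snd w))) (at (a, b) within S \<times> T)"
    by (auto intro!: derivative_eq_intros)
  moreover have "(F has_derivative L) (at (a, snd (a, b)) within (\<lambda>y. (a, snd y)) ` (S \<times> T))"
    using assms by (auto intro: has_derivative_subset)
  ultimately have "(F \<circ> (\<lambda>y. (a, snd y)) has_derivative L \<circ> (\<lambda>w. (0, snd w))) (at (a, b) within S \<times> T)"
    by (rule diff_chain_within)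
  then show ?thesis
    by (simp add: o_def)
qed

section \<open>The product manifold, with pullbacks to and from its factors\<close>

locale prod_mfd = M: smooth_mfd M + N: smooth_mfd N
  for M :: "('a, 'e::euclidean_space) manifold" and N :: "('b, 'f::euclidean_space) manifold"
begin

abbreviation V :: "('a \<times> 'b, 'e \<times> 'f) manifold" where "V \<equiv> prod_manifold M N"

lemma inv_chart_prod:
  assumes "(U, \<phi>) \<in> atlas M" "(W, \<psi>) \<in> atlas N" "y \<in> \<phi> ` U \<times> \<psi> ` W"
  shows "inv_into (U \<times> W) (map_prod \<phi> \<psi>) y = (inv_into U \<phi> (fst y), inv_into W \<psi> (snd y))"
  by (rule inv_into_map_prod[OF M.chart_inj[OF assms(1)] N.chart_inj[OF assms(2)] assms(3)])

lemma smooth_manifold_prod: "smooth_manifold V"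
  unfolding smooth_manifold_def
proof (intro conjI)
  show "Hausdorff_space (mtop V)"
    by (simp add: mtop_prod Hausdorff_space_prod_topology M.Hausdorff N.Hausdorff)
  show "second_countable (mtop V)"
    using M.smooth_manifold N.smooth_manifold unfolding smooth_manifold_def mtop_prod
    by (intro second_countable_prod_topology) auto
  show "subspace (model V)"
    by (simp add: model_prod subspace_Times M.subspace_model N.subspace_model)
  show "(\<Union>(U, \<phi>)\<in>atlas V. U) = pts V"
  proof
    show "(\<Union>(U, \<phi>)\<in>atlas V. U) \<subseteq> pts V"
      using M.chart_subset N.chart_subset by (fastforce elim!: atlas_prodE)
    show "pts V \<subseteq> (\<Union>(U, \<phi>)\<in>atlas V. U)"
    proof
      fix z assume z: "z \<in> pts V"
      then have z': "fst z \<in> pts M" "snd z \<in> pts N" by auto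
      obtain U \<phi> where U: "(U, \<phi>) \<in> atlas M" "fst z \<in> U"
        using M.chart_at[OF z'(1)] .
      obtain W \<psi> where W: "(W, \<psi>) \<in> atlas N" "snd z \<in> W"
        using N.chart_at[OF z'(2)] .
      show "z \<in> (\<Union>(U, \<phi>)\<in>atlas V. U)"
        using atlas_prodI[OF U(1) W(1)] U(2) W(2)
        by (intro UN_I[of "(U \<times> W, map_prod \<phi> \<psi>)"]) (auto simp: mem_Times_iff)
    qed
  qed
  show "\<forall>(U, \<phi>)\<in>atlas V. openin (mtop V) U \<and> openin (top_of_set (model V)) (\<phi> ` U) \<and>
      homeomorphic_map (subtopology (mtop V) U) (top_of_set (\<phi> ` U)) \<phi>"
  proof clarify
    fix S \<theta> assume "(S, \<theta>) \<in> atlas V"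
    then obtain U \<phi> W \<psi> where c: "(U, \<phi>) \<in> atlas M" "(W, \<psi>) \<in> atlas N" and
      eq: "S = U \<times> W" "\<theta> = map_prod \<phi> \<psi>"
      by (rule atlas_prodE)
    show "openin (mtop V) S \<and> openin (top_of_set (model V)) (\<theta> ` S) \<and>
        homeomorphic_map (subtopology (mtop V) S) (top_of_set (\<theta> ` S)) \<theta>"
      unfolding eq map_prod_Times mtop_prod model_prod
      using M.chart_open[OF c(1)] N.chart_open[OF c(2)]
        openin_Times[OF M.chart_image_open[OF c(1)] N.chart_image_open[OF c(2)]]
        homeomorphic_map_prod[OF M.chart_homeo[OF c(1)] N.chart_homeo[OF c(2)]]
      by (simp add: openin_prod_Times_iff subtopology_Times)
  qed
  show "\<forall>(U, \<phi>)\<in>atlas V. \<forall>(W, \<psi>)\<in>atlas V. smooth_on (model V) (\<phi> ` (U \<inter> W)) (\<psi> \<circ> inv_into U \<phi>)"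
  proof clarify
    fix S \<theta> S' \<theta>' assume S: "(S, \<theta>) \<in> atlas V" "(S', \<theta>') \<in> atlas V"
    obtain U \<phi> W \<psi> where c: "(U, \<phi>) \<in> atlas M" "(W, \<psi>) \<in> atlas N" and
      eq: "S = U \<times> W" "\<theta> = map_prod \<phi> \<psi>"
      using S(1) by (rule atlas_prodE)
    obtain U' \<phi>' W' \<psi>' where c': "(U', \<phi>') \<in> atlas M" "(W', \<psi>') \<in> atlas N" and
      eq': "S' = U' \<times> W'" "\<theta>' = map_prod \<phi>' \<psi>'"
      using S(2) by (rule atlas_prodE)
    have sub: "\<phi> ` (U \<inter> U') \<subseteq> model M" "\<psi> ` (W \<inter> W') \<subseteq> model N"
      using openin_imp_subset[OF M.chart_image_open[OF c(1)]]
        openin_imp_subset[OF N.chart_image_open[OF c(2)]] by auto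
    have 1: "smooth_on (model V) (\<phi> ` (U \<inter> U') \<times> \<psi> ` (W \<inter> W'))
        (\<lambda>y. (\<phi>' (inv_into U \<phi> (fst y)), \<psi>' (inv_into W \<psi> (snd y))))"
      unfolding model_prod
      by (intro smooth_on_Pair smooth_on_fst[OF M.subspace_model sub(1)] smooth_on_snd[OF N.subspace_model sub(2)]
          M.transition_smooth[OF c(1) c'(1)] N.transition_smooth[OF c(2) c'(2)])
    have 2: "\<theta> ` (S \<inter> S') = \<phi> ` (U \<inter> U') \<times> \<psi> ` (W \<inter> W')"
      unfolding eq eq' Times_Int_Times map_prod_Times ..
    have 3: "(\<theta>' \<circ> inv_into S \<theta>) y = (\<phi>' (inv_into U \<phi> (fst y)), \<psi>' (inv_into W \<psi> (snd y)))"
      if "y \<in> \<phi> ` (U \<inter> U') \<times> \<psi> ` (W \<inter> W')" for y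
    proof -
      have "y \<in> \<phi> ` U \<times> \<psi> ` W"
        using that by auto
      then show ?thesis
        by (simp add: eq eq' inv_chart_prod[OF c])
    qed
    show "smooth_on (model V) (\<theta> ` (S \<inter> S')) (\<theta>' \<circ> inv_into S \<theta>)"
      unfolding 2 by (rule iffD2[OF smooth_on_cong[OF 3] 1])
  qed
qed

sublocale V: smooth_mfd V
  by standard (rule smooth_manifold_prod)

lemma carrier_chart_prod:
  assumes f: "f \<in> carrier (C\<^sup>\<infinity> V)" and U: "(U, \<phi>) \<in> atlas M" and W: "(W, \<psi>) \<in> atlas N"
  shows "smooth_on (model M \<times> model N) (\<phi> ` U \<times> \<psi> ` W) (\<lambda>y. f (inv_into U \<phi> (fst y), inv_into W \<psi> (snd y)))"
  using V.carrier_chart[OF f atlas_prodI[OF U W]]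
  unfolding map_prod_Times model_prod
  by (rule iffD1[OF smooth_on_cong, rotated]) (simp only: inv_chart_prod[OF U W])

lemma restrict_prod_carrierI:
  assumes "\<And>U \<phi> W \<psi>. (U, \<phi>) \<in> atlas M \<Longrightarrow> (W, \<psi>) \<in> atlas N \<Longrightarrow>
    smooth_on (model M \<times> model N) (\<phi> ` U \<times> \<psi> ` W) (\<lambda>y. f (inv_into U \<phi> (fst y), inv_into W \<psi> (snd y)))"
  shows "(\<lambda>x\<in>pts V. f x) \<in> carrier (C\<^sup>\<infinity> V)"
proof (rule V.restrict_carrierI)
  fix S \<theta> assume "(S, \<theta>) \<in> atlas V"
  then obtain U \<phi> W \<psi> where c: "(U, \<phi>) \<in> atlas M" "(W, \<psi>) \<in> atlas N" and
    eq: "S = U \<times> W" "\<theta> = map_prod \<phi> \<psi>"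
    by (rule atlas_prodE)
  show "smooth_on (model V) (\<theta> ` S) (\<lambda>y. f (inv_into S \<theta> y))"
    unfolding eq map_prod_Times model_prod using assms[OF c]
    by (rule iffD1[OF smooth_on_cong, rotated]) (simp only: inv_chart_prod[OF c])
qed

lemma pullback_fst_carrier:
  assumes "g \<in> carrier (C\<^sup>\<infinity> M)"
  shows "pullback V fst g \<in> carrier (C\<^sup>\<infinity> V)"
  unfolding pullback_def
proof (rule restrict_prod_carrierI)
  fix U \<phi> W \<psi> assume "(U, \<phi>) \<in> atlas M" "(W, \<psi>) \<in> atlas N"
  then show "smooth_on (model M \<times> model N) (\<phi> ` U \<times> \<psi> ` W) (\<lambda>y. g (fst (inv_into U \<phi> (fst y), inv_into W \<psi> (snd y))))"
    using smooth_on_fst[OF M.subspace_model openin_imp_subset[OF M.chart_image_open]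
        M.carrier_chart[OF assms]] by simp
qed

lemma pullback_snd_carrier:
  assumes "h \<in> carrier (C\<^sup>\<infinity> N)"
  shows "pullback V snd h \<in> carrier (C\<^sup>\<infinity> V)"
  unfolding pullback_def
proof (rule restrict_prod_carrierI)
  fix U \<phi> W \<psi> assume "(U, \<phi>) \<in> atlas M" "(W, \<psi>) \<in> atlas N"
  then show "smooth_on (model M \<times> model N) (\<phi> ` U \<times> \<psi> ` W) (\<lambda>y. h (snd (inv_into U \<phi> (fst y), inv_into W \<psi> (snd y))))"
    using smooth_on_snd[OF N.subspace_model openin_imp_subset[OF N.chart_image_open]
        N.carrier_chart[OF assms]] by simp
qed

lemma pullback_i_carrier:
  assumes f: "f \<in> carrier (C\<^sup>\<infinity> V)" and n: "n \<in> pts N"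
  shows "pullback M (emb_i n) f \<in> carrier (C\<^sup>\<infinity> M)"
  unfolding pullback_def emb_i_def
proof (rule M.restrict_carrierI)
  fix U \<phi> assume U: "(U, \<phi>) \<in> atlas M"
  obtain W \<psi> where W: "(W, \<psi>) \<in> atlas N" "n \<in> W"
    using N.chart_at[OF n] .
  \<comment> \<open>The projections stay unreduced to exhibit a composite: the expression of
    \<open>f\<close> in the product chart after \<open>x \<mapsto> (x, \<psi> n)\<close>.\<close>
  have "smooth_on (model M) (\<phi> ` U) (\<lambda>x. f (inv_into U \<phi> (fst (x, \<psi> n)), inv_into W \<psi> (snd (x, \<psi> n))))"
    using W(2) openin_imp_subset[OF M.chart_image_open[OF U]] openin_imp_subset[OF N.chart_image_open[OF W(1)]]
    by (intro smooth_on_compose[OF _ _ carrier_chart_prod[OF f U W(1)]] smooth_on_Pair smooth_on_const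
        smooth_on_linear bounded_linear_ident subspace_Times M.subspace_model N.subspace_model) auto
  then show "smooth_on (model M) (\<phi> ` U) (\<lambda>x. f (inv_into U \<phi> x, n))"
    by (simp add: N.chart_inv[OF W])
qed

lemma pullback_j_carrier:
  assumes f: "f \<in> carrier (C\<^sup>\<infinity> V)" and m: "m \<in> pts M"
  shows "pullback N (emb_j m) f \<in> carrier (C\<^sup>\<infinity> N)"
  unfolding pullback_def emb_j_def
proof (rule N.restrict_carrierI)
  fix W \<psi> assume W: "(W, \<psi>) \<in> atlas N"
  obtain U \<phi> where U: "(U, \<phi>) \<in> atlas M" "m \<in> U"
    using M.chart_at[OF m] .
  have "smooth_on (model N) (\<psi> ` W) (\<lambda>x. f (inv_into U \<phi> (fst (\<phi> m, x)), inv_into W \<psi> (snd (\<phi> m, x))))"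
    using U(2) openin_imp_subset[OF M.chart_image_open[OF U(1)]] openin_imp_subset[OF N.chart_image_open[OF W]]
    by (intro smooth_on_compose[OF _ _ carrier_chart_prod[OF f U(1) W]] smooth_on_Pair smooth_on_const
        smooth_on_linear bounded_linear_ident subspace_Times M.subspace_model N.subspace_model) auto
  then show "smooth_on (model N) (\<psi> ` W) (\<lambda>x. f (m, inv_into W \<psi> x))"
    by (simp add: M.chart_inv[OF U])
qed

section \<open>Splitting a vector field on the product, and smoothness of its horizontal
  part\<close>

lemma derivation_split:
  assumes v: "v \<in> derivations (C\<^sup>\<infinity> V)" and f: "f \<in> carrier (C\<^sup>\<infinity> V)" and mn: "(m, n) \<in> pts V"
  shows "v f (m, n) = v (pullback V fst (pullback M (emb_i n) f)) (m, n) +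
    v (pullback V snd (pullback N (emb_j m) f)) (m, n)"
proof -
  have m: "m \<in> pts M" and n: "n \<in> pts N"
    using mn by auto
  obtain U \<phi> where U: "(U, \<phi>) \<in> atlas M" "m \<in> U"
    using M.chart_at[OF m] .
  obtain W \<psi> where W: "(W, \<psi>) \<in> atlas N" "n \<in> W"
    using N.chart_at[OF n] .
  define F where "F = (\<lambda>y. f (inv_into U \<phi> (fst y), inv_into W \<psi> (snd y)))"
  let ?S = "\<phi> ` U \<times> \<psi> ` W"
  obtain L where L: "(F has_derivative L) (at (\<phi> m, \<psi> n) within ?S)"
    using smooth_on_imp_differentiable[OF carrier_chart_prod[OF f U(1) W(1)], of "(\<phi> m, \<psi> n)"] U(2) W(2)
    unfolding F_def differentiable_def by auto
  define P where "P = pullback V fst (pullback M (emb_i n) f)"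
  define R where "R = pullback V snd (pullback N (emb_j m) f)"
  define P' where "P' = (\<lambda>x\<in>pts V. -1 * P x)"
  define R' where "R' = (\<lambda>x\<in>pts V. -1 * R x)"
  define h' where "h' = (\<lambda>x\<in>pts V. P' x + R' x)"
  \<comment> \<open>This is \<open>f - P - R\<close>, assembled from the operations for which
    derivations have a rule. Its value at \<open>(m, n)\<close> is \<open>- f (m, n)\<close>; what
    has to vanish there is its differential.\<close>
  define h where "h = (\<lambda>x\<in>pts V. f x + h' x)"
  have P: "P \<in> carrier (C\<^sup>\<infinity> V)"
    unfolding P_def by (intro pullback_fst_carrier pullback_i_carrier f n)
  have R: "R \<in> carrier (C\<^sup>\<infinity> V)"
    unfolding R_def by (intro pullback_snd_carrier pullback_j_carrier f m)
  have P': "P' \<in> carrier (C\<^sup>\<infinity> V)"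
    unfolding P'_def using P by (rule V.smult_carrier)
  have R': "R' \<in> carrier (C\<^sup>\<infinity> V)"
    unfolding R'_def using R by (rule V.smult_carrier)
  have h': "h' \<in> carrier (C\<^sup>\<infinity> V)"
    unfolding h'_def using P' R' by (rule V.add_carrier)
  have h: "h \<in> carrier (C\<^sup>\<infinity> V)"
    unfolding h_def using f h' by (rule V.add_carrier)
  have "v h (m, n) = v f (m, n) + v h' (m, n)"
    unfolding h_def by (rule V.derivation_add[OF v f h' mn])
  also have "v h' (m, n) = v P' (m, n) + v R' (m, n)"
    unfolding h'_def by (rule V.derivation_add[OF v P' R' mn])
  also have "v P' (m, n) = -1 * v P (m, n)"
    unfolding P'_def by (rule V.derivation_smult[OF v P mn])
  also have "v R' (m, n) = -1 * v R (m, n)"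
    unfolding R'_def by (rule V.derivation_smult[OF v R mn])
  finally have vh: "v h (m, n) = v f (m, n) - v P (m, n) - v R (m, n)"
    by simp
  have "v h (m, n) = 0"
  proof (rule V.derivation_vanishes[OF v h atlas_prodI[OF U(1) W(1)]])
    show "(m, n) \<in> U \<times> W"
      using U W by simp
    \<comment> \<open>In coordinates the differential of \<open>h\<close> is \<open>L w\<close>
      minus its parts along the two factors, which is 0 by linearity.\<close>
    have "((\<lambda>y. F y + (-1 * F (fst y, \<psi> n) + -1 * F (\<phi> m, snd y))) has_derivative
        (\<lambda>w. L w + (-1 * L (fst w, 0) + -1 * L (0, snd w)))) (at (\<phi> m, \<psi> n) within ?S)"
      using U(2) W(2)
      by (intro has_derivative_add has_derivative_mult_right L has_derivative_slice_fst[OF L]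
          has_derivative_slice_snd[OF L]) auto
    moreover have "(\<lambda>w. L w + (-1 * L (fst w, 0) + -1 * L (0, snd w))) = (\<lambda>w. 0)"
    proof
      fix w :: "'e \<times> 'f"
      have "L ((fst w, 0) + (0, snd w)) = L (fst w, 0) + L (0, snd w)"
        by (rule linear_add[OF has_derivative_linear[OF L]])
      then show "L w + (-1 * L (fst w, 0) + -1 * L (0, snd w)) = 0"
        by simp
    qed
    ultimately have "((\<lambda>y. F y + (-1 * F (fst y, \<psi> n) + -1 * F (\<phi> m, snd y))) has_derivative (\<lambda>w. 0))
        (at (\<phi> m, \<psi> n) within ?S)"
      by (simp only:)
    then show "((\<lambda>y. h (inv_into (U \<times> W) (map_prod \<phi> \<psi>) y)) has_derivative (\<lambda>w. 0))
        (at (map_prod \<phi> \<psi> (m, n)) within map_prod \<phi> \<psi> ` (U \<times> W))"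
      unfolding map_prod_Times map_prod_simp
    proof (rule has_derivative_transform[rotated 2])
      show "(\<phi> m, \<psi> n) \<in> ?S"
        using U W by simp
      fix y assume y: "y \<in> ?S"
      have "inv_into U \<phi> (fst y) \<in> pts M" "inv_into W \<psi> (snd y) \<in> pts N"
        using y M.chart_subset[OF U(1)] N.chart_subset[OF W(1)]
        by (auto dest!: inv_into_into)
      then show "h (inv_into (U \<times> W) (map_prod \<phi> \<psi>) y) =
          F y + (-1 * F (fst y, \<psi> n) + -1 * F (\<phi> m, snd y))"
        unfolding inv_chart_prod[OF U(1) W(1) y]
        using m n M.chart_inv[OF U] N.chart_inv[OF W]
        by (simp add: h_def h'_def P'_def R'_def P_def R_def pullback_def emb_i_def emb_j_def F_def)
    qed
  qed simp
  then show ?thesis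
    using vh by (simp add: P_def R_def)
qed

text \<open>
  In coordinates, the value at \<open>(m, n)\<close> is \<open>\<Sum>\<^sub>b \<partial>\<^sub>b f (m, n) * v (\<pi>\<^sub>M\<^sup>* c\<^sub>b) (m, n)\<close> where \<open>c\<^sub>b\<close> are
  smooth functions on \<open>M\<close> that agree with the coordinates near a given point.
\<close>

lemma horizontal_part_carrier:
  assumes v: "v \<in> derivations (C\<^sup>\<infinity> V)" and f: "f \<in> carrier (C\<^sup>\<infinity> V)"
  shows "(\<lambda>z\<in>pts V. v (pullback V fst (pullback M (emb_i (snd z)) f)) z) \<in> carrier (C\<^sup>\<infinity> V)"
    (is "?H \<in> _")
proof -
  obtain B where B: "finite B" "B \<subseteq> model M" "\<And>x. x \<in> model M \<Longrightarrow> (\<Sum>b\<in>B. (x \<bullet> b) *\<^sub>R b) = x"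
    using orthonormal_expansion[OF M.subspace_model] by metis
  have "smooth_fun V ?H"
  proof (rule V.smooth_fun_localI)
    fix p assume "p \<in> pts V"
    then have p: "fst p \<in> pts M" "snd p \<in> pts N" by auto
    obtain U \<phi> where U: "(U, \<phi>) \<in> atlas M" "fst p \<in> U"
      using M.chart_at[OF p(1)] .
    obtain W \<psi> where W: "(W, \<psi>) \<in> atlas N" "snd p \<in> W"
      using N.chart_at[OF p(2)] .
    have chart: "(U \<times> W, map_prod \<phi> \<psi>) \<in> atlas V"
      using atlas_prodI[OF U(1) W(1)] .
    let ?S = "\<phi> ` U \<times> \<psi> ` W"
    have S: "openin (top_of_set (model V)) ?S" "subspace (model V)"
      using V.chart_image_open[OF chart] V.subspace_model by (simp_all add: map_prod_Times)
    define F where "F = (\<lambda>y. f (inv_into U \<phi> (fst y), inv_into W \<psi> (snd y)))"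
    have F: "smooth_on (model V) ?S F"
      unfolding F_def model_prod by (rule carrier_chart_prod[OF f U(1) W(1)])
    obtain T \<rho> where T: "openin (top_of_set (model M)) T" "\<phi> (fst p) \<in> T" "T \<subseteq> \<phi> ` U"
      and \<rho>: "\<forall>y\<in>T. \<rho> y = (1::real)"
      and ext: "\<forall>F. smooth_on (model M) (\<phi> ` U) F \<longrightarrow>
        (\<lambda>x\<in>pts M. if x \<in> U \<and> \<phi> x \<in> \<phi> ` U then \<rho> (\<phi> x) * F (\<phi> x) else 0) \<in> carrier (C\<^sup>\<infinity> M)"
      by (rule M.bump_extension[OF U M.chart_image_open[OF U(1)] imageI[OF U(2)] order_refl])
    define c where
      "c b = (\<lambda>x\<in>pts M. if x \<in> U \<and> \<phi> x \<in> \<phi> ` U then \<rho> (\<phi> x) * (\<phi> x \<bullet> b) else 0)" for b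
    define C where "C b = pullback V fst (c b)" for b
    have C: "C b \<in> carrier (C\<^sup>\<infinity> V)" for b
      unfolding C_def c_def
      by (intro pullback_fst_carrier ext[rule_format] smooth_on_linear bounded_linear_inner_left)
    define K where "K b = dirderiv (b, 0) F" for b
    have K: "smooth_on (model V) ?S (K b)" if "b \<in> B" for b
      unfolding K_def using B(2) that subspace_0[OF N.subspace_model]
      by (intro smooth_on_dirderiv[OF S(2,1) F]) (auto simp: model_prod)
    \<comment> \<open>The functions \<open>C b\<close> are fixed once \<open>p\<close> is, so
      \<open>v (C b)\<close> is a single element of the algebra and \<open>G\<close> is visibly
      smooth. The fact \<open>eq\<close> then identifies it with \<open>?H\<close> near
      \<open>p\<close>.\<close>
    define G where "G y = (\<Sum>b\<in>B. K b y * v (C b) (inv_into U \<phi> (fst y), inv_into W \<psi> (snd y)))" for y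
    have G: "smooth_on (model V) ?S G"
      unfolding G_def
      by (intro smooth_on_sum smooth_on_mult K
          carrier_chart_prod[OF V.derivation_carrier[OF v C] U(1) W(1), folded model_prod])
    have eq: "?H z = G (map_prod \<phi> \<psi> z)" if z: "z \<in> U \<times> W" "map_prod \<phi> \<psi> z \<in> T \<times> \<psi> ` W" for z
    proof -
      obtain m n where z_eq: "z = (m, n)" by (cases z)
      have mn: "m \<in> U" "n \<in> W" "\<phi> m \<in> T"
        using z by (auto simp: z_eq)
      have m: "m \<in> pts M" and n: "n \<in> pts N"
        using mn M.chart_subset[OF U(1)] N.chart_subset[OF W(1)] by auto
      then have mnV: "(m, n) \<in> pts V" by simp
      let ?y = "(\<phi> m, \<psi> n)"
      have y: "?y \<in> ?S" "?y \<in> T \<times> \<psi> ` W"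
        using mn by auto
      obtain L where L: "(F has_derivative L) (at ?y within ?S)"
        using smooth_on_imp_differentiable[OF F y(1)] unfolding differentiable_def by auto
      have lin: "linear L"
        by (rule has_derivative_linear[OF L])
      have KL: "K b ?y = L (b, 0)" if "b \<in> B" for b
        unfolding K_def using B(2) that subspace_0[OF N.subspace_model]
        by (intro dirderiv_eq[OF S(2,1) y(1) _ L]) (auto simp: model_prod)
      define P where "P = pullback V fst (pullback M (emb_i n) f)"
      \<comment> \<open>The coefficients are frozen at \<open>?y\<close>: as constants they can be
        taken out of \<open>v\<close> by real linearity. The function \<open>h\<close> is then
        \<open>P\<close> minus the combination of coordinates with the same differential at
        \<open>(m, n)\<close>.\<close>
      define KC where "KC b = (\<lambda>x\<in>pts V. - K b ?y * C b x)" for b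
      define Q where "Q = (\<lambda>x\<in>pts V. \<Sum>b\<in>B. KC b x)"
      define h where "h = (\<lambda>x\<in>pts V. P x + Q x)"
      have P: "P \<in> carrier (C\<^sup>\<infinity> V)"
        unfolding P_def by (intro pullback_fst_carrier pullback_i_carrier f n)
      have KC: "KC b \<in> carrier (C\<^sup>\<infinity> V)" for b
        unfolding KC_def using C by (rule V.smult_carrier)
      have Q: "Q \<in> carrier (C\<^sup>\<infinity> V)"
        unfolding Q_def using KC by (rule V.sum_carrier)
      have h: "h \<in> carrier (C\<^sup>\<infinity> V)"
        unfolding h_def using P Q by (rule V.add_carrier)
      have "v h (m, n) = v P (m, n) + v Q (m, n)"
        unfolding h_def by (rule V.derivation_add[OF v P Q mnV])
      also have "v Q (m, n) = (\<Sum>b\<in>B. v (KC b) (m, n))"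
        unfolding Q_def by (rule V.derivation_sum[OF v mnV B(1) KC])
      also have "\<dots> = (\<Sum>b\<in>B. - K b ?y * v (C b) (m, n))"
        unfolding KC_def V.derivation_smult[OF v C mnV] ..
      finally have vh: "v h (m, n) = v P (m, n) + (\<Sum>b\<in>B. - K b ?y * v (C b) (m, n))" .
      have "v h (m, n) = 0"
      proof (rule V.derivation_vanishes[OF v h chart])
        show "(m, n) \<in> U \<times> W"
          using mn by simp
        have "((\<lambda>y. F (fst y, \<psi> n) + (\<Sum>b\<in>B. - K b ?y * (fst y \<bullet> b))) has_derivative
            (\<lambda>w. L (fst w, 0) + (\<Sum>b\<in>B. - K b ?y * (fst w \<bullet> b)))) (at ?y within ?S)"
          using mn
          by (intro has_derivative_add has_derivative_sum has_derivative_mult_right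
              has_derivative_slice_fst[OF L] has_derivative_inner_left has_derivative_fst
              has_derivative_ident) auto
        \<comment> \<open>The functions \<open>C b\<close> are exact coordinates only over
          \<open>T\<close>, where \<open>\<rho>\<close> is 1. Both sets are neighbourhoods of
          \<open>?y\<close> in the model space, so the derivative may be computed within the smaller
          one.\<close>
        moreover have at: "at ?y within T \<times> \<psi> ` W = at ?y within ?S"
          using T(3) y(2) openin_imp_subset[OF S(1)] openin_Times[OF T(1) N.chart_image_open[OF W(1)]]
          by (intro at_within_openin_subset[of "model V"]) (auto simp: model_prod)
        ultimately have "((\<lambda>y. F (fst y, \<psi> n) + (\<Sum>b\<in>B. - K b ?y * (fst y \<bullet> b))) has_derivative
            (\<lambda>w. L (fst w, 0) + (\<Sum>b\<in>B. - K b ?y * (fst w \<bullet> b)))) (at ?y within T \<times> \<psi> ` W)"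
          by (simp only:)
        then show "((\<lambda>y. h (inv_into (U \<times> W) (map_prod \<phi> \<psi>) y)) has_derivative
            (\<lambda>w. L (fst w, 0) + (\<Sum>b\<in>B. - K b ?y * (fst w \<bullet> b))))
            (at (map_prod \<phi> \<psi> (m, n)) within map_prod \<phi> \<psi> ` (U \<times> W))"
          unfolding map_prod_Times map_prod_simp at[symmetric]
        proof (rule has_derivative_transform[OF y(2), rotated])
          fix y assume y': "y \<in> T \<times> \<psi> ` W"
          then have y: "y \<in> ?S"
            using T(3) by auto
          have y1: "fst y \<in> \<phi> ` U" "\<rho> (fst y) = 1"
            using y y' \<rho> by auto
          have inv: "inv_into U \<phi> (fst y) \<in> U" "\<phi> (inv_into U \<phi> (fst y)) = fst y"
            using y1(1) by (auto intro: inv_into_into f_inv_into_f)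
          have inv_pts: "inv_into U \<phi> (fst y) \<in> pts M" "inv_into W \<psi> (snd y) \<in> pts N"
            using y M.chart_subset[OF U(1)] N.chart_subset[OF W(1)]
            by (auto dest!: inv_into_into)
          have "C b (inv_into U \<phi> (fst y), inv_into W \<psi> (snd y)) = fst y \<bullet> b" for b
            using inv inv_pts y1 by (simp add: C_def c_def pullback_def)
          then show "h (inv_into (U \<times> W) (map_prod \<phi> \<psi>) y) =
              F (fst y, \<psi> n) + (\<Sum>b\<in>B. - K b ?y * (fst y \<bullet> b))"
            unfolding inv_chart_prod[OF U(1) W(1) y]
            using inv_pts n N.chart_inv[OF W(1) mn(2)]
            by (simp add: h_def Q_def KC_def P_def pullback_def emb_i_def F_def)
        qed
        \<comment> \<open>The basis \<open>B\<close> reproduces \<open>fst w\<close> only for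
          directions in the model space; this is why \<open>derivation_vanishes\<close> tests
          \<open>L\<close> on the model alone.\<close>
        fix w assume "w \<in> model V"
        then have "(\<Sum>b\<in>B. (fst w \<bullet> b) *\<^sub>R b) = fst w"
          using B(3) by (auto simp: model_prod)
        then have "L (fst w, 0) = L (\<Sum>b\<in>B. (fst w \<bullet> b) *\<^sub>R (b, 0))"
          by (simp add: sum_prod)
        also have "\<dots> = (\<Sum>b\<in>B. (fst w \<bullet> b) *\<^sub>R L (b, 0))"
          unfolding linear_sum[OF lin] linear_cmul[OF lin] ..
        also have "\<dots> = (\<Sum>b\<in>B. K b ?y * (fst w \<bullet> b))"
          using KL by (intro sum.cong) simp_all
        finally show "L (fst w, 0) + (\<Sum>b\<in>B. - K b ?y * (fst w \<bullet> b)) = 0"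
          by (simp add: sum_negf)
      qed
      then have "v P (m, n) = (\<Sum>b\<in>B. K b ?y * v (C b) (m, n))"
        using vh by (simp add: sum_negf)
      then show ?thesis
        using mnV M.chart_inv[OF U(1) mn(1)] N.chart_inv[OF W(1) mn(2)] by (simp add: z_eq G_def P_def)
    qed
    have sub: "T \<times> \<psi> ` W \<subseteq> ?S"
      using T(3) by auto
    show "\<exists>U \<phi> Q F. (U, \<phi>) \<in> atlas V \<and> p \<in> U \<and> \<phi> p \<in> Q \<and> openin (top_of_set (model V)) Q \<and>
        smooth_on (model V) Q F \<and> (\<forall>x\<in>U. \<phi> x \<in> Q \<longrightarrow> ?H x = F (\<phi> x))"
    proof (intro exI conjI ballI impI)
      show "(U \<times> W, map_prod \<phi> \<psi>) \<in> atlas V" by (rule chart)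
      show "p \<in> U \<times> W" "map_prod \<phi> \<psi> p \<in> T \<times> \<psi> ` W"
        using U W T by (auto simp: mem_Times_iff)
      show "openin (top_of_set (model V)) (T \<times> \<psi> ` W)"
        unfolding model_prod using openin_Times[OF T(1) N.chart_image_open[OF W(1)]] .
      show "smooth_on (model V) (T \<times> \<psi> ` W) G"
        by (rule smooth_on_subset[OF G sub])
    qed (rule eq)
  qed
  then show ?thesis
    by (simp add: V.carrier_iff del: pts_prod)
qed

end

section \<open>The module of vector fields\<close>

context smooth_mfd
begin

lemma fun_apply:
  assumes "x \<in> pts M"
  shows "(f \<oplus>\<^bsub>C\<^sup>\<infinity> M\<^esub> g) x = f x + g x" "(f \<otimes>\<^bsub>C\<^sup>\<infinity> M\<^esub> g) x = f x * g x"
    "(c \<odot>\<^bsub>C\<^sup>\<infinity> M\<^esub> f) x = c * f x" "\<zero>\<^bsub>C\<^sup>\<infinity> M\<^esub> x = 0" "\<one>\<^bsub>C\<^sup>\<infinity> M\<^esub> x = 1"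
  using assms by (simp_all add: smooth_algebra_simps)

lemma fun_closed:
  "f \<in> carrier (C\<^sup>\<infinity> M) \<Longrightarrow> g \<in> carrier (C\<^sup>\<infinity> M) \<Longrightarrow> f \<oplus>\<^bsub>C\<^sup>\<infinity> M\<^esub> g \<in> carrier (C\<^sup>\<infinity> M)"
  "f \<in> carrier (C\<^sup>\<infinity> M) \<Longrightarrow> g \<in> carrier (C\<^sup>\<infinity> M) \<Longrightarrow> f \<otimes>\<^bsub>C\<^sup>\<infinity> M\<^esub> g \<in> carrier (C\<^sup>\<infinity> M)"
  "f \<in> carrier (C\<^sup>\<infinity> M) \<Longrightarrow> c \<odot>\<^bsub>C\<^sup>\<infinity> M\<^esub> f \<in> carrier (C\<^sup>\<infinity> M)"
  "\<zero>\<^bsub>C\<^sup>\<infinity> M\<^esub> \<in> carrier (C\<^sup>\<infinity> M)" "\<one>\<^bsub>C\<^sup>\<infinity> M\<^esub> \<in> carrier (C\<^sup>\<infinity> M)"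
  unfolding smooth_algebra_simps
  by (rule add_carrier mult_carrier smult_carrier const_carrier; assumption?)+

lemma cring_smooth_algebra: "cring (C\<^sup>\<infinity> M)"
proof (intro cringI abelian_groupI comm_monoidI)
  fix f assume f: "f \<in> carrier (C\<^sup>\<infinity> M)"
  show "\<exists>g\<in>carrier (C\<^sup>\<infinity> M). g \<oplus>\<^bsub>C\<^sup>\<infinity> M\<^esub> f = \<zero>\<^bsub>C\<^sup>\<infinity> M\<^esub>"
    using f by (intro bexI[of _ "(-1) \<odot>\<^bsub>C\<^sup>\<infinity> M\<^esub> f"] carrier_eqI) (simp_all add: fun_apply fun_closed)
qed (auto intro!: carrier_eqI simp: fun_apply fun_closed algebra_simps)

lemma derivation_ops:
  assumes "D \<in> derivations (C\<^sup>\<infinity> M)" "f \<in> carrier (C\<^sup>\<infinity> M)" "x \<in> pts M"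
  shows "g \<in> carrier (C\<^sup>\<infinity> M) \<Longrightarrow> D (f \<oplus>\<^bsub>C\<^sup>\<infinity> M\<^esub> g) x = D f x + D g x"
    "g \<in> carrier (C\<^sup>\<infinity> M) \<Longrightarrow> D (f \<otimes>\<^bsub>C\<^sup>\<infinity> M\<^esub> g) x = f x * D g x + D f x * g x"
    "D (c \<odot>\<^bsub>C\<^sup>\<infinity> M\<^esub> f) x = c * D f x"
  unfolding smooth_algebra_simps
  using derivation_add derivation_mult derivation_smult assms by blast+

lemma derivationI:
  assumes "D \<in> extensional (carrier (C\<^sup>\<infinity> M))" "\<And>f. f \<in> carrier (C\<^sup>\<infinity> M) \<Longrightarrow> D f \<in> carrier (C\<^sup>\<infinity> M)"
    and "\<And>f g x. f \<in> carrier (C\<^sup>\<infinity> M) \<Longrightarrow> g \<in> carrier (C\<^sup>\<infinity> M) \<Longrightarrow> x \<in> pts M \<Longrightarrow>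
      D (f \<oplus>\<^bsub>C\<^sup>\<infinity> M\<^esub> g) x = D f x + D g x"
    and "\<And>f g x. f \<in> carrier (C\<^sup>\<infinity> M) \<Longrightarrow> g \<in> carrier (C\<^sup>\<infinity> M) \<Longrightarrow> x \<in> pts M \<Longrightarrow>
      D (f \<otimes>\<^bsub>C\<^sup>\<infinity> M\<^esub> g) x = f x * D g x + D f x * g x"
    and "\<And>c f x. f \<in> carrier (C\<^sup>\<infinity> M) \<Longrightarrow> x \<in> pts M \<Longrightarrow> D (c \<odot>\<^bsub>C\<^sup>\<infinity> M\<^esub> f) x = c * D f x"
  shows "D \<in> derivations (C\<^sup>\<infinity> M)"
  using assms unfolding derivations_iff smooth_algebra_simps by (auto simp: PiE_iff)

lemma carrier_fields: "carrier (\<XX> M) = derivations (C\<^sup>\<infinity> M)"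
  by (simp add: vector_fields_def)

lemma field_apply:
  assumes "f \<in> carrier (C\<^sup>\<infinity> M)" "x \<in> pts M"
  shows "(v \<oplus>\<^bsub>\<XX> M\<^esub> w) f x = v f x + w f x" "(g \<odot>\<^bsub>\<XX> M\<^esub> v) f x = g x * v f x" "\<zero>\<^bsub>\<XX> M\<^esub> f x = 0"
  using assms by (simp_all add: vector_fields_def fun_apply)

lemma field_apply_fun:
  assumes "f \<in> carrier (C\<^sup>\<infinity> M)"
  shows "(v \<oplus>\<^bsub>\<XX> M\<^esub> w) f = v f \<oplus>\<^bsub>C\<^sup>\<infinity> M\<^esub> w f" "(g \<odot>\<^bsub>\<XX> M\<^esub> v) f = g \<otimes>\<^bsub>C\<^sup>\<infinity> M\<^esub> v f"
    "\<zero>\<^bsub>\<XX> M\<^esub> f = \<zero>\<^bsub>C\<^sup>\<infinity> M\<^esub>"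
  using assms by (simp_all add: vector_fields_def)

lemma field_extensional:
  "v \<oplus>\<^bsub>\<XX> M\<^esub> w \<in> extensional (carrier (C\<^sup>\<infinity> M))" "g \<odot>\<^bsub>\<XX> M\<^esub> v \<in> extensional (carrier (C\<^sup>\<infinity> M))"
  "\<zero>\<^bsub>\<XX> M\<^esub> \<in> extensional (carrier (C\<^sup>\<infinity> M))"
  by (simp_all add: vector_fields_def)

lemma field_closed:
  assumes v: "v \<in> carrier (\<XX> M)"
  shows "w \<in> carrier (\<XX> M) \<Longrightarrow> v \<oplus>\<^bsub>\<XX> M\<^esub> w \<in> carrier (\<XX> M)"
    "g \<in> carrier (C\<^sup>\<infinity> M) \<Longrightarrow> g \<odot>\<^bsub>\<XX> M\<^esub> v \<in> carrier (\<XX> M)"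
  using v unfolding carrier_fields
  by (auto intro!: derivationI simp: field_extensional field_apply fun_closed derivation_ops algebra_simps)
    (auto simp: field_apply_fun fun_closed derivation_carrier)

lemma zero_field_closed: "\<zero>\<^bsub>\<XX> M\<^esub> \<in> carrier (\<XX> M)"
  unfolding carrier_fields
  by (rule derivationI) (simp_all add: field_extensional field_apply_fun fun_closed fun_apply)

lemma field_eqI:
  assumes "v \<in> carrier (\<XX> M)" "w \<in> carrier (\<XX> M)"
    and "\<And>f x. f \<in> carrier (C\<^sup>\<infinity> M) \<Longrightarrow> x \<in> pts M \<Longrightarrow> v f x = w f x"
  shows "v = w"
proof (rule extensionalityI[of _ "carrier (C\<^sup>\<infinity> M)"])
  show "v \<in> extensional (carrier (C\<^sup>\<infinity> M))" "w \<in> extensional (carrier (C\<^sup>\<infinity> M))"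
    using assms(1,2) by (auto simp: carrier_fields derivations_iff PiE_iff)
  fix f assume "f \<in> carrier (C\<^sup>\<infinity> M)"
  then show "v f = w f"
    using assms derivation_carrier unfolding carrier_fields by (intro carrier_eqI) auto
qed

lemma module_fields: "Module.module (C\<^sup>\<infinity> M) (\<XX> M)"
proof (rule moduleI[OF cring_smooth_algebra])
  show "abelian_group (\<XX> M)"
  proof (rule abelian_groupI)
    fix v assume v: "v \<in> carrier (\<XX> M)"
    show "\<exists>w\<in>carrier (\<XX> M). w \<oplus>\<^bsub>\<XX> M\<^esub> v = \<zero>\<^bsub>\<XX> M\<^esub>"
      using v
      by (intro bexI[of _ "((-1) \<odot>\<^bsub>C\<^sup>\<infinity> M\<^esub> \<one>\<^bsub>C\<^sup>\<infinity> M\<^esub>) \<odot>\<^bsub>\<XX> M\<^esub> v"] field_eqI)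
        (simp_all add: field_apply field_closed fun_closed zero_field_closed fun_apply)
  qed (auto intro!: field_eqI simp: field_apply field_closed fun_closed zero_field_closed)
qed (auto intro!: field_eqI simp: field_apply field_closed fun_closed fun_apply algebra_simps)

text \<open>Covers horizontal and vertical fields alike, each being defined by vanishing on a set of
  pulled-back functions. Closure holds because the module operations are computed argument by
  argument; negation is multiplication by the constant function -1.\<close>

lemma submodule_annihilator:
  assumes "S \<subseteq> carrier (C\<^sup>\<infinity> M)"
  shows "submodule {v \<in> carrier (\<XX> M). \<forall>f\<in>S. v f = \<zero>\<^bsub>C\<^sup>\<infinity> M\<^esub>} (C\<^sup>\<infinity> M) (\<XX> M)" (is "submodule ?A _ _")
proof -
  interpret Module.module "C\<^sup>\<infinity> M" "\<XX> M"
    by (rule module_fields)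
  have smult: "g \<odot>\<^bsub>\<XX> M\<^esub> v \<in> ?A" if "g \<in> carrier (C\<^sup>\<infinity> M)" "v \<in> ?A" for g v
    using that assms by (auto simp: field_apply_fun subset_iff)
  show ?thesis
  proof (rule submoduleI)
    fix v assume v: "v \<in> ?A"
    have "\<ominus>\<^bsub>\<XX> M\<^esub> v = (\<ominus>\<^bsub>C\<^sup>\<infinity> M\<^esub> \<one>\<^bsub>C\<^sup>\<infinity> M\<^esub>) \<odot>\<^bsub>\<XX> M\<^esub> v"
      using v by (simp add: smult_l_minus)
    with smult[OF _ v] show "\<ominus>\<^bsub>\<XX> M\<^esub> v \<in> ?A"
      by simp
  next
    fix v w assume "v \<in> ?A" "w \<in> ?A"
    then show "v \<oplus>\<^bsub>\<XX> M\<^esub> w \<in> ?A"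
      using assms by (auto simp: field_apply_fun subset_iff)
  next
    show "\<zero>\<^bsub>\<XX> M\<^esub> \<in> ?A"
      using assms by (auto simp: field_apply_fun subset_iff)
  qed (use smult in auto)
qed

end

section \<open>Smooth families\<close>

text \<open>What the two choices of a factor have in common: slices \<open>i p\<close>, the
  projection \<open>\<pi>\<close> along the parameters and the projection \<open>\<sigma>\<close>
  onto them. The instances keep \<open>M \<times> N\<close> as the ambient manifold, so the factors
  need not be swapped. \<open>horizontal_part\<close> is the only assumption about vector fields;
  the rest of the locale follows formally.\<close>

locale product_family = X: smooth_mfd X + P: smooth_mfd P + V: smooth_mfd V
  for X :: "('x, 'e::euclidean_space) manifold" and P :: "('p, 'f::euclidean_space) manifold"
    and V :: "('v, 'g::euclidean_space) manifold" +
  fixes i :: "'p \<Rightarrow> 'x \<Rightarrow> 'v" and \<pi> :: "'v \<Rightarrow> 'x" and \<sigma> :: "'v \<Rightarrow> 'p"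
  assumes i_pts: "p \<in> pts P \<Longrightarrow> x \<in> pts X \<Longrightarrow> i p x \<in> pts V"
    and \<pi>_i: "p \<in> pts P \<Longrightarrow> x \<in> pts X \<Longrightarrow> \<pi> (i p x) = x"
    and \<sigma>_i: "p \<in> pts P \<Longrightarrow> x \<in> pts X \<Longrightarrow> \<sigma> (i p x) = p"
    and \<pi>_pts: "y \<in> pts V \<Longrightarrow> \<pi> y \<in> pts X"
    and \<sigma>_pts: "y \<in> pts V \<Longrightarrow> \<sigma> y \<in> pts P"
    and i_proj: "y \<in> pts V \<Longrightarrow> i (\<sigma> y) (\<pi> y) = y"
    and pullback_i: "f \<in> carrier (C\<^sup>\<infinity> V) \<Longrightarrow> p \<in> pts P \<Longrightarrow> pullback X (i p) f \<in> carrier (C\<^sup>\<infinity> X)"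
    and pullback_\<pi>: "g \<in> carrier (C\<^sup>\<infinity> X) \<Longrightarrow> pullback V \<pi> g \<in> carrier (C\<^sup>\<infinity> V)"
    and pullback_\<sigma>: "h \<in> carrier (C\<^sup>\<infinity> P) \<Longrightarrow> pullback V \<sigma> h \<in> carrier (C\<^sup>\<infinity> V)"
    and horizontal_part: "v \<in> derivations (C\<^sup>\<infinity> V) \<Longrightarrow> f \<in> carrier (C\<^sup>\<infinity> V) \<Longrightarrow>
      (\<lambda>y\<in>pts V. v (pullback V \<pi> (pullback X (i (\<sigma> y)) f)) y) \<in> carrier (C\<^sup>\<infinity> V)"
begin

abbreviation "FA \<equiv> family_algebra X P V i"
abbreviation "FF \<equiv> family_fields X P V i"
abbreviation "\<iota> \<equiv> family_iota X P V i"
abbreviation "proj \<equiv> family_pi X P V i \<pi>"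

lemma pullback_i_apply: "x \<in> pts X \<Longrightarrow> pullback X (i p) f x = f (i p x)"
  and pullback_\<pi>_apply: "y \<in> pts V \<Longrightarrow> pullback V \<pi> g y = g (\<pi> y)"
  by (simp_all add: pullback_def)

lemma pullback_i_\<pi>: "p \<in> pts P \<Longrightarrow> g \<in> carrier (C\<^sup>\<infinity> X) \<Longrightarrow> pullback X (i p) (pullback V \<pi> g) = g"
  by (intro X.carrier_eqI pullback_i pullback_\<pi>) (simp_all add: pullback_i_apply pullback_\<pi>_apply i_pts \<pi>_i)

lemma pullback_i_ops:
  assumes "p \<in> pts P" "f \<in> carrier (C\<^sup>\<infinity> V)"
  shows "g \<in> carrier (C\<^sup>\<infinity> V) \<Longrightarrow>
      pullback X (i p) (f \<oplus>\<^bsub>C\<^sup>\<infinity> V\<^esub> g) = pullback X (i p) f \<oplus>\<^bsub>C\<^sup>\<infinity> X\<^esub> pullback X (i p) g"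
    "g \<in> carrier (C\<^sup>\<infinity> V) \<Longrightarrow>
      pullback X (i p) (f \<otimes>\<^bsub>C\<^sup>\<infinity> V\<^esub> g) = pullback X (i p) f \<otimes>\<^bsub>C\<^sup>\<infinity> X\<^esub> pullback X (i p) g"
    "pullback X (i p) (c \<odot>\<^bsub>C\<^sup>\<infinity> V\<^esub> f) = c \<odot>\<^bsub>C\<^sup>\<infinity> X\<^esub> pullback X (i p) f"
  using assms
  by (auto intro!: X.carrier_eqI pullback_i
      simp: pullback_i_apply X.fun_apply V.fun_apply X.fun_closed V.fun_closed pullback_i i_pts)

lemma pullback_\<pi>_ops:
  assumes "f \<in> carrier (C\<^sup>\<infinity> X)"
  shows "g \<in> carrier (C\<^sup>\<infinity> X) \<Longrightarrow>
      pullback V \<pi> (f \<oplus>\<^bsub>C\<^sup>\<infinity> X\<^esub> g) = pullback V \<pi> f \<oplus>\<^bsub>C\<^sup>\<infinity> V\<^esub> pullback V \<pi> g"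
    "g \<in> carrier (C\<^sup>\<infinity> X) \<Longrightarrow>
      pullback V \<pi> (f \<otimes>\<^bsub>C\<^sup>\<infinity> X\<^esub> g) = pullback V \<pi> f \<otimes>\<^bsub>C\<^sup>\<infinity> V\<^esub> pullback V \<pi> g"
    "pullback V \<pi> (c \<odot>\<^bsub>C\<^sup>\<infinity> X\<^esub> f) = c \<odot>\<^bsub>C\<^sup>\<infinity> V\<^esub> pullback V \<pi> f"
  using assms
  by (auto intro!: V.carrier_eqI pullback_\<pi>
      simp: pullback_\<pi>_apply X.fun_apply V.fun_apply X.fun_closed V.fun_closed pullback_\<pi> \<pi>_pts)

text \<open>The family \<open>w\<close> acting on functions on \<open>V\<close>, viewed as smooth families of functions.\<close>

definition total :: "('p \<Rightarrow> ('x \<Rightarrow> real) \<Rightarrow> ('x \<Rightarrow> real)) \<Rightarrow> ('v \<Rightarrow> real) \<Rightarrow> ('v \<Rightarrow> real)"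
  where "total w f = (\<lambda>y\<in>pts V. w (\<sigma> y) (pullback X (i (\<sigma> y)) f) (\<pi> y))"

lemma total_apply: "y \<in> pts V \<Longrightarrow> total w f y = w (\<sigma> y) (pullback X (i (\<sigma> y)) f) (\<pi> y)"
  by (simp add: total_def)

text \<open>The canonical identification of smooth families with functions on \<open>V\<close>, at
  the level of carriers; it moves questions about families to \<open>V\<close>.\<close>

lemma carrier_FA: "g \<in> carrier FA \<longleftrightarrow> (\<exists>f\<in>carrier (C\<^sup>\<infinity> V). g = (\<lambda>p\<in>pts P. pullback X (i p) f))"
proof
  assume "g \<in> carrier FA"
  then obtain f where g: "g \<in> pts P \<rightarrow>\<^sub>E carrier (C\<^sup>\<infinity> X)" and f: "f \<in> carrier (C\<^sup>\<infinity> V)"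
    and fg: "\<forall>p\<in>pts P. \<forall>x\<in>pts X. f (i p x) = g p x"
    by (auto simp: family_algebra_def)
  have "g = (\<lambda>p\<in>pts P. pullback X (i p) f)"
  proof (rule extensionalityI[of _ "pts P"])
    fix p assume p: "p \<in> pts P"
    have "g p = pullback X (i p) f"
      using g f fg p by (intro X.carrier_eqI pullback_i) (auto simp: pullback_i_apply)
    then show "g p = (\<lambda>p\<in>pts P. pullback X (i p) f) p"
      using p by simp
  qed (use g in \<open>auto simp: PiE_iff\<close>)
  then show "\<exists>f\<in>carrier (C\<^sup>\<infinity> V). g = (\<lambda>p\<in>pts P. pullback X (i p) f)"
    using f by blast
next
  assume "\<exists>f\<in>carrier (C\<^sup>\<infinity> V). g = (\<lambda>p\<in>pts P. pullback X (i p) f)"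
  then show "g \<in> carrier FA"
    by (auto simp: family_algebra_def pullback_i pullback_i_apply intro!: bexI)
qed

lemma FA_ops:
  assumes "p \<in> pts P"
  shows "(g \<oplus>\<^bsub>FA\<^esub> h) p = g p \<oplus>\<^bsub>C\<^sup>\<infinity> X\<^esub> h p" "(g \<otimes>\<^bsub>FA\<^esub> h) p = g p \<otimes>\<^bsub>C\<^sup>\<infinity> X\<^esub> h p"
    "(c \<odot>\<^bsub>FA\<^esub> h) p = c \<odot>\<^bsub>C\<^sup>\<infinity> X\<^esub> h p"
  using assms by (simp_all add: family_algebra_def)

lemma FA_ext:
  "g \<oplus>\<^bsub>FA\<^esub> h \<in> extensional (pts P)" "g \<otimes>\<^bsub>FA\<^esub> h \<in> extensional (pts P)"
  "c \<odot>\<^bsub>FA\<^esub> h \<in> extensional (pts P)"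
  by (simp_all add: family_algebra_def)

lemma FA_closed:
  assumes "g \<in> carrier FA"
  shows "h \<in> carrier FA \<Longrightarrow> g \<oplus>\<^bsub>FA\<^esub> h \<in> carrier FA" "h \<in> carrier FA \<Longrightarrow> g \<otimes>\<^bsub>FA\<^esub> h \<in> carrier FA"
    "c \<odot>\<^bsub>FA\<^esub> g \<in> carrier FA"
proof -
  obtain f where f: "f \<in> carrier (C\<^sup>\<infinity> V)" "g = (\<lambda>p\<in>pts P. pullback X (i p) f)"
    using assms carrier_FA by auto
  show "c \<odot>\<^bsub>FA\<^esub> g \<in> carrier FA"
    unfolding carrier_FA using f
    by (intro bexI[of _ "c \<odot>\<^bsub>C\<^sup>\<infinity> V\<^esub> f"] extensionalityI[of _ "pts P"])
      (auto simp: FA_ext FA_ops pullback_i_ops V.fun_closed)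
  assume "h \<in> carrier FA"
  then obtain f' where f': "f' \<in> carrier (C\<^sup>\<infinity> V)" "h = (\<lambda>p\<in>pts P. pullback X (i p) f')"
    using carrier_FA by auto
  show "g \<oplus>\<^bsub>FA\<^esub> h \<in> carrier FA"
    unfolding carrier_FA using f f'
    by (intro bexI[of _ "f \<oplus>\<^bsub>C\<^sup>\<infinity> V\<^esub> f'"] extensionalityI[of _ "pts P"])
      (auto simp: FA_ext FA_ops pullback_i_ops V.fun_closed)
  show "g \<otimes>\<^bsub>FA\<^esub> h \<in> carrier FA"
    unfolding carrier_FA using f f'
    by (intro bexI[of _ "f \<otimes>\<^bsub>C\<^sup>\<infinity> V\<^esub> f'"] extensionalityI[of _ "pts P"])
      (auto simp: FA_ext FA_ops pullback_i_ops V.fun_closed)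
qed

text \<open>Linearity and the Leibniz rule hold member by member as soon as each \<open>w p\<close>
  is a vector field. What \<open>family_fields\<close> adds is that smooth families go to smooth
  families, and under the identification with functions on \<open>V\<close> this says that
  \<open>total w\<close> preserves smoothness.\<close>

lemma carrier_FF_iff: "w \<in> carrier FF \<longleftrightarrow>
    w \<in> pts P \<rightarrow>\<^sub>E carrier (\<XX> X) \<and> (\<forall>f\<in>carrier (C\<^sup>\<infinity> V). total w f \<in> carrier (C\<^sup>\<infinity> V))"
proof -
  define D where "D = (\<lambda>g\<in>carrier FA. \<lambda>p\<in>pts P. w p (g p))"
  have D: "D g p = w p (g p)" if "g \<in> carrier FA" "p \<in> pts P" for g p
    using that by (simp add: D_def)
  have "(\<forall>f\<in>carrier (C\<^sup>\<infinity> V). total w f \<in> carrier (C\<^sup>\<infinity> V)) \<longleftrightarrow> D \<in> derivations FA"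
    if w: "w \<in> pts P \<rightarrow>\<^sub>E carrier (\<XX> X)"
  proof
    assume R: "D \<in> derivations FA"
    show "\<forall>f\<in>carrier (C\<^sup>\<infinity> V). total w f \<in> carrier (C\<^sup>\<infinity> V)"
    proof
      fix f assume f: "f \<in> carrier (C\<^sup>\<infinity> V)"
      let ?g = "\<lambda>p\<in>pts P. pullback X (i p) f"
      have g: "?g \<in> carrier FA"
        using f carrier_FA by blast
      then have "D ?g \<in> carrier FA"
        using R by (auto simp: derivations_def)
      then obtain f' where f': "f' \<in> carrier (C\<^sup>\<infinity> V)" "D ?g = (\<lambda>p\<in>pts P. pullback X (i p) f')"
        unfolding carrier_FA by blast
      have "total w f = f'"
      proof (rule extensionalityI[of _ "pts V"])
        fix y assume y: "y \<in> pts V"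
        have "f' y = pullback X (i (\<sigma> y)) f' (\<pi> y)"
          by (simp add: pullback_i_apply \<pi>_pts i_proj y)
        also have "\<dots> = D ?g (\<sigma> y) (\<pi> y)"
          by (simp add: f'(2) \<sigma>_pts y)
        also have "\<dots> = total w f y"
          using D[OF g \<sigma>_pts[OF y]] y by (simp add: total_apply \<sigma>_pts)
        finally show "total w f y = f' y" by simp
      qed (use f' in \<open>auto simp: total_def V.carrier_iff\<close>)
      then show "total w f \<in> carrier (C\<^sup>\<infinity> V)"
        using f' by simp
    qed
  next
    assume T: "\<forall>f\<in>carrier (C\<^sup>\<infinity> V). total w f \<in> carrier (C\<^sup>\<infinity> V)"
    have D_closed: "D g \<in> carrier FA" if g: "g \<in> carrier FA" for g
    proof -
      obtain f where f: "f \<in> carrier (C\<^sup>\<infinity> V)" "g = (\<lambda>p\<in>pts P. pullback X (i p) f)"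
        using g carrier_FA by auto
      have "D g = (\<lambda>p\<in>pts P. pullback X (i p) (total w f))"
      proof (rule extensionalityI[of _ "pts P"])
        fix p assume p: "p \<in> pts P"
        have "w p (pullback X (i p) f) = pullback X (i p) (total w f)"
        proof (rule X.carrier_eqI)
          show "w p (pullback X (i p) f) \<in> carrier (C\<^sup>\<infinity> X)"
            using w p f pullback_i X.derivation_carrier X.carrier_fields by (metis PiE_mem)
          show "pullback X (i p) (total w f) \<in> carrier (C\<^sup>\<infinity> X)"
            using T f p pullback_i by blast
        qed (use p in \<open>simp add: pullback_i_apply total_apply i_pts \<sigma>_i \<pi>_i\<close>)
        then show "D g p = (\<lambda>p\<in>pts P. pullback X (i p) (total w f)) p"
          using p f D[OF g p] by simp
      qed (use g in \<open>simp_all add: D_def\<close>)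
      then show ?thesis
        using T f carrier_FA by blast
    qed
    have w_der: "w p \<in> derivations (C\<^sup>\<infinity> X)" if "p \<in> pts P" for p
      using w that X.carrier_fields by auto
    have g_carrier: "g p \<in> carrier (C\<^sup>\<infinity> X)" if "g \<in> carrier FA" "p \<in> pts P" for g p
      using that by (auto simp: family_algebra_def)
    have D_ext: "D g \<in> extensional (pts P)" if "g \<in> carrier FA" for g
      using that by (simp add: D_def)
    show "D \<in> derivations FA"
      unfolding derivations_def
    proof (intro CollectI conjI ballI allI)
      show "D \<in> carrier FA \<rightarrow>\<^sub>E carrier FA"
        using D_closed by (auto simp: PiE_iff D_def)
      fix g assume g: "g \<in> carrier FA"
      show "D (c \<odot>\<^bsub>FA\<^esub> g) = c \<odot>\<^bsub>FA\<^esub> D g" for c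
      proof (rule extensionalityI[of _ "pts P"])
        fix p assume p: "p \<in> pts P"
        show "D (c \<odot>\<^bsub>FA\<^esub> g) p = (c \<odot>\<^bsub>FA\<^esub> D g) p"
          using g p w_der[OF p] g_carrier[OF g p] by (simp add: D FA_closed FA_ops derivations_def)
      qed (simp_all add: FA_ext D_ext FA_closed g)
      fix h assume h: "h \<in> carrier FA"
      show "D (g \<oplus>\<^bsub>FA\<^esub> h) = D g \<oplus>\<^bsub>FA\<^esub> D h"
      proof (rule extensionalityI[of _ "pts P"])
        fix p assume p: "p \<in> pts P"
        show "D (g \<oplus>\<^bsub>FA\<^esub> h) p = (D g \<oplus>\<^bsub>FA\<^esub> D h) p"
          using g h p w_der[OF p] g_carrier[OF g p] g_carrier[OF h p]
          by (simp add: D FA_closed FA_ops derivations_def)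
      qed (simp_all add: FA_ext D_ext FA_closed g h)
      show "D (g \<otimes>\<^bsub>FA\<^esub> h) = (g \<otimes>\<^bsub>FA\<^esub> D h) \<oplus>\<^bsub>FA\<^esub> (D g \<otimes>\<^bsub>FA\<^esub> h)"
      proof (rule extensionalityI[of _ "pts P"])
        fix p assume p: "p \<in> pts P"
        show "D (g \<otimes>\<^bsub>FA\<^esub> h) p = ((g \<otimes>\<^bsub>FA\<^esub> D h) \<oplus>\<^bsub>FA\<^esub> (D g \<otimes>\<^bsub>FA\<^esub> h)) p"
          using g h p w_der[OF p] g_carrier[OF g p] g_carrier[OF h p]
          by (simp add: D FA_closed FA_ops derivations_def)
      qed (simp_all add: FA_ext D_ext FA_closed g h)
    qed
  qed
  then show ?thesis
    unfolding family_fields_def D_def by auto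
qed

lemma FF_derivation: "w \<in> carrier FF \<Longrightarrow> p \<in> pts P \<Longrightarrow> w p \<in> derivations (C\<^sup>\<infinity> X)"
  and FF_total: "w \<in> carrier FF \<Longrightarrow> f \<in> carrier (C\<^sup>\<infinity> V) \<Longrightarrow> total w f \<in> carrier (C\<^sup>\<infinity> V)"
  unfolding carrier_FF_iff X.carrier_fields by auto

lemma FF_ops:
  assumes "p \<in> pts P"
  shows "(w \<oplus>\<^bsub>FF\<^esub> u) p = w p \<oplus>\<^bsub>\<XX> X\<^esub> u p" "(f \<odot>\<^bsub>FF\<^esub> w) p = pullback X (i p) f \<odot>\<^bsub>\<XX> X\<^esub> w p"
    "\<zero>\<^bsub>FF\<^esub> p = \<zero>\<^bsub>\<XX> X\<^esub>"
  using assms by (simp_all add: family_fields_def)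

lemma FF_ext:
  "w \<oplus>\<^bsub>FF\<^esub> u \<in> extensional (pts P)" "f \<odot>\<^bsub>FF\<^esub> w \<in> extensional (pts P)" "\<zero>\<^bsub>FF\<^esub> \<in> extensional (pts P)"
  by (simp_all add: family_fields_def)

lemma FF_apply:
  assumes "p \<in> pts P" "g \<in> carrier (C\<^sup>\<infinity> X)" "x \<in> pts X"
  shows "(w \<oplus>\<^bsub>FF\<^esub> u) p g x = w p g x + u p g x" "(f \<odot>\<^bsub>FF\<^esub> w) p g x = f (i p x) * w p g x"
    "\<zero>\<^bsub>FF\<^esub> p g x = 0"
  using assms by (simp_all add: FF_ops X.field_apply pullback_i_apply)

lemma FF_eqI:
  assumes "w \<in> carrier FF" "u \<in> carrier FF"
    and "\<And>p g x. p \<in> pts P \<Longrightarrow> g \<in> carrier (C\<^sup>\<infinity> X) \<Longrightarrow> x \<in> pts X \<Longrightarrow> w p g x = u p g x"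
  shows "w = u"
proof (rule extensionalityI[of _ "pts P"])
  show "w \<in> extensional (pts P)" "u \<in> extensional (pts P)"
    using assms by (auto simp: carrier_FF_iff PiE_iff)
  fix p assume "p \<in> pts P"
  then show "w p = u p"
    using assms by (intro X.field_eqI) (auto simp: carrier_FF_iff)
qed

text \<open>Beyond closure for each member, only smoothness of \<open>total\<close> is at stake.
  \<open>total\<close> is additive in the family and turns the slicewise action of \<open>f\<close>
  into multiplication by \<open>f\<close>, because
  \<open>i (\<sigma> y) (\<pi> y) = y\<close>.\<close>

lemma FF_closed:
  assumes w: "w \<in> carrier FF"
  shows "u \<in> carrier FF \<Longrightarrow> w \<oplus>\<^bsub>FF\<^esub> u \<in> carrier FF"
    "f \<in> carrier (C\<^sup>\<infinity> V) \<Longrightarrow> f \<odot>\<^bsub>FF\<^esub> w \<in> carrier FF"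
proof -
  assume u: "u \<in> carrier FF"
  have "total (w \<oplus>\<^bsub>FF\<^esub> u) f \<in> carrier (C\<^sup>\<infinity> V)" if f: "f \<in> carrier (C\<^sup>\<infinity> V)" for f
  proof -
    have "total (w \<oplus>\<^bsub>FF\<^esub> u) f = total w f \<oplus>\<^bsub>C\<^sup>\<infinity> V\<^esub> total u f"
      unfolding smooth_algebra_simps
      by (rule extensionalityI[of _ "pts V"])
        (simp_all add: total_def FF_apply \<sigma>_pts \<pi>_pts pullback_i f)
    then show ?thesis
      using FF_total w u f V.fun_closed by simp
  qed
  then show "w \<oplus>\<^bsub>FF\<^esub> u \<in> carrier FF"
    using w u unfolding carrier_FF_iff by (auto simp: PiE_iff FF_ext FF_ops X.field_closed)
next
  assume h: "f \<in> carrier (C\<^sup>\<infinity> V)"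
  have "total (f \<odot>\<^bsub>FF\<^esub> w) f' \<in> carrier (C\<^sup>\<infinity> V)" if f': "f' \<in> carrier (C\<^sup>\<infinity> V)" for f'
  proof -
    have "total (f \<odot>\<^bsub>FF\<^esub> w) f' = f \<otimes>\<^bsub>C\<^sup>\<infinity> V\<^esub> total w f'"
      unfolding smooth_algebra_simps
      by (rule extensionalityI[of _ "pts V"])
        (simp_all add: total_def FF_apply \<sigma>_pts \<pi>_pts pullback_i f' i_proj)
    then show ?thesis
      using FF_total w h f' V.fun_closed by simp
  qed
  then show "f \<odot>\<^bsub>FF\<^esub> w \<in> carrier FF"
    using w h unfolding carrier_FF_iff by (auto simp: PiE_iff FF_ext FF_ops X.field_closed pullback_i)
qed

lemma FF_zero_closed: "\<zero>\<^bsub>FF\<^esub> \<in> carrier FF"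
proof -
  have "total \<zero>\<^bsub>FF\<^esub> f \<in> carrier (C\<^sup>\<infinity> V)" if f: "f \<in> carrier (C\<^sup>\<infinity> V)" for f
  proof -
    have "total \<zero>\<^bsub>FF\<^esub> f = \<zero>\<^bsub>C\<^sup>\<infinity> V\<^esub>"
      unfolding smooth_algebra_simps
      by (rule extensionalityI[of _ "pts V"])
        (simp_all add: total_def FF_apply \<sigma>_pts \<pi>_pts pullback_i f)
    then show ?thesis
      using V.fun_closed by simp
  qed
  then show ?thesis
    unfolding carrier_FF_iff by (auto simp: PiE_iff FF_ext FF_ops X.zero_field_closed)
qed

lemma module_FF: "Module.module (C\<^sup>\<infinity> V) FF"
proof (rule moduleI[OF V.cring_smooth_algebra])
  show "abelian_group FF"
  proof (rule abelian_groupI)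
    fix w assume w: "w \<in> carrier FF"
    show "\<exists>u\<in>carrier FF. u \<oplus>\<^bsub>FF\<^esub> w = \<zero>\<^bsub>FF\<^esub>"
      using w
      by (intro bexI[of _ "((-1) \<odot>\<^bsub>C\<^sup>\<infinity> V\<^esub> \<one>\<^bsub>C\<^sup>\<infinity> V\<^esub>) \<odot>\<^bsub>FF\<^esub> w"] FF_eqI)
        (simp_all add: FF_apply FF_closed V.fun_closed FF_zero_closed V.fun_apply i_pts)
  qed (auto intro!: FF_eqI simp: FF_apply FF_closed V.fun_closed FF_zero_closed)
qed (auto intro!: FF_eqI simp: FF_apply FF_closed V.fun_closed V.fun_apply i_pts algebra_simps)

section \<open>The maps between families and vector fields on \<open>V\<close>\<close>

lemma total_derivation:
  assumes w: "w \<in> carrier FF"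
  shows "(\<lambda>f\<in>carrier (C\<^sup>\<infinity> V). total w f) \<in> derivations (C\<^sup>\<infinity> V)"
  by (rule V.derivationI)
    (simp_all add: FF_total w V.fun_closed total_apply pullback_i_ops \<sigma>_pts \<pi>_pts pullback_i
      X.derivation_ops[OF FF_derivation[OF w]] pullback_i_apply i_proj)

text \<open>Resolves the definite description. \<open>total w\<close> satisfies the defining
  condition, and it is the only solution because every \<open>y\<close> is the point
  \<open>\<pi> y\<close> of the slice \<open>i (\<sigma> y)\<close>, so the condition prescribes
  \<open>v f y\<close>.\<close>

lemma iota_eq:
  assumes w: "w \<in> carrier FF"
  shows "\<iota> w = (\<lambda>f\<in>carrier (C\<^sup>\<infinity> V). total w f)" (is "_ = ?T")
  unfolding family_iota_def
proof (rule the_equality)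
  have "pullback X (i p) (total w f) = w p (pullback X (i p) f)"
    if "f \<in> carrier (C\<^sup>\<infinity> V)" "p \<in> pts P" for f p
    using that
    by (intro X.carrier_eqI pullback_i FF_total w X.derivation_carrier[OF FF_derivation[OF w]])
      (simp_all add: pullback_i_apply total_apply i_pts \<sigma>_i \<pi>_i)
  then show "?T \<in> carrier (\<XX> V) \<and> (\<forall>f\<in>carrier (C\<^sup>\<infinity> V). \<forall>p\<in>pts P.
      pullback X (i p) (?T f) = w p (pullback X (i p) f))"
    using total_derivation[OF w] by (simp add: V.carrier_fields)
next
  fix v assume v: "v \<in> carrier (\<XX> V) \<and> (\<forall>f\<in>carrier (C\<^sup>\<infinity> V). \<forall>p\<in>pts P.
      pullback X (i p) (v f) = w p (pullback X (i p) f))"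
  show "v = ?T"
  proof (rule V.field_eqI)
    fix f y assume f: "f \<in> carrier (C\<^sup>\<infinity> V)" and y: "y \<in> pts V"
    have "v f y = pullback X (i (\<sigma> y)) (v f) (\<pi> y)"
      using y by (simp add: pullback_i_apply \<pi>_pts i_proj)
    also have "\<dots> = ?T f y"
      using v f y by (simp add: total_apply \<sigma>_pts)
    finally show "v f y = ?T f y" .
  qed (use v total_derivation[OF w] V.carrier_fields in auto)
qed

lemma iota_closed: "w \<in> carrier FF \<Longrightarrow> \<iota> w \<in> carrier (\<XX> V)"
  by (simp add: iota_eq V.carrier_fields total_derivation)

lemma iota_apply:
  "w \<in> carrier FF \<Longrightarrow> f \<in> carrier (C\<^sup>\<infinity> V) \<Longrightarrow> y \<in> pts V \<Longrightarrow>
    \<iota> w f y = w (\<sigma> y) (pullback X (i (\<sigma> y)) f) (\<pi> y)"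
  by (simp add: iota_eq total_apply)

lemma pi_apply:
  "p \<in> pts P \<Longrightarrow> g \<in> carrier (C\<^sup>\<infinity> X) \<Longrightarrow> x \<in> pts X \<Longrightarrow> proj v p g x = v (pullback V \<pi> g) (i p x)"
  by (simp add: family_pi_def pullback_i_apply)

text \<open>Each member is a derivation because pullbacks respect the algebra operations. Smooth
  dependence on the parameter is the assumption \<open>horizontal_part\<close>, since
  \<open>total (proj v) f\<close> is exactly the function named there.\<close>

lemma pi_closed:
  assumes v: "v \<in> carrier (\<XX> V)"
  shows "proj v \<in> carrier FF"
proof -
  have v': "v \<in> derivations (C\<^sup>\<infinity> V)"
    using v by (simp add: V.carrier_fields)
  have "proj v p \<in> derivations (C\<^sup>\<infinity> X)" if p: "p \<in> pts P" for p
  proof (rule X.derivationI)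
    fix g assume g: "g \<in> carrier (C\<^sup>\<infinity> X)"
    show "proj v p g \<in> carrier (C\<^sup>\<infinity> X)"
      using p g by (simp add: family_pi_def pullback_i pullback_\<pi> V.derivation_carrier[OF v'])
  qed (use p in \<open>simp_all add: pi_apply X.fun_closed pullback_\<pi>_ops V.derivation_ops[OF v'] pullback_\<pi>
      i_pts pullback_\<pi>_apply \<pi>_i\<close>, simp add: family_pi_def)
  moreover have "total (proj v) f \<in> carrier (C\<^sup>\<infinity> V)" if f: "f \<in> carrier (C\<^sup>\<infinity> V)" for f
  proof -
    have "total (proj v) f = (\<lambda>y\<in>pts V. v (pullback V \<pi> (pullback X (i (\<sigma> y)) f)) y)"
      unfolding total_def using f
      by (intro restrict_ext) (simp add: pi_apply \<sigma>_pts \<pi>_pts pullback_i i_proj)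
    then show ?thesis
      using horizontal_part[OF v' f] by simp
  qed
  ultimately show ?thesis
    unfolding carrier_FF_iff X.carrier_fields by (auto simp: PiE_iff family_pi_def)
qed

text \<open>Pulling \<open>g\<close> back along \<open>\<pi>\<close> and restricting to a slice
  returns \<open>g\<close>. Injectivity of \<open>\<iota>\<close> and surjectivity of
  \<open>proj\<close> both come from here.\<close>

lemma pi_iota:
  assumes w: "w \<in> carrier FF"
  shows "proj (\<iota> w) = w"
  by (rule FF_eqI)
    (simp_all add: pi_closed iota_closed w pi_apply iota_apply pullback_\<pi> pullback_i_\<pi> i_pts \<sigma>_i \<pi>_i)

lemma iota_pi_apply:
  assumes "v \<in> carrier (\<XX> V)" "f \<in> carrier (C\<^sup>\<infinity> V)" "y \<in> pts V"
  shows "\<iota> (proj v) f y = v (pullback V \<pi> (pullback X (i (\<sigma> y)) f)) y"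
  using assms by (simp add: iota_apply pi_closed pi_apply \<sigma>_pts \<pi>_pts pullback_i i_proj)

lemma mod_hom_iota: "mod_hom (C\<^sup>\<infinity> V) FF (\<XX> V) \<iota>"
  unfolding mod_hom_def
proof (intro conjI ballI)
  fix w u assume w: "w \<in> carrier FF" and u: "u \<in> carrier FF"
  show "\<iota> (w \<oplus>\<^bsub>FF\<^esub> u) = \<iota> w \<oplus>\<^bsub>\<XX> V\<^esub> \<iota> u"
    using w u by (intro V.field_eqI)
      (simp_all add: iota_closed FF_closed V.field_closed iota_apply V.field_apply FF_apply \<sigma>_pts \<pi>_pts pullback_i)
next
  fix f w assume f: "f \<in> carrier (C\<^sup>\<infinity> V)" and w: "w \<in> carrier FF"
  show "\<iota> (f \<odot>\<^bsub>FF\<^esub> w) = f \<odot>\<^bsub>\<XX> V\<^esub> \<iota> w"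
    using w f by (intro V.field_eqI)
      (simp_all add: iota_closed FF_closed V.field_closed iota_apply V.field_apply FF_apply \<sigma>_pts \<pi>_pts
        pullback_i i_proj)
qed (use module_FF V.module_fields iota_closed in auto)

lemma mod_hom_pi: "mod_hom (C\<^sup>\<infinity> V) (\<XX> V) FF proj"
  unfolding mod_hom_def
proof (intro conjI ballI)
  fix v w assume "v \<in> carrier (\<XX> V)" "w \<in> carrier (\<XX> V)"
  then show "proj (v \<oplus>\<^bsub>\<XX> V\<^esub> w) = proj v \<oplus>\<^bsub>FF\<^esub> proj w"
    by (intro FF_eqI) (simp_all add: pi_closed V.field_closed FF_closed pi_apply FF_apply V.field_apply
        pullback_\<pi> i_pts)
next
  fix f v assume "f \<in> carrier (C\<^sup>\<infinity> V)" "v \<in> carrier (\<XX> V)"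
  then show "proj (f \<odot>\<^bsub>\<XX> V\<^esub> v) = f \<odot>\<^bsub>FF\<^esub> proj v"
    by (intro FF_eqI) (simp_all add: pi_closed V.field_closed FF_closed pi_apply FF_apply V.field_apply
        pullback_\<pi> i_pts)
qed (use module_FF V.module_fields pi_closed in auto)

text \<open>A function of the parameter alone is constant on each slice, and derivations annihilate
  constants.\<close>

lemma iota_annihilates:
  assumes w: "w \<in> carrier FF" and h: "h \<in> carrier (C\<^sup>\<infinity> P)"
  shows "\<iota> w (pullback V \<sigma> h) = \<zero>\<^bsub>C\<^sup>\<infinity> V\<^esub>"
proof (rule V.carrier_eqI)
  show "\<iota> w (pullback V \<sigma> h) \<in> carrier (C\<^sup>\<infinity> V)"
    using iota_closed[OF w] pullback_\<sigma>[OF h] V.derivation_carrier V.carrier_fields by blast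
  fix y assume y: "y \<in> pts V"
  have "pullback X (i (\<sigma> y)) (pullback V \<sigma> h) = (\<lambda>x\<in>pts X. h (\<sigma> y))"
    unfolding pullback_def using y by (intro restrict_ext) (simp add: i_pts \<sigma>_pts \<sigma>_i)
  then show "\<iota> w (pullback V \<sigma> h) y = \<zero>\<^bsub>C\<^sup>\<infinity> V\<^esub> y"
    using X.derivation_const[OF FF_derivation[OF w \<sigma>_pts[OF y]] \<pi>_pts[OF y]] y w h
    by (simp add: iota_apply pullback_\<sigma> V.fun_apply)
qed (rule V.fun_closed)

text \<open>Turns the defining conditions of horizontal and vertical fields into kernels of module
  homomorphisms.\<close>

lemma pi_zero_iff:
  assumes v: "v \<in> carrier (\<XX> V)"
  shows "proj v = \<zero>\<^bsub>FF\<^esub> \<longleftrightarrow> (\<forall>g\<in>carrier (C\<^sup>\<infinity> X). v (pullback V \<pi> g) = \<zero>\<^bsub>C\<^sup>\<infinity> V\<^esub>)"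
proof
  assume z: "proj v = \<zero>\<^bsub>FF\<^esub>"
  show "\<forall>g\<in>carrier (C\<^sup>\<infinity> X). v (pullback V \<pi> g) = \<zero>\<^bsub>C\<^sup>\<infinity> V\<^esub>"
  proof
    fix g assume g: "g \<in> carrier (C\<^sup>\<infinity> X)"
    show "v (pullback V \<pi> g) = \<zero>\<^bsub>C\<^sup>\<infinity> V\<^esub>"
    proof (rule V.carrier_eqI)
      show "v (pullback V \<pi> g) \<in> carrier (C\<^sup>\<infinity> V)"
        using v pullback_\<pi>[OF g] V.derivation_carrier V.carrier_fields by blast
      fix y assume y: "y \<in> pts V"
      have "v (pullback V \<pi> g) y = proj v (\<sigma> y) g (\<pi> y)"
        using y g by (simp add: pi_apply \<sigma>_pts \<pi>_pts i_proj)
      then show "v (pullback V \<pi> g) y = \<zero>\<^bsub>C\<^sup>\<infinity> V\<^esub> y"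
        using y g by (simp add: z FF_apply \<sigma>_pts \<pi>_pts V.fun_apply)
    qed (rule V.fun_closed)
  qed
next
  assume "\<forall>g\<in>carrier (C\<^sup>\<infinity> X). v (pullback V \<pi> g) = \<zero>\<^bsub>C\<^sup>\<infinity> V\<^esub>"
  then show "proj v = \<zero>\<^bsub>FF\<^esub>"
    using v by (intro FF_eqI) (simp_all add: pi_closed FF_zero_closed pi_apply FF_apply V.fun_apply i_pts)
qed

end

section \<open>Horizontal and vertical vector fields\<close>

context prod_mfd
begin

text \<open>By \<open>derivation_split\<close> this function is \<open>v f\<close> minus the
  horizontal part, so no second computation in coordinates is required. It supplies
  \<open>horizontal_part\<close> for the instance with the factors exchanged.\<close>

lemma vertical_part_carrier:
  assumes v: "v \<in> derivations (C\<^sup>\<infinity> V)" and f: "f \<in> carrier (C\<^sup>\<infinity> V)"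
  shows "(\<lambda>z\<in>pts V. v (pullback V snd (pullback N (emb_j (fst z)) f)) z) \<in> carrier (C\<^sup>\<infinity> V)"
proof -
  let ?H = "\<lambda>z\<in>pts V. v (pullback V fst (pullback M (emb_i (snd z)) f)) z"
  have "(\<lambda>z\<in>pts V. v (pullback V snd (pullback N (emb_j (fst z)) f)) z) =
      v f \<oplus>\<^bsub>C\<^sup>\<infinity> V\<^esub> ((-1) \<odot>\<^bsub>C\<^sup>\<infinity> V\<^esub> ?H)"
  proof (rule extensionalityI[of _ "pts V"])
    fix z assume z: "z \<in> pts V"
    obtain m n where mn: "z = (m, n)" by (cases z)
    show "(\<lambda>z\<in>pts V. v (pullback V snd (pullback N (emb_j (fst z)) f)) z) z =
        (v f \<oplus>\<^bsub>C\<^sup>\<infinity> V\<^esub> ((-1) \<odot>\<^bsub>C\<^sup>\<infinity> V\<^esub> ?H)) z"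
      unfolding V.fun_apply[OF z] restrict_apply'[OF z]
      using derivation_split[OF v f z[unfolded mn]] by (simp add: mn)
  qed (simp_all add: smooth_algebra_simps del: pts_prod)
  also have "\<dots> \<in> carrier (C\<^sup>\<infinity> V)"
    using V.derivation_carrier[OF v f] horizontal_part_carrier[OF v f] by (intro V.fun_closed)
  finally show ?thesis .
qed

sublocale MN: product_family M N V emb_i fst snd
  by unfold_locales
    ((rule pullback_i_carrier pullback_fst_carrier pullback_snd_carrier horizontal_part_carrier; assumption)
      | force simp: emb_i_def)+

sublocale NM: product_family N M V emb_j snd fst
  by unfold_locales
    ((rule pullback_j_carrier pullback_fst_carrier pullback_snd_carrier vertical_part_carrier; assumption)
      | force simp: emb_j_def)+

abbreviation "Hor \<equiv> horizontal_fields M N"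
abbreviation "Ver \<equiv> vertical_fields M N"

text \<open>Note the crossing: horizontal fields annihilate functions of the second factor, so they
  are the kernel of the projection to families on \<open>N\<close>.\<close>

lemma Hor_iff: "v \<in> Hor \<longleftrightarrow> v \<in> carrier (\<XX> V) \<and> NM.proj v = \<zero>\<^bsub>NM.FF\<^esub>"
  using NM.pi_zero_iff by (auto simp: horizontal_fields_def)

lemma Ver_iff: "v \<in> Ver \<longleftrightarrow> v \<in> carrier (\<XX> V) \<and> MN.proj v = \<zero>\<^bsub>MN.FF\<^esub>"
  using MN.pi_zero_iff by (auto simp: vertical_fields_def)

lemma submodule_Hor: "submodule Hor (C\<^sup>\<infinity> V) (\<XX> V)"
  using V.submodule_annihilator[of "pullback V snd ` carrier (C\<^sup>\<infinity> N)"] pullback_snd_carrier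
  unfolding horizontal_fields_def by auto

lemma submodule_Ver: "submodule Ver (C\<^sup>\<infinity> V) (\<XX> V)"
  using V.submodule_annihilator[of "pullback V fst ` carrier (C\<^sup>\<infinity> M)"] pullback_fst_carrier
  unfolding vertical_fields_def by auto

section \<open>Decomposition, projections, isomorphisms and the exact sequence\<close>

lemma iota_MN_Hor: "w \<in> carrier MN.FF \<Longrightarrow> MN.\<iota> w \<in> Hor"
  using MN.iota_closed MN.iota_annihilates by (simp add: horizontal_fields_def)

lemma iota_NM_Ver: "w \<in> carrier NM.FF \<Longrightarrow> NM.\<iota> w \<in> Ver"
  using NM.iota_closed NM.iota_annihilates by (simp add: vertical_fields_def)

text \<open>This is \<open>derivation_split\<close> at every function and point, since
  \<open>iota_pi_apply\<close> evaluates the two composites to its two summands.\<close>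

lemma decomposition:
  assumes v: "v \<in> carrier (\<XX> V)"
  shows "v = MN.\<iota> (MN.proj v) \<oplus>\<^bsub>\<XX> V\<^esub> NM.\<iota> (NM.proj v)"
proof (rule V.field_eqI[OF v])
  show "MN.\<iota> (MN.proj v) \<oplus>\<^bsub>\<XX> V\<^esub> NM.\<iota> (NM.proj v) \<in> carrier (\<XX> V)"
    by (intro V.field_closed MN.iota_closed NM.iota_closed MN.pi_closed NM.pi_closed v)
  fix f z assume f: "f \<in> carrier (C\<^sup>\<infinity> V)" and z: "z \<in> pts V"
  show "v f z = (MN.\<iota> (MN.proj v) \<oplus>\<^bsub>\<XX> V\<^esub> NM.\<iota> (NM.proj v)) f z"
    using derivation_split[OF _ f, of v "fst z" "snd z"] v z
    by (simp add: V.carrier_fields V.field_apply[OF f z] MN.iota_pi_apply[OF v f z]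
        NM.iota_pi_apply[OF v f z] del: pts_prod)
qed

lemma iota_zero: "MN.\<iota> \<zero>\<^bsub>MN.FF\<^esub> = \<zero>\<^bsub>\<XX> V\<^esub>" "NM.\<iota> \<zero>\<^bsub>NM.FF\<^esub> = \<zero>\<^bsub>\<XX> V\<^esub>"
  by (intro V.field_eqI; simp add: MN.iota_closed NM.iota_closed MN.FF_zero_closed NM.FF_zero_closed
      V.zero_field_closed MN.iota_apply NM.iota_apply MN.FF_apply NM.FF_apply V.field_apply
      MN.pullback_i NM.pullback_i mem_Times_iff)+

text \<open>In \<open>decomposition\<close> one of the two summands is the image of the zero
  family.\<close>

lemma Hor_eq: "v \<in> Hor \<Longrightarrow> MN.\<iota> (MN.proj v) = v"
  and Ver_eq: "v \<in> Ver \<Longrightarrow> NM.\<iota> (NM.proj v) = v"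
proof -
  interpret Module.module "C\<^sup>\<infinity> V" "\<XX> V"
    by (rule V.module_fields)
  show "MN.\<iota> (MN.proj v) = v" if "v \<in> Hor"
    using decomposition[of v] that MN.iota_closed[OF MN.pi_closed] by (simp add: Hor_iff iota_zero)
  show "NM.\<iota> (NM.proj v) = v" if "v \<in> Ver"
    using decomposition[of v] that NM.iota_closed[OF NM.pi_closed] by (simp add: Ver_iff iota_zero)
qed

text \<open>A field in both spaces equals its own horizontal part by \<open>Hor_eq\<close>, and this
  is the image of the zero family by \<open>Ver_iff\<close>.\<close>

lemma Hor_Int_Ver: "Hor \<inter> Ver = {\<zero>\<^bsub>\<XX> V\<^esub>}"
proof
  show "Hor \<inter> Ver \<subseteq> {\<zero>\<^bsub>\<XX> V\<^esub>}"
    using Hor_eq iota_zero by (force simp: Ver_iff)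
  have "MN.\<iota> \<zero>\<^bsub>MN.FF\<^esub> \<in> Hor" "NM.\<iota> \<zero>\<^bsub>NM.FF\<^esub> \<in> Ver"
    by (intro iota_MN_Hor MN.FF_zero_closed iota_NM_Ver NM.FF_zero_closed)+
  then show "{\<zero>\<^bsub>\<XX> V\<^esub>} \<subseteq> Hor \<inter> Ver"
    by (simp add: iota_zero)
qed

lemma direct_sum_Hor_Ver: "direct_sum_of (C\<^sup>\<infinity> V) (\<XX> V) Hor Ver"
  unfolding direct_sum_of_def
proof (intro conjI V.module_fields submodule_Hor submodule_Ver Hor_Int_Ver)
  show "Hor <+>\<^bsub>\<XX> V\<^esub> Ver = carrier (\<XX> V)"
  proof
    show "Hor <+>\<^bsub>\<XX> V\<^esub> Ver \<subseteq> carrier (\<XX> V)"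
      by (auto simp: set_add_def' Hor_iff Ver_iff V.field_closed)
    show "carrier (\<XX> V) \<subseteq> Hor <+>\<^bsub>\<XX> V\<^esub> Ver"
    proof
      fix v assume v: "v \<in> carrier (\<XX> V)"
      then have "MN.\<iota> (MN.proj v) \<in> Hor" "NM.\<iota> (NM.proj v) \<in> Ver"
        by (intro iota_MN_Hor iota_NM_Ver MN.pi_closed NM.pi_closed; assumption)+
      then show "v \<in> Hor <+>\<^bsub>\<XX> V\<^esub> Ver"
        using decomposition[OF v] unfolding set_add_def' by blast
    qed
  qed
qed

text \<open>Each projection kills the other summand. This gives uniqueness of components: from
  \<open>v = a \<oplus> b\<close> the family of \<open>a\<close> is that of \<open>v\<close>, and
  \<open>Hor_eq\<close> or \<open>Ver_eq\<close> recovers the component from its family.\<close>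

lemma proj_add_Hor_Ver:
  assumes a: "a \<in> Hor" and b: "b \<in> Ver"
  shows "MN.proj (a \<oplus>\<^bsub>\<XX> V\<^esub> b) = MN.proj a" "NM.proj (a \<oplus>\<^bsub>\<XX> V\<^esub> b) = NM.proj b"
proof -
  interpret MN: Module.module "C\<^sup>\<infinity> V" MN.FF
    by (rule MN.module_FF)
  interpret NM: Module.module "C\<^sup>\<infinity> V" NM.FF
    by (rule NM.module_FF)
  show "MN.proj (a \<oplus>\<^bsub>\<XX> V\<^esub> b) = MN.proj a"
    using MN.mod_hom_pi a b MN.pi_closed by (simp add: mod_hom_def Hor_iff Ver_iff)
  show "NM.proj (a \<oplus>\<^bsub>\<XX> V\<^esub> b) = NM.proj b"
    using NM.mod_hom_pi a b NM.pi_closed by (simp add: mod_hom_def Hor_iff Ver_iff)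
qed

lemma summand_proj_Hor:
  assumes v: "v \<in> carrier (\<XX> V)"
  shows "summand_proj (\<XX> V) Hor Ver v = MN.\<iota> (MN.proj v)"
  unfolding summand_proj_def
proof (rule the_equality)
  show "MN.\<iota> (MN.proj v) \<in> Hor \<and> (\<exists>b\<in>Ver. v = MN.\<iota> (MN.proj v) \<oplus>\<^bsub>\<XX> V\<^esub> b)"
    using decomposition[OF v] iota_MN_Hor[OF MN.pi_closed[OF v]] iota_NM_Ver[OF NM.pi_closed[OF v]] by blast
  fix a assume "a \<in> Hor \<and> (\<exists>b\<in>Ver. v = a \<oplus>\<^bsub>\<XX> V\<^esub> b)"
  then show "a = MN.\<iota> (MN.proj v)"
    using proj_add_Hor_Ver(1) Hor_eq by metis
qed

lemma summand_proj_Ver: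
  assumes v: "v \<in> carrier (\<XX> V)"
  shows "summand_proj (\<XX> V) Ver Hor v = NM.\<iota> (NM.proj v)"
  unfolding summand_proj_def
proof (rule the_equality)
  interpret Module.module "C\<^sup>\<infinity> V" "\<XX> V"
    by (rule V.module_fields)
  \<comment> \<open>\<open>summand_proj\<close> expects the vertical component on the left, while
    \<open>decomposition\<close> has it on the right.\<close>
  have comm: "a \<oplus>\<^bsub>\<XX> V\<^esub> b = b \<oplus>\<^bsub>\<XX> V\<^esub> a" if "a \<in> Ver" "b \<in> Hor" for a b
    using that by (intro M.a_comm) (simp_all add: Hor_iff Ver_iff)
  show "NM.\<iota> (NM.proj v) \<in> Ver \<and> (\<exists>b\<in>Hor. v = NM.\<iota> (NM.proj v) \<oplus>\<^bsub>\<XX> V\<^esub> b)"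
    using decomposition[OF v] iota_MN_Hor[OF MN.pi_closed[OF v]] iota_NM_Ver[OF NM.pi_closed[OF v]] comm
    by metis
  fix a assume "a \<in> Ver \<and> (\<exists>b\<in>Hor. v = a \<oplus>\<^bsub>\<XX> V\<^esub> b)"
  then show "a = NM.\<iota> (NM.proj v)"
    using proj_add_Hor_Ver(2) Ver_eq comm by metis
qed

text \<open>The inverse is \<open>MN.proj\<close>: one composite is the identity by
  \<open>MN.pi_iota\<close>, the other by \<open>Hor_eq\<close>.\<close>

lemma mod_iso_MN: "mod_iso (C\<^sup>\<infinity> V) MN.FF (\<XX> V\<lparr>carrier := Hor\<rparr>) MN.\<iota>"
  unfolding mod_iso_def
proof
  show "mod_hom (C\<^sup>\<infinity> V) MN.FF (\<XX> V\<lparr>carrier := Hor\<rparr>) MN.\<iota>"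
    using MN.mod_hom_iota iota_MN_Hor submodule.submodule_is_module[OF submodule_Hor V.module_fields]
    by (auto simp: mod_hom_def)
  show "bij_betw MN.\<iota> (carrier MN.FF) (carrier (\<XX> V\<lparr>carrier := Hor\<rparr>))"
    using MN.pi_iota Hor_eq iota_MN_Hor MN.pi_closed Hor_iff
    by (intro bij_betw_byWitness[where f' = MN.proj]) auto
qed

lemma mod_iso_NM: "mod_iso (C\<^sup>\<infinity> V) NM.FF (\<XX> V\<lparr>carrier := Ver\<rparr>) NM.\<iota>"
  unfolding mod_iso_def
proof
  show "mod_hom (C\<^sup>\<infinity> V) NM.FF (\<XX> V\<lparr>carrier := Ver\<rparr>) NM.\<iota>"
    using NM.mod_hom_iota iota_NM_Ver submodule.submodule_is_module[OF submodule_Ver V.module_fields]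
    by (auto simp: mod_hom_def)
  show "bij_betw NM.\<iota> (carrier NM.FF) (carrier (\<XX> V\<lparr>carrier := Ver\<rparr>))"
    using NM.pi_iota Ver_eq iota_NM_Ver NM.pi_closed Ver_iff
    by (intro bij_betw_byWitness[where f' = NM.proj]) auto
qed

text \<open>In the middle, the image of \<open>MN.\<iota>\<close> and the kernel of
  \<open>NM.proj\<close> are both the space of horizontal fields. At the ends,
  \<open>MN.pi_iota\<close> and \<open>NM.pi_iota\<close> provide a left inverse of the first map
  and a right inverse of the second.\<close>

lemma short_exact_MN_NM: "short_exact (C\<^sup>\<infinity> V) MN.FF MN.\<iota> (\<XX> V) NM.proj NM.FF"
  unfolding short_exact_def
proof (intro conjI MN.mod_hom_iota NM.mod_hom_pi)
  show "a_kernel MN.FF (\<XX> V) MN.\<iota> = {\<zero>\<^bsub>MN.FF\<^esub>}"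
    unfolding a_kernel_def'
  proof
    show "{w \<in> carrier MN.FF. MN.\<iota> w = \<zero>\<^bsub>\<XX> V\<^esub>} \<subseteq> {\<zero>\<^bsub>MN.FF\<^esub>}"
      using MN.pi_iota MN.FF_zero_closed iota_zero(1) by (auto, metis)
  qed (use MN.FF_zero_closed iota_zero in auto)
  show "MN.\<iota> ` carrier MN.FF = a_kernel (\<XX> V) NM.FF NM.proj"
  proof
    show "MN.\<iota> ` carrier MN.FF \<subseteq> a_kernel (\<XX> V) NM.FF NM.proj"
      using iota_MN_Hor by (auto simp: a_kernel_def' Hor_iff)
    show "a_kernel (\<XX> V) NM.FF NM.proj \<subseteq> MN.\<iota> ` carrier MN.FF"
    proof
      fix v assume "v \<in> a_kernel (\<XX> V) NM.FF NM.proj"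
      then have "v \<in> Hor"
        by (simp add: a_kernel_def' Hor_iff)
      then show "v \<in> MN.\<iota> ` carrier MN.FF"
        using Hor_eq MN.pi_closed Hor_iff by (metis image_eqI)
    qed
  qed
  show "NM.proj ` carrier (\<XX> V) = carrier NM.FF"
  proof
    show "NM.proj ` carrier (\<XX> V) \<subseteq> carrier NM.FF"
      using NM.pi_closed by auto
    show "carrier NM.FF \<subseteq> NM.proj ` carrier (\<XX> V)"
      using NM.pi_iota NM.iota_closed by (metis image_eqI subsetI)
  qed
qed

end

theorem mainTheorem1:
  fixes M :: "('a, 'e::euclidean_space) manifold"
    and N :: "('b, 'f::euclidean_space) manifold"
    and V :: "('a \<times> 'b, 'e \<times> 'f) manifold"
  assumes "smooth_manifold M" and "smooth_manifold N" and "V = prod_manifold M N"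
  shows
    "direct_sum_of (C\<^sup>\<infinity> V) (\<XX> V) (horizontal_fields M N) (vertical_fields M N) \<and>
     (mod_hom (C\<^sup>\<infinity> V) (\<XX> V) (fields_MN M N) (pi_MN M N) \<and>
      mod_hom (C\<^sup>\<infinity> V) (\<XX> V) (fields_NM M N) (pi_NM M N) \<and>
      (\<forall>v\<in>carrier (\<XX> V).
         summand_proj (\<XX> V) (horizontal_fields M N) (vertical_fields M N) v =
           (iota_MN M N \<circ> pi_MN M N) v \<and>
         summand_proj (\<XX> V) (vertical_fields M N) (horizontal_fields M N) v =
           (iota_NM M N \<circ> pi_NM M N) v)) \<and>
     (mod_iso (C\<^sup>\<infinity> V) (fields_MN M N) (\<XX> V\<lparr>carrier := horizontal_fields M N\<rparr>) (iota_MN M N) \<and>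
      mod_iso (C\<^sup>\<infinity> V) (fields_NM M N) (\<XX> V\<lparr>carrier := vertical_fields M N\<rparr>) (iota_NM M N)) \<and>
     short_exact (C\<^sup>\<infinity> V) (fields_MN M N) (iota_MN M N) (\<XX> V) (pi_NM M N) (fields_NM M N)"
proof -
  interpret prod_mfd M N
    using assms(1,2) by unfold_locales
  show ?thesis
    unfolding assms(3) fields_MN_def fields_NM_def iota_MN_def iota_NM_def pi_MN_def pi_NM_def o_def
    by (intro conjI ballI direct_sum_Hor_Ver MN.mod_hom_pi NM.mod_hom_pi summand_proj_Hor summand_proj_Ver
        mod_iso_MN mod_iso_NM short_exact_MN_NM)
qed

end
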